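(* Let $C$ be a category with pullbacks, $B$ a bicategory, and $\mathcal{S}=(U,V,\mathrm{BC})$ a $B$-valued Pith-Beck-Chevalley system on $C$. Then there is a pseudofunctor $\mathcal{F}_{\mathcal{S}}:\mathrm{Pith}(\mathrm{Span}(C))\to B$ such that: (1) $\mathcal{F}_{\mathcal{S}}(c)=U(c)$ for every $c\in C$; (2) for a span $S:c\xleftarrow{f}\widehat S\xrightarrow{g}c'$, $\mathcal{F}_{\mathcal{S}}(S)=U(g)V(f)$; (3) for spans $S:c\xleftarrow{f}\widehat S\xrightarrow{g}c'$, $S':c\xleftarrow{f'}\widehat{S'}\xrightarrow{g'}c'$ and an isomorphism of spans $\phi:\widehat S\xrightarrow{\sim}\widehat{S'}$ (so $f=f'\phi$, $g=g'\phi$), the 2-morphism $\mathcal{F}_{\mathcal{S}}(\phi):U(g)V(f)\to U(g')V(f')$ equals the composite $U(g)V(f)=U(g'\phi)V(f'\phi)\xrightarrow{U_{\mathrm{comp}}\cdot V_{\mathrm{comp}}}(U(g')U(\phi))(V(\phi)V(f'))\xrightarrow{\alpha^{-1}}((U(g')U(\phi))V(\phi))V(f')\xrightarrow{\alpha\cdot V(f')}(U(g')(U(\phi)V(\phi)))V(f')\xrightarrow{(U(g')\cdot\eta_{\mathcal S}(\phi))\cdot V(f')}(U(g')\mathrm{Id})V(f')\xrightarrow{\rho\cdot V(f')}U(g')V(f')$; (4) for spans $S:c\xleftarrow{f}\widehat S\xrightarrow{g}c'$ and $S':c'\xleftarrow{h}\widehat{S'}\xrightarrow{k}c''$, with composite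 apex $\widehat{S'S}=\widehat S\times_{c'}\widehat{S'}$ and projections $\pi_1:\widehat{S'S}\to\widehat S$, $\pi_2:\widehat{S'S}\to\widehat{S'}$, the composition isomorphism $(\mathcal{F}_{\mathcal{S}})_{\mathrm{comp},S,S'}:U(k\pi_2)V(f\pi_1)\to(U(k)V(h))(U(g)V(f))$ equals the composite $U(k\pi_2)V(f\pi_1)\xrightarrow{U_{\mathrm{comp}}\cdot V_{\mathrm{comp}}}(U(k)U(\pi_2))(V(\pi_1)V(f))\xrightarrow{\alpha^{-1}}((U(k)U(\pi_2))V(\pi_1))V(f)\xrightarrow{\alpha\cdot V(f)}(U(k)(U(\pi_2)V(\pi_1)))V(f)\xrightarrow{(U(k)\cdot\mathrm{BC}(\mathrm{Cs})^{-1})\cdot V(f)}(U(k)(V(h)U(g)))V(f)\xrightarrow{\alpha^{-1}\cdot V(f)}((U(k)V(h))U(g))V(f)\xrightarrow{\alpha}(U(k)V(h))(U(g)V(f))$, where $\mathrm{Cs}$ is the pullback square with top $\pi_1$, left $\pi_2$, right $g$, bottom $h$; (5) for $c\in C$, the unit isomorphism $(\mathcal F_{\mathcal S})_{\mathrm{Id}_c}:U(\mathrm{Id}_c)V(\mathrm{Id}_c)\to\mathrm{Id}$ equals $\lambda\circ(U_{\mathrm{Id}_c}\cdot V_{\mathrm{Id}_c})$.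
   Context: For a category $C$ with pullbacks, $\mathrm{Span}(C)$ is the bicategory with objects those of $C$, 1-morphisms spans $c\xleftarrow{l}\widehat S\xrightarrow{r}c'$, 2-morphisms maps of apices commuting with legs, composition by pullback, and canonical associators/unitors; $\mathrm{Pith}(\mathsf{B})$ is the sub-bicategory of a bicategory $\mathsf{B}$ keeping all objects and 1-morphisms but only invertible 2-morphisms. In a bicategory, $\alpha,\lambda,\rho$ denote associators and left/right unitors, $\cdot$ denotes whiskering, and composition of 1-morphisms is written $yx$ for $x$ then $y$. A $B$-valued Pith-Beck-Chevalley system on $C$ consists of: pseudofunctors $U:C\to B$ and $V:C^{\mathrm{op}}\to B$ agreeing on objects (with composition isomorphisms $U_{\mathrm{comp}}:U(gf)\cong U(g)U(f)$, $V_{\mathrm{comp}}:V(gf)\cong V(f)V(g)$ and unit isomorphisms $U_{\mathrm{Id}}:U(\mathrm{Id})\cong\mathrm{Id}$, $V_{\mathrm{Id}}:V(\mathrm{Id})\cong\mathrm{Id}$); and for every pullback square $S$ in $C$ with top $t:c_0\to c_1$, left $l:c_0\to c_2$, right $r:c_1\to c_3$, bottom $b:c_2\to c_3$, an isomorphism $\mathrm{BC}(S):V(b)U(r)\xrightarrow{\sim}U(l)V(t)$. These must satisfy: (horizontal pasting) for pullback squares $L$ (top $t_0$, left $v_0$, right $v_1$, bottom $b_0$) and $R$ (top $t_1$, left $v_1$, right $v_2$, bottom $b_1$) with pasted square $\mathrm{hcomp}(L,R)$, $(U(v_0)\cdot V_{\mathrm{comp}})\circ\mathrm{BC}(\mathrm{hcomp}(L,R))=\alpha\circ(\mathrm{BC}(L)\cdot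 V(t_1))\circ\alpha^{-1}\circ(V(b_0)\cdot\mathrm{BC}(R))\circ\alpha\circ(V_{\mathrm{comp}}\cdot U(v_2))$; (vertical pasting) for pullback squares $T$ (top $h_0$, left $l_0$, right $r_0$, bottom $h_1$) and $B$ (top $h_1$, left $l_1$, right $r_1$, bottom $h_2$) with pasted square $\mathrm{vcomp}(T,B)$, $(U_{\mathrm{comp}}\cdot V(h_0))\circ\mathrm{BC}(\mathrm{vcomp}(T,B))=\alpha^{-1}\circ(U(l_1)\cdot\mathrm{BC}(T))\circ\alpha\circ(\mathrm{BC}(B)\cdot U(r_0))\circ\alpha^{-1}\circ(V(h_2)\cdot U_{\mathrm{comp}})$; (horizontal unit squares) for $f:x\to y$ and the square with top $\mathrm{Id}_x$, left $f$, right $f$, bottom $\mathrm{Id}_y$, $\rho\circ(U(f)\cdot V_{\mathrm{Id}})\circ\mathrm{BC}=\lambda\circ(V_{\mathrm{Id}}\cdot U(f))$; (vertical unit squares) for $f:x\to y$ and the square with top $f$, left $\mathrm{Id}_x$, right $\mathrm{Id}_y$, bottom $f$, $\lambda\circ(U_{\mathrm{Id}}\cdot V(f))\circ\mathrm{BC}=\rho\circ(V(f)\cdot U_{\mathrm{Id}})$. For an isomorphism $\phi:x\to y$ in $C$, $\eta_{\mathcal S}(\phi):U(\phi)V(\phi)\to\mathrm{Id}_y$ is the composite $\lambda\circ(V_{\mathrm{Id}}\cdot U_{\mathrm{Id}})\circ\mathrm{BC}(S)^{-1}$ where $S$ is the pullback square with top $\phi$, left $\phi$, right $\mathrm{Id}_y$,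 bottom $\mathrm{Id}_y$. *)

theory Defs
  imports Main
begin

record ('o,'a) cat =
  cOb   :: "'o set"
  cAr   :: "'a set"
  cdom  :: "'a \<Rightarrow> 'o"
  ccod  :: "'a \<Rightarrow> 'o"
  ccomp :: "'a \<Rightarrow> 'a \<Rightarrow> 'a"   (* ccomp g f = g o f, i.e. f then g *)
  cid   :: "'o \<Rightarrow> 'a"

definition category :: "('o,'a) cat \<Rightarrow> bool" where
  "category C \<longleftrightarrow>
    (\<forall>f\<in>cAr C. cdom C f \<in> cOb C \<and> ccod C f \<in> cOb C) \<and>
    (\<forall>c\<in>cOb C. cid C c \<in> cAr C \<and> cdom C (cid C c) = c \<and> ccod C (cid C c) = c) \<and>
    (\<forall>f\<in>cAr C. \<forall>g\<in>cAr C. cdom C g = ccod C f \<longrightarrow>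
        ccomp C g f \<in> cAr C \<and> cdom C (ccomp C g f) = cdom C f \<and> ccod C (ccomp C g f) = ccod C g) \<and>
    (\<forall>f\<in>cAr C. ccomp C (cid C (ccod C f)) f = f \<and> ccomp C f (cid C (cdom C f)) = f) \<and>
    (\<forall>f\<in>cAr C. \<forall>g\<in>cAr C. \<forall>h\<in>cAr C. cdom C g = ccod C f \<and> cdom C h = ccod C g \<longrightarrow>
        ccomp C h (ccomp C g f) = ccomp C (ccomp C h g) f)"

definition cop :: "('o,'a) cat \<Rightarrow> ('o,'a) cat" where
  "cop C = C\<lparr>cdom := ccod C, ccod := cdom C, ccomp := (\<lambda>g f. ccomp C f g)\<rparr>"

text \<open>A commutative square with top t (c0 to c1), left l (c0 to c2), right r (c1 to c3),
  bottom b (c2 to c3), which is a pullback square.\<close>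
definition is_pullback :: "('o,'a) cat \<Rightarrow> 'a \<Rightarrow> 'a \<Rightarrow> 'a \<Rightarrow> 'a \<Rightarrow> bool" where
  "is_pullback C t l r b \<longleftrightarrow>
    t \<in> cAr C \<and> l \<in> cAr C \<and> r \<in> cAr C \<and> b \<in> cAr C \<and>
    cdom C t = cdom C l \<and> ccod C t = cdom C r \<and> ccod C l = cdom C b \<and> ccod C r = ccod C b \<and>
    ccomp C r t = ccomp C b l \<and>
    (\<forall>t'\<in>cAr C. \<forall>l'\<in>cAr C. cdom C t' = cdom C l' \<and> ccod C t' = cdom C r \<and> ccod C l' = cdom C b \<and>
        ccomp C r t' = ccomp C b l' \<longrightarrow>
      (\<exists>!u. u \<in> cAr C \<and> cdom C u = cdom C t' \<and> ccod C u = cdom C t \<and>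
             ccomp C t u = t' \<and> ccomp C l u = l'))"

definition has_pullbacks :: "('o,'a) cat \<Rightarrow> bool" where
  "has_pullbacks C \<longleftrightarrow>
    (\<forall>r\<in>cAr C. \<forall>b\<in>cAr C. ccod C r = ccod C b \<longrightarrow> (\<exists>t l. is_pullback C t l r b))"

definition pbk :: "('o,'a) cat \<Rightarrow> 'a \<Rightarrow> 'a \<Rightarrow> 'a \<times> 'a" where
  "pbk C r b = (SOME (t, l). is_pullback C t l r b)"

definition pbmap :: "('o,'a) cat \<Rightarrow> 'a \<times> 'a \<Rightarrow> 'a \<Rightarrow> 'a \<Rightarrow> 'a" where
  "pbmap C P x y = (THE u. u \<in> cAr C \<and> cdom C u = cdom C x \<and> ccod C u = cdom C (fst P) \<and>
                          ccomp C (fst P) u = x \<and> ccomp C (snd P) u = y)"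

record ('o,'c,'t) bicat =
  bObj   :: "'o set"
  bHom   :: "'c set"
  bsrc   :: "'c \<Rightarrow> 'o"
  btrg   :: "'c \<Rightarrow> 'o"
  bCell  :: "'t set"
  bdom   :: "'t \<Rightarrow> 'c"
  bcod   :: "'t \<Rightarrow> 'c"
  bvc    :: "'t \<Rightarrow> 't \<Rightarrow> 't"         (* vertical composition: bvc \<beta> \<alpha> = \<beta> \<circ> \<alpha> *)
  bhc    :: "'c \<Rightarrow> 'c \<Rightarrow> 'c"         (* bhc y x = y x, i.e. x then y *)
  bhcc   :: "'t \<Rightarrow> 't \<Rightarrow> 't"
  bid    :: "'o \<Rightarrow> 'c"
  bidc   :: "'c \<Rightarrow> 't"
  bassoc :: "'c \<Rightarrow> 'c \<Rightarrow> 'c \<Rightarrow> 't"   (* bassoc z y x : (z y) x \<Rightarrow> z (y x) *)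
  blu    :: "'c \<Rightarrow> 't"               (* left unitor  : Id x \<Rightarrow> x *)
  bru    :: "'c \<Rightarrow> 't"               (* right unitor : x Id \<Rightarrow> x *)

definition biso :: "('o,'c,'t) bicat \<Rightarrow> 't \<Rightarrow> bool" where
  "biso B \<alpha> \<longleftrightarrow> \<alpha> \<in> bCell B \<and>
     (\<exists>\<beta>\<in>bCell B. bdom B \<beta> = bcod B \<alpha> \<and> bcod B \<beta> = bdom B \<alpha> \<and>
        bvc B \<beta> \<alpha> = bidc B (bdom B \<alpha>) \<and> bvc B \<alpha> \<beta> = bidc B (bcod B \<alpha>))"

definition binv :: "('o,'c,'t) bicat \<Rightarrow> 't \<Rightarrow> 't" where
  "binv B \<alpha> = (THE \<beta>. \<beta> \<in> bCell B \<and> bdom B \<beta> = bcod B \<alpha> \<and> bcod B \<beta> = bdom B \<alpha> \<and>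
        bvc B \<beta> \<alpha> = bidc B (bdom B \<alpha>) \<and> bvc B \<alpha> \<beta> = bidc B (bcod B \<alpha>))"

definition bicategory :: "('o,'c,'t) bicat \<Rightarrow> bool" where
  "bicategory B \<longleftrightarrow>
    (\<forall>x\<in>bHom B. bsrc B x \<in> bObj B \<and> btrg B x \<in> bObj B) \<and>
    (\<forall>a\<in>bObj B. bid B a \<in> bHom B \<and> bsrc B (bid B a) = a \<and> btrg B (bid B a) = a) \<and>
    (\<forall>x\<in>bHom B. \<forall>y\<in>bHom B. bsrc B y = btrg B x \<longrightarrow>
        bhc B y x \<in> bHom B \<and> bsrc B (bhc B y x) = bsrc B x \<and> btrg B (bhc B y x) = btrg B y) \<and>
    (\<forall>\<alpha>\<in>bCell B. bdom B \<alpha> \<in> bHom B \<and> bcod B \<alpha> \<in> bHom B \<and>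
        bsrc B (bdom B \<alpha>) = bsrc B (bcod B \<alpha>) \<and> btrg B (bdom B \<alpha>) = btrg B (bcod B \<alpha>)) \<and>
    (\<forall>x\<in>bHom B. bidc B x \<in> bCell B \<and> bdom B (bidc B x) = x \<and> bcod B (bidc B x) = x) \<and>
    (\<forall>\<alpha>\<in>bCell B. \<forall>\<beta>\<in>bCell B. bcod B \<alpha> = bdom B \<beta> \<longrightarrow>
        bvc B \<beta> \<alpha> \<in> bCell B \<and> bdom B (bvc B \<beta> \<alpha>) = bdom B \<alpha> \<and> bcod B (bvc B \<beta> \<alpha>) = bcod B \<beta>) \<and>
    (\<forall>\<alpha>\<in>bCell B. bvc B (bidc B (bcod B \<alpha>)) \<alpha> = \<alpha> \<and> bvc B \<alpha> (bidc B (bdom B \<alpha>)) = \<alpha>) \<and>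
    (\<forall>\<alpha>\<in>bCell B. \<forall>\<beta>\<in>bCell B. \<forall>\<gamma>\<in>bCell B. bcod B \<alpha> = bdom B \<beta> \<and> bcod B \<beta> = bdom B \<gamma> \<longrightarrow>
        bvc B \<gamma> (bvc B \<beta> \<alpha>) = bvc B (bvc B \<gamma> \<beta>) \<alpha>) \<and>
    (\<forall>\<alpha>\<in>bCell B. \<forall>\<beta>\<in>bCell B. bsrc B (bdom B \<beta>) = btrg B (bdom B \<alpha>) \<longrightarrow>
        bhcc B \<beta> \<alpha> \<in> bCell B \<and> bdom B (bhcc B \<beta> \<alpha>) = bhc B (bdom B \<beta>) (bdom B \<alpha>) \<and>
        bcod B (bhcc B \<beta> \<alpha>) = bhc B (bcod B \<beta>) (bcod B \<alpha>)) \<and>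
    (\<forall>x\<in>bHom B. \<forall>y\<in>bHom B. bsrc B y = btrg B x \<longrightarrow>
        bhcc B (bidc B y) (bidc B x) = bidc B (bhc B y x)) \<and>
    (\<forall>\<alpha>\<in>bCell B. \<forall>\<alpha>'\<in>bCell B. \<forall>\<beta>\<in>bCell B. \<forall>\<beta>'\<in>bCell B.
        bcod B \<alpha> = bdom B \<alpha>' \<and> bcod B \<beta> = bdom B \<beta>' \<and> bsrc B (bdom B \<beta>) = btrg B (bdom B \<alpha>) \<longrightarrow>
        bhcc B (bvc B \<beta>' \<beta>) (bvc B \<alpha>' \<alpha>) = bvc B (bhcc B \<beta>' \<alpha>') (bhcc B \<beta> \<alpha>)) \<and>
    (\<forall>x\<in>bHom B. \<forall>y\<in>bHom B. \<forall>z\<in>bHom B. bsrc B y = btrg B x \<and> bsrc B z = btrg B y \<longrightarrow>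
        bassoc B z y x \<in> bCell B \<and> bdom B (bassoc B z y x) = bhc B (bhc B z y) x \<and>
        bcod B (bassoc B z y x) = bhc B z (bhc B y x) \<and> biso B (bassoc B z y x)) \<and>
    (\<forall>\<alpha>\<in>bCell B. \<forall>\<beta>\<in>bCell B. \<forall>\<gamma>\<in>bCell B.
        bsrc B (bdom B \<beta>) = btrg B (bdom B \<alpha>) \<and> bsrc B (bdom B \<gamma>) = btrg B (bdom B \<beta>) \<longrightarrow>
        bvc B (bassoc B (bcod B \<gamma>) (bcod B \<beta>) (bcod B \<alpha>)) (bhcc B (bhcc B \<gamma> \<beta>) \<alpha>) =
        bvc B (bhcc B \<gamma> (bhcc B \<beta> \<alpha>)) (bassoc B (bdom B \<gamma>) (bdom B \<beta>) (bdom B \<alpha>))) \<and>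
    (\<forall>x\<in>bHom B. blu B x \<in> bCell B \<and> bdom B (blu B x) = bhc B (bid B (btrg B x)) x \<and>
        bcod B (blu B x) = x \<and> biso B (blu B x)) \<and>
    (\<forall>\<alpha>\<in>bCell B. bvc B (blu B (bcod B \<alpha>)) (bhcc B (bidc B (bid B (btrg B (bdom B \<alpha>)))) \<alpha>) =
        bvc B \<alpha> (blu B (bdom B \<alpha>))) \<and>
    (\<forall>x\<in>bHom B. bru B x \<in> bCell B \<and> bdom B (bru B x) = bhc B x (bid B (bsrc B x)) \<and>
        bcod B (bru B x) = x \<and> biso B (bru B x)) \<and>
    (\<forall>\<alpha>\<in>bCell B. bvc B (bru B (bcod B \<alpha>)) (bhcc B \<alpha> (bidc B (bid B (bsrc B (bdom B \<alpha>))))) =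
        bvc B \<alpha> (bru B (bdom B \<alpha>))) \<and>
    (\<forall>x\<in>bHom B. \<forall>y\<in>bHom B. \<forall>z\<in>bHom B. \<forall>w\<in>bHom B.
        bsrc B y = btrg B x \<and> bsrc B z = btrg B y \<and> bsrc B w = btrg B z \<longrightarrow>
        bvc B (bhcc B (bidc B w) (bassoc B z y x))
              (bvc B (bassoc B w (bhc B z y) x) (bhcc B (bassoc B w z y) (bidc B x))) =
        bvc B (bassoc B w z (bhc B y x)) (bassoc B (bhc B w z) y x)) \<and>
    (\<forall>x\<in>bHom B. \<forall>y\<in>bHom B. bsrc B y = btrg B x \<longrightarrow>
        bvc B (bhcc B (bidc B y) (blu B x)) (bassoc B y (bid B (btrg B x)) x) =
        bhcc B (bru B y) (bidc B x))"

definition Pith :: "('o,'c,'t) bicat \<Rightarrow> ('o,'c,'t) bicat" where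
  "Pith B = B\<lparr>bCell := {\<alpha> \<in> bCell B. biso B \<alpha>}\<rparr>"

text \<open>A category viewed as a locally discrete bicategory (2-cells are identities,
  the identity 2-cell on f being represented by f itself).\<close>
definition ldisc :: "('o,'a) cat \<Rightarrow> ('o,'a,'a) bicat" where
  "ldisc C = \<lparr>bObj = cOb C, bHom = cAr C, bsrc = cdom C, btrg = ccod C,
     bCell = cAr C, bdom = id, bcod = id, bvc = (\<lambda>b a. a), bhc = ccomp C, bhcc = ccomp C,
     bid = cid C, bidc = id, bassoc = (\<lambda>z y x. ccomp C z (ccomp C y x)), blu = id, bru = id\<rparr>"

record ('o1,'c1,'t1,'o2,'c2,'t2) pfun =
  PO   :: "'o1 \<Rightarrow> 'o2"
  P1   :: "'c1 \<Rightarrow> 'c2"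
  P2   :: "'t1 \<Rightarrow> 't2"
  Pcmp :: "'c1 \<Rightarrow> 'c1 \<Rightarrow> 't2"   (* Pcmp F y x : F(y x) \<Rightarrow> F(y) F(x) *)
  Pid  :: "'o1 \<Rightarrow> 't2"           (* Pid F a : F(Id a) \<Rightarrow> Id (F a) *)

definition pseudofunctor ::
  "('o1,'c1,'t1) bicat \<Rightarrow> ('o2,'c2,'t2) bicat \<Rightarrow> ('o1,'c1,'t1,'o2,'c2,'t2) pfun \<Rightarrow> bool" where
  "pseudofunctor B B' F \<longleftrightarrow>
    (\<forall>a\<in>bObj B. PO F a \<in> bObj B') \<and>
    (\<forall>x\<in>bHom B. P1 F x \<in> bHom B' \<and> bsrc B' (P1 F x) = PO F (bsrc B x) \<and>
        btrg B' (P1 F x) = PO F (btrg B x)) \<and>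
    (\<forall>\<alpha>\<in>bCell B. P2 F \<alpha> \<in> bCell B' \<and> bdom B' (P2 F \<alpha>) = P1 F (bdom B \<alpha>) \<and>
        bcod B' (P2 F \<alpha>) = P1 F (bcod B \<alpha>)) \<and>
    (\<forall>x\<in>bHom B. P2 F (bidc B x) = bidc B' (P1 F x)) \<and>
    (\<forall>\<alpha>\<in>bCell B. \<forall>\<beta>\<in>bCell B. bcod B \<alpha> = bdom B \<beta> \<longrightarrow>
        P2 F (bvc B \<beta> \<alpha>) = bvc B' (P2 F \<beta>) (P2 F \<alpha>)) \<and>
    (\<forall>x\<in>bHom B. \<forall>y\<in>bHom B. bsrc B y = btrg B x \<longrightarrow>
        Pcmp F y x \<in> bCell B' \<and> bdom B' (Pcmp F y x) = P1 F (bhc B y x) \<and>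
        bcod B' (Pcmp F y x) = bhc B' (P1 F y) (P1 F x) \<and> biso B' (Pcmp F y x)) \<and>
    (\<forall>\<alpha>\<in>bCell B. \<forall>\<beta>\<in>bCell B. bsrc B (bdom B \<beta>) = btrg B (bdom B \<alpha>) \<longrightarrow>
        bvc B' (Pcmp F (bcod B \<beta>) (bcod B \<alpha>)) (P2 F (bhcc B \<beta> \<alpha>)) =
        bvc B' (bhcc B' (P2 F \<beta>) (P2 F \<alpha>)) (Pcmp F (bdom B \<beta>) (bdom B \<alpha>))) \<and>
    (\<forall>a\<in>bObj B. Pid F a \<in> bCell B' \<and> bdom B' (Pid F a) = P1 F (bid B a) \<and>
        bcod B' (Pid F a) = bid B' (PO F a) \<and> biso B' (Pid F a)) \<and>
    (\<forall>x\<in>bHom B. \<forall>y\<in>bHom B. \<forall>z\<in>bHom B. bsrc B y = btrg B x \<and> bsrc B z = btrg B y \<longrightarrow>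
        bvc B' (bassoc B' (P1 F z) (P1 F y) (P1 F x))
          (bvc B' (bhcc B' (Pcmp F z y) (bidc B' (P1 F x))) (Pcmp F (bhc B z y) x)) =
        bvc B' (bhcc B' (bidc B' (P1 F z)) (Pcmp F y x))
          (bvc B' (Pcmp F z (bhc B y x)) (P2 F (bassoc B z y x)))) \<and>
    (\<forall>x\<in>bHom B.
        bvc B' (blu B' (P1 F x))
          (bvc B' (bhcc B' (Pid F (btrg B x)) (bidc B' (P1 F x))) (Pcmp F (bid B (btrg B x)) x)) =
        P2 F (blu B x)) \<and>
    (\<forall>x\<in>bHom B.
        bvc B' (bru B' (P1 F x))
          (bvc B' (bhcc B' (bidc B' (P1 F x)) (Pid F (bsrc B x))) (Pcmp F x (bid B (bsrc B x)))) =
        P2 F (bru B x))"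

text \<open>A span c <-l- S -r-> c' is the pair (l, r), a 1-morphism from c to c'.
  A 2-morphism is a triple (S, S', u) with u an arrow between apices commuting with legs.
  Composition uses the chosen pullback pbk.\<close>

definition span_hc :: "('o,'a) cat \<Rightarrow> 'a \<times> 'a \<Rightarrow> 'a \<times> 'a \<Rightarrow> 'a \<times> 'a" where
  "span_hc C S' S =
     (ccomp C (fst S) (fst (pbk C (snd S) (fst S'))), ccomp C (snd S') (snd (pbk C (snd S) (fst S'))))"

definition span_hcc :: "('o,'a) cat \<Rightarrow> ('a\<times>'a)\<times>('a\<times>'a)\<times>'a \<Rightarrow> ('a\<times>'a)\<times>('a\<times>'a)\<times>'a \<Rightarrow> ('a\<times>'a)\<times>('a\<times>'a)\<times>'a" where
  "span_hcc C \<psi> \<phi> = (case (\<psi>, \<phi>) of ((T1, T2, v), (S1, S2, u)) \<Rightarrow>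
     (span_hc C T1 S1, span_hc C T2 S2,
      pbmap C (pbk C (snd S2) (fst T2))
        (ccomp C u (fst (pbk C (snd S1) (fst T1)))) (ccomp C v (snd (pbk C (snd S1) (fst T1))))))"

definition span_assoc :: "('o,'a) cat \<Rightarrow> 'a\<times>'a \<Rightarrow> 'a\<times>'a \<Rightarrow> 'a\<times>'a \<Rightarrow> ('a\<times>'a)\<times>('a\<times>'a)\<times>'a" where
  "span_assoc C z y x =
     (let f = fst x; g = snd x; h = fst y; k = snd y; m = fst z;
          R = pbk C k m; T = pbk C g (ccomp C h (fst R));
          P = pbk C g h; Q = pbk C (ccomp C k (snd P)) m
      in (span_hc C (span_hc C z y) x, span_hc C z (span_hc C y x),
          pbmap C Q (pbmap C P (fst T) (ccomp C (fst R) (snd T))) (ccomp C (snd R) (snd T))))"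

definition span_lu :: "('o,'a) cat \<Rightarrow> 'a\<times>'a \<Rightarrow> ('a\<times>'a)\<times>('a\<times>'a)\<times>'a" where
  "span_lu C x = (let b = ccod C (snd x) in
     (span_hc C (cid C b, cid C b) x, x, fst (pbk C (snd x) (cid C b))))"

definition span_ru :: "('o,'a) cat \<Rightarrow> 'a\<times>'a \<Rightarrow> ('a\<times>'a)\<times>('a\<times>'a)\<times>'a" where
  "span_ru C x = (let a = ccod C (fst x) in
     (span_hc C x (cid C a, cid C a), x, snd (pbk C (cid C a) (fst x))))"

definition span_bicat :: "('o,'a) cat \<Rightarrow> ('o, 'a\<times>'a, ('a\<times>'a)\<times>('a\<times>'a)\<times>'a) bicat" where
  "span_bicat C = \<lparr>
     bObj = cOb C,
     bHom = {(l, r). l \<in> cAr C \<and> r \<in> cAr C \<and> cdom C l = cdom C r},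
     bsrc = (\<lambda>S. ccod C (fst S)),
     btrg = (\<lambda>S. ccod C (snd S)),
     bCell = {(S, S', u). S \<in> {(l, r). l \<in> cAr C \<and> r \<in> cAr C \<and> cdom C l = cdom C r} \<and>
                          S' \<in> {(l, r). l \<in> cAr C \<and> r \<in> cAr C \<and> cdom C l = cdom C r} \<and>
                          ccod C (fst S) = ccod C (fst S') \<and> ccod C (snd S) = ccod C (snd S') \<and>
                          u \<in> cAr C \<and> cdom C u = cdom C (fst S) \<and> ccod C u = cdom C (fst S') \<and>
                          ccomp C (fst S') u = fst S \<and> ccomp C (snd S') u = snd S},
     bdom = fst,
     bcod = (\<lambda>\<sigma>. fst (snd \<sigma>)),
     bvc = (\<lambda>\<tau> \<sigma>. (fst \<sigma>, fst (snd \<tau>), ccomp C (snd (snd \<tau>)) (snd (snd \<sigma>)))),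
     bhc = span_hc C,
     bhcc = span_hcc C,
     bid = (\<lambda>c. (cid C c, cid C c)),
     bidc = (\<lambda>S. (S, S, cid C (cdom C (fst S)))),
     bassoc = span_assoc C,
     blu = span_lu C,
     bru = span_ru C \<rparr>"

text \<open>U : C -> B is a pseudofunctor on the locally discrete bicategory of C; V : C^op -> B likewise.
  Thus U_comp(g,f) = Pcmp U g f : U(g f) => U(g) U(f), and V_comp(g,f) = Pcmp V f g : V(g f) => V(f) V(g);
  U_Id = Pid U, V_Id = Pid V.  BC t l r b : V(b) U(r) => U(l) V(t).\<close>

definition pbc_system ::
  "('o,'a) cat \<Rightarrow> ('bo,'bc,'bt) bicat \<Rightarrow> ('o,'a,'a,'bo,'bc,'bt) pfun \<Rightarrow> ('o,'a,'a,'bo,'bc,'bt) pfun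
     \<Rightarrow> ('a \<Rightarrow> 'a \<Rightarrow> 'a \<Rightarrow> 'a \<Rightarrow> 'bt) \<Rightarrow> bool" where
  "pbc_system C B U V BC \<longleftrightarrow>
    pseudofunctor (ldisc C) B U \<and> pseudofunctor (ldisc (cop C)) B V \<and>
    (\<forall>c\<in>cOb C. PO U c = PO V c) \<and>
    (\<forall>t l r b. is_pullback C t l r b \<longrightarrow>
        BC t l r b \<in> bCell B \<and> bdom B (BC t l r b) = bhc B (P1 V b) (P1 U r) \<and>
        bcod B (BC t l r b) = bhc B (P1 U l) (P1 V t) \<and> biso B (BC t l r b)) \<and>
    (\<forall>t0 v0 v1 b0 t1 v2 b1. is_pullback C t0 v0 v1 b0 \<and> is_pullback C t1 v1 v2 b1 \<longrightarrow>
        bvc B (bhcc B (bidc B (P1 U v0)) (Pcmp V t0 t1)) (BC (ccomp C t1 t0) v0 v2 (ccomp C b1 b0)) =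
        bvc B (bassoc B (P1 U v0) (P1 V t0) (P1 V t1))
         (bvc B (bhcc B (BC t0 v0 v1 b0) (bidc B (P1 V t1)))
          (bvc B (binv B (bassoc B (P1 V b0) (P1 U v1) (P1 V t1)))
           (bvc B (bhcc B (bidc B (P1 V b0)) (BC t1 v1 v2 b1))
            (bvc B (bassoc B (P1 V b0) (P1 V b1) (P1 U v2))
             (bhcc B (Pcmp V b0 b1) (bidc B (P1 U v2)))))))) \<and>
    (\<forall>h0 l0 r0 h1 l1 r1 h2. is_pullback C h0 l0 r0 h1 \<and> is_pullback C h1 l1 r1 h2 \<longrightarrow>
        bvc B (bhcc B (Pcmp U l1 l0) (bidc B (P1 V h0))) (BC h0 (ccomp C l1 l0) (ccomp C r1 r0) h2) =
        bvc B (binv B (bassoc B (P1 U l1) (P1 U l0) (P1 V h0)))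
         (bvc B (bhcc B (bidc B (P1 U l1)) (BC h0 l0 r0 h1))
          (bvc B (bassoc B (P1 U l1) (P1 V h1) (P1 U r0))
           (bvc B (bhcc B (BC h1 l1 r1 h2) (bidc B (P1 U r0)))
            (bvc B (binv B (bassoc B (P1 V h2) (P1 U r1) (P1 U r0)))
             (bhcc B (bidc B (P1 V h2)) (Pcmp U r1 r0))))))) \<and>
    (\<forall>f\<in>cAr C.
        bvc B (bru B (P1 U f)) (bvc B (bhcc B (bidc B (P1 U f)) (Pid V (cdom C f)))
                                 (BC (cid C (cdom C f)) f f (cid C (ccod C f)))) =
        bvc B (blu B (P1 U f)) (bhcc B (Pid V (ccod C f)) (bidc B (P1 U f)))) \<and>
    (\<forall>f\<in>cAr C.
        bvc B (blu B (P1 V f)) (bvc B (bhcc B (Pid U (cdom C f)) (bidc B (P1 V f)))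
                                 (BC f (cid C (cdom C f)) (cid C (ccod C f)) f)) =
        bvc B (bru B (P1 V f)) (bhcc B (bidc B (P1 V f)) (Pid U (ccod C f))))"

text \<open>eta_S(phi) : U(phi) V(phi) => Id_y for an isomorphism phi : x -> y.\<close>
definition bc_eta ::
  "('o,'a) cat \<Rightarrow> ('bo,'bc,'bt) bicat \<Rightarrow> ('o,'a,'a,'bo,'bc,'bt) pfun \<Rightarrow> ('o,'a,'a,'bo,'bc,'bt) pfun
     \<Rightarrow> ('a \<Rightarrow> 'a \<Rightarrow> 'a \<Rightarrow> 'a \<Rightarrow> 'bt) \<Rightarrow> 'a \<Rightarrow> 'bt" where
  "bc_eta C B U V BC \<phi> = (let y = ccod C \<phi> in
     bvc B (blu B (bid B (PO U y)))
       (bvc B (bhcc B (Pid V y) (Pid U y)) (binv B (BC \<phi> \<phi> (cid C y) (cid C y)))))"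

end

theory Submission
  imports Defs
begin

text \<open>
  Every 2-cell between composites of 1-cells of \<open>B\<close> acts on right-normed composites: a cell from
  \<open>x\<^sub>1 \<dots> x\<^sub>m\<close> to \<open>y\<^sub>1 \<dots> y\<^sub>n\<close> induces, for each 1-cell \<open>w\<close>, a cell from
  \<open>x\<^sub>1 (\<dots> (x\<^sub>m w))\<close> to \<open>y\<^sub>1 (\<dots> (y\<^sub>n w))\<close>, naturally in \<open>w\<close>. Associators and unitors act as
  identities, and the action is faithful (take \<open>w = Id\<close>), so every identity can be checked as in a
  strict 2-category.

  In this strict calculus write \<open>\<theta>(t,l,r,b) : U(l) V(t) \<rightarrow> V(b) U(r)\<close> for the inverse Beck--Chevalley
  cell. Pasting \<open>(\<phi>,\<phi>,1,1)\<close> with the vertical unit square of \<open>t\<close> and then with \<open>(t,l,r,b)\<close> shows that,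
  for an isomorphism \<open>\<phi>\<close>, \<open>\<theta>(t\<phi>,l\<phi>,r,b) = \<theta>(t,l,r,b) \<circ> U(l) \<eta>(\<phi>) V(t) \<circ> (U_comp \<cdot> V_comp)\<close>.
  Functoriality on 2-cells is the case of the squares \<open>(\<psi>,\<psi>,1,1)\<close>; the unit axioms are the cases of
  the unit squares. Naturality of the composition cells follows by also moving isomorphisms across the other
  two corners of the square. For associativity, the iterated pullback has a corner square that pastes
  horizontally and vertically onto the two composition squares, and the two pasting axioms express
  both composites through that corner.
\<close>

section \<open>Bicategories\<close>

text \<open>The equations to be proved compare long composites with different bracketings in a
  bicategory that is not strict. The action on right-normed composites is a Cayley representation:
  whiskering on the right by an arbitrary \<open>w\<close> turns bracketing into composition of
  functions, and naturality in \<open>w\<close> lets cells at different places of a word slide past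
  each other.

  Inverse Beck--Chevalley cells are preferred to \<open>BC\<close> because the prescribed
  composition cells and \<open>eta\<close> both run in that direction.

  A second obstacle is the choice of pullbacks. Chosen pullbacks are not closed under pasting, are
  not preserved by isomorphisms of spans, and need not be trivial along an identity. The composition
  cell is therefore studied for every pullback square. Each comparison map between two pullbacks of
  the same cospan is invertible, and the rule for precomposing a square with an isomorphism absorbs
  it.\<close>

locale bicat_locale =
  fixes B :: "('bo,'bc,'bt) bicat"
  assumes bicat: "bicategory B"
begin

abbreviation vcomp (infixr "\<odot>" 60) where "\<sigma> \<odot> \<tau> \<equiv> bvc B \<sigma> \<tau>"
abbreviation hcomp1 (infixr "\<star>" 65) where "x \<star> y \<equiv> bhc B x y"
abbreviation hcomp2 (infixr "\<otimes>" 65) where "\<sigma> \<otimes> \<tau> \<equiv> bhcc B \<sigma> \<tau>"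
abbreviation Hom where "Hom \<equiv> bHom B"
abbreviation Cell where "Cell \<equiv> bCell B"
abbreviation src where "src \<equiv> bsrc B"
abbreviation trg where "trg \<equiv> btrg B"
abbreviation dom2 where "dom2 \<equiv> bdom B"
abbreviation cod2 where "cod2 \<equiv> bcod B"
abbreviation id1 where "id1 \<equiv> bid B"
abbreviation id2 where "id2 \<equiv> bidc B"
abbreviation ass where "ass \<equiv> bassoc B"

section \<open>The axioms of a bicategory as separate facts\<close>

lemmas bicat_axioms0 = bicat[unfolded bicategory_def]
lemmas bicat_axioms1 = bicat_axioms0[THEN conjunct2]
lemmas bicat_axioms2 = bicat_axioms1[THEN conjunct2]
lemmas bicat_axioms3 = bicat_axioms2[THEN conjunct2]
lemmas bicat_axioms4 = bicat_axioms3[THEN conjunct2]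
lemmas bicat_axioms5 = bicat_axioms4[THEN conjunct2]
lemmas bicat_axioms6 = bicat_axioms5[THEN conjunct2]
lemmas bicat_axioms7 = bicat_axioms6[THEN conjunct2]
lemmas bicat_axioms8 = bicat_axioms7[THEN conjunct2]
lemmas bicat_axioms9 = bicat_axioms8[THEN conjunct2]
lemmas bicat_axioms10 = bicat_axioms9[THEN conjunct2]
lemmas bicat_axioms11 = bicat_axioms10[THEN conjunct2]
lemmas bicat_axioms12 = bicat_axioms11[THEN conjunct2]
lemmas bicat_axioms13 = bicat_axioms12[THEN conjunct2]
lemmas bicat_axioms14 = bicat_axioms13[THEN conjunct2]
lemmas bicat_axioms15 = bicat_axioms14[THEN conjunct2]
lemmas bicat_axioms16 = bicat_axioms15[THEN conjunct2]
lemmas bicat_axioms17 = bicat_axioms16[THEN conjunct2]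
lemmas bicat_axioms18 = bicat_axioms17[THEN conjunct2]

lemma hom_obj [simp]: "x \<in> Hom \<Longrightarrow> src x \<in> bObj B" "x \<in> Hom \<Longrightarrow> trg x \<in> bObj B"
  using bicat_axioms0[THEN conjunct1] by simp_all

lemma id1_hom [simp]: "a \<in> bObj B \<Longrightarrow> id1 a \<in> Hom" "a \<in> bObj B \<Longrightarrow> src (id1 a) = a"
  "a \<in> bObj B \<Longrightarrow> trg (id1 a) = a"
  using bicat_axioms1[THEN conjunct1] by simp_all

lemma hcomp1_hom [simp]:
  "\<lbrakk>x \<in> Hom; y \<in> Hom; src y = trg x\<rbrakk> \<Longrightarrow> y \<star> x \<in> Hom"
  "\<lbrakk>x \<in> Hom; y \<in> Hom; src y = trg x\<rbrakk> \<Longrightarrow> src (y \<star> x) = src x"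
  "\<lbrakk>x \<in> Hom; y \<in> Hom; src y = trg x\<rbrakk> \<Longrightarrow> trg (y \<star> x) = trg y"
  using bicat_axioms2[THEN conjunct1] by simp_all

lemma cell_hom [simp]: "\<sigma> \<in> Cell \<Longrightarrow> dom2 \<sigma> \<in> Hom" "\<sigma> \<in> Cell \<Longrightarrow> cod2 \<sigma> \<in> Hom"
  "\<sigma> \<in> Cell \<Longrightarrow> src (cod2 \<sigma>) = src (dom2 \<sigma>)" "\<sigma> \<in> Cell \<Longrightarrow> trg (cod2 \<sigma>) = trg (dom2 \<sigma>)"
  using bicat_axioms3[THEN conjunct1] by simp_all

lemma id2_cell [simp]: "x \<in> Hom \<Longrightarrow> id2 x \<in> Cell" "x \<in> Hom \<Longrightarrow> dom2 (id2 x) = x"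
  "x \<in> Hom \<Longrightarrow> cod2 (id2 x) = x"
  using bicat_axioms4[THEN conjunct1] by simp_all

lemma vcomp_cell [simp]:
  "\<lbrakk>\<sigma> \<in> Cell; \<tau> \<in> Cell; cod2 \<sigma> = dom2 \<tau>\<rbrakk> \<Longrightarrow> \<tau> \<odot> \<sigma> \<in> Cell"
  "\<lbrakk>\<sigma> \<in> Cell; \<tau> \<in> Cell; cod2 \<sigma> = dom2 \<tau>\<rbrakk> \<Longrightarrow> dom2 (\<tau> \<odot> \<sigma>) = dom2 \<sigma>"
  "\<lbrakk>\<sigma> \<in> Cell; \<tau> \<in> Cell; cod2 \<sigma> = dom2 \<tau>\<rbrakk> \<Longrightarrow> cod2 (\<tau> \<odot> \<sigma>) = cod2 \<tau>"
  using bicat_axioms5[THEN conjunct1] by simp_all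

lemma vcomp_id [simp]: "\<lbrakk>\<sigma> \<in> Cell; x = cod2 \<sigma>\<rbrakk> \<Longrightarrow> id2 x \<odot> \<sigma> = \<sigma>"
  "\<lbrakk>\<sigma> \<in> Cell; x = dom2 \<sigma>\<rbrakk> \<Longrightarrow> \<sigma> \<odot> id2 x = \<sigma>"
  using bicat_axioms6[THEN conjunct1] by simp_all

lemma vassoc:
  "\<lbrakk>\<sigma> \<in> Cell; \<tau> \<in> Cell; \<upsilon> \<in> Cell; cod2 \<sigma> = dom2 \<tau>; cod2 \<tau> = dom2 \<upsilon>\<rbrakk>
    \<Longrightarrow> (\<upsilon> \<odot> \<tau>) \<odot> \<sigma> = \<upsilon> \<odot> \<tau> \<odot> \<sigma>"
  using bicat_axioms7[THEN conjunct1] by simp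

lemma hcomp2_cell [simp]:
  "\<lbrakk>\<sigma> \<in> Cell; \<tau> \<in> Cell; src (dom2 \<tau>) = trg (dom2 \<sigma>)\<rbrakk> \<Longrightarrow> \<tau> \<otimes> \<sigma> \<in> Cell"
  "\<lbrakk>\<sigma> \<in> Cell; \<tau> \<in> Cell; src (dom2 \<tau>) = trg (dom2 \<sigma>)\<rbrakk> \<Longrightarrow> dom2 (\<tau> \<otimes> \<sigma>) = dom2 \<tau> \<star> dom2 \<sigma>"
  "\<lbrakk>\<sigma> \<in> Cell; \<tau> \<in> Cell; src (dom2 \<tau>) = trg (dom2 \<sigma>)\<rbrakk> \<Longrightarrow> cod2 (\<tau> \<otimes> \<sigma>) = cod2 \<tau> \<star> cod2 \<sigma>"
  using bicat_axioms8[THEN conjunct1] by simp_all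

lemma hcomp2_id [simp]: "\<lbrakk>x \<in> Hom; y \<in> Hom; src y = trg x\<rbrakk> \<Longrightarrow> id2 y \<otimes> id2 x = id2 (y \<star> x)"
  using bicat_axioms9[THEN conjunct1] by simp_all

lemma interchange:
  "\<lbrakk>\<sigma> \<in> Cell; \<sigma>' \<in> Cell; \<tau> \<in> Cell; \<tau>' \<in> Cell; cod2 \<sigma> = dom2 \<sigma>'; cod2 \<tau> = dom2 \<tau>';
     src (dom2 \<tau>) = trg (dom2 \<sigma>)\<rbrakk> \<Longrightarrow> (\<tau>' \<odot> \<tau>) \<otimes> (\<sigma>' \<odot> \<sigma>) = (\<tau>' \<otimes> \<sigma>') \<odot> (\<tau> \<otimes> \<sigma>)"
  using bicat_axioms10[THEN conjunct1] by simp

lemma ass_cell [simp]: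
  "\<lbrakk>x \<in> Hom; y \<in> Hom; z \<in> Hom; src y = trg x; src z = trg y\<rbrakk> \<Longrightarrow> ass z y x \<in> Cell"
  "\<lbrakk>x \<in> Hom; y \<in> Hom; z \<in> Hom; src y = trg x; src z = trg y\<rbrakk> \<Longrightarrow> dom2 (ass z y x) = (z \<star> y) \<star> x"
  "\<lbrakk>x \<in> Hom; y \<in> Hom; z \<in> Hom; src y = trg x; src z = trg y\<rbrakk> \<Longrightarrow> cod2 (ass z y x) = z \<star> y \<star> x"
  "\<lbrakk>x \<in> Hom; y \<in> Hom; z \<in> Hom; src y = trg x; src z = trg y\<rbrakk> \<Longrightarrow> biso B (ass z y x)"
  using bicat_axioms11[THEN conjunct1] by simp_all

lemma ass_natural:
  "\<lbrakk>\<rho> \<in> Cell; \<sigma> \<in> Cell; \<tau> \<in> Cell; src (dom2 \<sigma>) = trg (dom2 \<rho>); src (dom2 \<tau>) = trg (dom2 \<sigma>)\<rbrakk> \<Longrightarrow>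
    ass (cod2 \<tau>) (cod2 \<sigma>) (cod2 \<rho>) \<odot> ((\<tau> \<otimes> \<sigma>) \<otimes> \<rho>) =
    (\<tau> \<otimes> \<sigma> \<otimes> \<rho>) \<odot> ass (dom2 \<tau>) (dom2 \<sigma>) (dom2 \<rho>)"
  using bicat_axioms12[THEN conjunct1] by simp

lemma lu_cell [simp]: "x \<in> Hom \<Longrightarrow> blu B x \<in> Cell" "x \<in> Hom \<Longrightarrow> dom2 (blu B x) = id1 (trg x) \<star> x"
  "x \<in> Hom \<Longrightarrow> cod2 (blu B x) = x" "x \<in> Hom \<Longrightarrow> biso B (blu B x)"
  using bicat_axioms13[THEN conjunct1] by simp_all

lemma lu_natural: "\<sigma> \<in> Cell \<Longrightarrow>
  blu B (cod2 \<sigma>) \<odot> (id2 (id1 (trg (dom2 \<sigma>))) \<otimes> \<sigma>) = \<sigma> \<odot> blu B (dom2 \<sigma>)"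
  using bicat_axioms14[THEN conjunct1] by simp_all

lemma ru_cell [simp]: "x \<in> Hom \<Longrightarrow> bru B x \<in> Cell" "x \<in> Hom \<Longrightarrow> dom2 (bru B x) = x \<star> id1 (src x)"
  "x \<in> Hom \<Longrightarrow> cod2 (bru B x) = x" "x \<in> Hom \<Longrightarrow> biso B (bru B x)"
  using bicat_axioms15[THEN conjunct1] by simp_all

lemma ru_natural: "\<sigma> \<in> Cell \<Longrightarrow>
  bru B (cod2 \<sigma>) \<odot> (\<sigma> \<otimes> id2 (id1 (src (dom2 \<sigma>)))) = \<sigma> \<odot> bru B (dom2 \<sigma>)"
  using bicat_axioms16[THEN conjunct1] by simp_all

lemma pentagon:
  "\<lbrakk>x \<in> Hom; y \<in> Hom; z \<in> Hom; w \<in> Hom; src y = trg x; src z = trg y; src w = trg z\<rbrakk> \<Longrightarrow>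
    (id2 w \<otimes> ass z y x) \<odot> ass w (z \<star> y) x \<odot> (ass w z y \<otimes> id2 x) =
    ass w z (y \<star> x) \<odot> ass (w \<star> z) y x"
  using bicat_axioms17[THEN conjunct1] by simp_all

lemma triangle:
  "\<lbrakk>x \<in> Hom; y \<in> Hom; src y = trg x\<rbrakk> \<Longrightarrow>
    (id2 y \<otimes> blu B x) \<odot> ass y (id1 (trg x)) x = bru B y \<otimes> id2 x"
  using bicat_axioms18 by simp_all

section \<open>Invertible 2-cells and cancellation\<close>

lemma iso_cell: "biso B \<sigma> \<Longrightarrow> \<sigma> \<in> Cell"
  by (simp add: biso_def)

lemma inv_cell [simp]:
  assumes "biso B \<sigma>"
  shows "binv B \<sigma> \<in> Cell" "dom2 (binv B \<sigma>) = cod2 \<sigma>" "cod2 (binv B \<sigma>) = dom2 \<sigma>"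
    "binv B \<sigma> \<odot> \<sigma> = id2 (dom2 \<sigma>)" "\<sigma> \<odot> binv B \<sigma> = id2 (cod2 \<sigma>)"
proof -
  let ?P = "\<lambda>\<beta>. \<beta> \<in> Cell \<and> dom2 \<beta> = cod2 \<sigma> \<and> cod2 \<beta> = dom2 \<sigma> \<and>
        \<beta> \<odot> \<sigma> = id2 (dom2 \<sigma>) \<and> \<sigma> \<odot> \<beta> = id2 (cod2 \<sigma>)"
  have cell: "\<sigma> \<in> Cell" using assms by (simp add: biso_def)
  obtain \<beta> where \<beta>: "?P \<beta>" using assms unfolding biso_def by blast
  have "\<beta>' = \<beta>" if "?P \<beta>'" for \<beta>'
  proof -
    have "\<beta>' = \<beta>' \<odot> \<sigma> \<odot> \<beta>" using that \<beta> cell by simp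
    also have "\<dots> = (\<beta>' \<odot> \<sigma>) \<odot> \<beta>" using that \<beta> cell by (subst vassoc) simp_all
    also have "\<dots> = \<beta>" using that \<beta> cell by simp
    finally show ?thesis .
  qed
  then have "?P (binv B \<sigma>)" unfolding binv_def using \<beta> by (rule theI[where P = ?P, rotated])
  then show "binv B \<sigma> \<in> Cell" "dom2 (binv B \<sigma>) = cod2 \<sigma>" "cod2 (binv B \<sigma>) = dom2 \<sigma>"
    "binv B \<sigma> \<odot> \<sigma> = id2 (dom2 \<sigma>)" "\<sigma> \<odot> binv B \<sigma> = id2 (cod2 \<sigma>)"
    by blast+
qed

lemma isoI: "\<lbrakk>\<sigma> \<in> Cell; \<tau> \<in> Cell; dom2 \<tau> = cod2 \<sigma>; cod2 \<tau> = dom2 \<sigma>; \<tau> \<odot> \<sigma> = id2 (dom2 \<sigma>);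
    \<sigma> \<odot> \<tau> = id2 (cod2 \<sigma>)\<rbrakk> \<Longrightarrow> biso B \<sigma>"
  unfolding biso_def by blast

lemma iso_monic:
  assumes "biso B \<sigma>" "\<tau> \<in> Cell" "\<tau>' \<in> Cell" "cod2 \<tau> = dom2 \<sigma>" "cod2 \<tau>' = dom2 \<sigma>" "\<sigma> \<odot> \<tau> = \<sigma> \<odot> \<tau>'"
  shows "\<tau> = \<tau>'"
proof -
  have "(binv B \<sigma> \<odot> \<sigma>) \<odot> \<tau> = (binv B \<sigma> \<odot> \<sigma>) \<odot> \<tau>'"
    using assms by (subst (1 2) vassoc) (simp_all add: iso_cell del: inv_cell(4,5))
  then show ?thesis using assms by (simp add: iso_cell)
qed

lemma iso_epic:
  assumes "biso B \<sigma>" "\<tau> \<in> Cell" "\<tau>' \<in> Cell" "dom2 \<tau> = cod2 \<sigma>" "dom2 \<tau>' = cod2 \<sigma>" "\<tau> \<odot> \<sigma> = \<tau>' \<odot> \<sigma>"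
  shows "\<tau> = \<tau>'"
proof -
  have "\<tau> \<odot> (\<sigma> \<odot> binv B \<sigma>) = \<tau>' \<odot> (\<sigma> \<odot> binv B \<sigma>)"
    using assms by (subst (1 2) vassoc[symmetric]) (simp_all add: iso_cell del: inv_cell(4,5))
  then show ?thesis using assms by (simp add: iso_cell)
qed

lemma iso_id2 [simp]: "x \<in> Hom \<Longrightarrow> biso B (id2 x)"
  by (rule isoI[of _ "id2 x"]) simp_all

lemma iso_binv [simp]: "biso B \<sigma> \<Longrightarrow> biso B (binv B \<sigma>)"
  by (rule isoI[of _ \<sigma>]) (simp_all add: iso_cell)

lemma iso_vcomp [simp]:
  assumes "biso B \<sigma>" "biso B \<tau>" "dom2 \<tau> = cod2 \<sigma>"
  shows "biso B (\<tau> \<odot> \<sigma>)"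
proof (rule isoI[of _ "binv B \<sigma> \<odot> binv B \<tau>"])
  have "(binv B \<sigma> \<odot> binv B \<tau>) \<odot> \<tau> \<odot> \<sigma> = binv B \<sigma> \<odot> (binv B \<tau> \<odot> \<tau>) \<odot> \<sigma>"
    using assms by (simp add: iso_cell vassoc del: inv_cell(4,5))
  then show "(binv B \<sigma> \<odot> binv B \<tau>) \<odot> \<tau> \<odot> \<sigma> = id2 (dom2 (\<tau> \<odot> \<sigma>))"
    using assms by (simp add: iso_cell)
  have "(\<tau> \<odot> \<sigma>) \<odot> binv B \<sigma> \<odot> binv B \<tau> = \<tau> \<odot> (\<sigma> \<odot> binv B \<sigma>) \<odot> binv B \<tau>"
    using assms by (simp add: iso_cell vassoc del: inv_cell(4,5))
  then show "(\<tau> \<odot> \<sigma>) \<odot> binv B \<sigma> \<odot> binv B \<tau> = id2 (cod2 (\<tau> \<odot> \<sigma>))"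
    using assms by (simp add: iso_cell)
qed (use assms in \<open>simp_all add: iso_cell\<close>)

lemma iso_hcomp2 [simp]:
  assumes "biso B \<sigma>" "biso B \<tau>" "src (dom2 \<tau>) = trg (dom2 \<sigma>)"
  shows "biso B (\<tau> \<otimes> \<sigma>)"
  by (rule isoI[of _ "binv B \<tau> \<otimes> binv B \<sigma>"])
    (use assms in \<open>simp_all add: iso_cell interchange[symmetric]\<close>)

section \<open>Whiskering and interchange\<close>

lemma lwhisker_vcomp:
  "\<lbrakk>x \<in> Hom; \<sigma> \<in> Cell; \<tau> \<in> Cell; dom2 \<tau> = cod2 \<sigma>; src x = trg (dom2 \<sigma>)\<rbrakk> \<Longrightarrow>
    id2 x \<otimes> (\<tau> \<odot> \<sigma>) = (id2 x \<otimes> \<tau>) \<odot> (id2 x \<otimes> \<sigma>)"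
  using interchange[of \<sigma> \<tau> "id2 x" "id2 x"] by simp

lemma rwhisker_vcomp:
  "\<lbrakk>x \<in> Hom; \<sigma> \<in> Cell; \<tau> \<in> Cell; dom2 \<tau> = cod2 \<sigma>; src (dom2 \<sigma>) = trg x\<rbrakk> \<Longrightarrow>
    (\<tau> \<odot> \<sigma>) \<otimes> id2 x = (\<tau> \<otimes> id2 x) \<odot> (\<sigma> \<otimes> id2 x)"
  using interchange[of "id2 x" "id2 x" \<sigma> \<tau>] by simp

lemma hcomp2_split:
  "\<lbrakk>\<sigma> \<in> Cell; \<tau> \<in> Cell; src (dom2 \<tau>) = trg (dom2 \<sigma>)\<rbrakk> \<Longrightarrow>
    (\<tau> \<otimes> id2 (cod2 \<sigma>)) \<odot> (id2 (dom2 \<tau>) \<otimes> \<sigma>) = \<tau> \<otimes> \<sigma>"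
  using interchange[of \<sigma> "id2 (cod2 \<sigma>)" "id2 (dom2 \<tau>)" \<tau>] by simp

lemma whisker_exchange:
  "\<lbrakk>\<sigma> \<in> Cell; \<tau> \<in> Cell; src (dom2 \<tau>) = trg (dom2 \<sigma>)\<rbrakk> \<Longrightarrow>
    (id2 (cod2 \<tau>) \<otimes> \<sigma>) \<odot> (\<tau> \<otimes> id2 (dom2 \<sigma>)) = (\<tau> \<otimes> id2 (cod2 \<sigma>)) \<odot> (id2 (dom2 \<tau>) \<otimes> \<sigma>)"
  using interchange[of \<sigma> "id2 (cod2 \<sigma>)" "id2 (dom2 \<tau>)" \<tau>]
    interchange[of "id2 (dom2 \<sigma>)" \<sigma> \<tau> "id2 (cod2 \<tau>)"] by simp

text \<open>The left unitor is natural and invertible, so whiskering by an identity is conjugate to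
  doing nothing.\<close>

lemma lwhisker_id1_faithful:
  assumes "\<sigma> \<in> Cell" "\<tau> \<in> Cell" "dom2 \<sigma> = dom2 \<tau>" "cod2 \<sigma> = cod2 \<tau>"
    and "id2 (id1 (trg (dom2 \<sigma>))) \<otimes> \<sigma> = id2 (id1 (trg (dom2 \<sigma>))) \<otimes> \<tau>"
  shows "\<sigma> = \<tau>"
  by (rule iso_epic[of "blu B (dom2 \<sigma>)"])
    (use assms lu_natural[of \<sigma>] lu_natural[of \<tau>] in simp_all)

text \<open>The mirror image, by the right unitor. It is what makes the action on right-normed
  composites faithful at \<open>w = id1 a\<close>.\<close>

lemma rwhisker_id1_faithful:
  assumes "\<sigma> \<in> Cell" "\<tau> \<in> Cell" "dom2 \<sigma> = dom2 \<tau>" "cod2 \<sigma> = cod2 \<tau>"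
    and "\<sigma> \<otimes> id2 (id1 (src (dom2 \<sigma>))) = \<tau> \<otimes> id2 (id1 (src (dom2 \<sigma>)))"
  shows "\<sigma> = \<tau>"
  by (rule iso_epic[of "bru B (dom2 \<sigma>)"])
    (use assms ru_natural[of \<sigma>] ru_natural[of \<tau>] in simp_all)

text \<open>Composites are nested to the right, so an equation about
  \<open>\<sigma> \<odot> \<tau>\<close> does not match at the head of a longer composite. This
  lemma and the next append the tail \<open>\<kappa>\<close>.\<close>

lemma vcomp_reassoc:
  "\<lbrakk>\<sigma> \<odot> \<tau> = \<upsilon>; \<sigma> \<in> Cell; \<tau> \<in> Cell; cod2 \<tau> = dom2 \<sigma>; \<kappa> \<in> Cell; cod2 \<kappa> = dom2 \<tau>\<rbrakk>
    \<Longrightarrow> \<sigma> \<odot> \<tau> \<odot> \<kappa> = \<upsilon> \<odot> \<kappa>"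
  using vassoc[of \<kappa> \<tau> \<sigma>] by simp

lemma vcomp_square_reassoc:
  "\<lbrakk>\<sigma> \<odot> \<tau> = \<upsilon> \<odot> \<phi>; \<sigma> \<in> Cell; \<tau> \<in> Cell; cod2 \<tau> = dom2 \<sigma>; \<upsilon> \<in> Cell; \<phi> \<in> Cell; cod2 \<phi> = dom2 \<upsilon>;
     \<kappa> \<in> Cell; cod2 \<kappa> = dom2 \<tau>\<rbrakk> \<Longrightarrow> \<sigma> \<odot> \<tau> \<odot> \<kappa> = \<upsilon> \<odot> \<phi> \<odot> \<kappa>"
  by (metis vassoc vcomp_cell(2))

text \<open>Kelly's observation that this triangle follows from the pentagon and the middle triangle.\<close>
lemma lu_hcomp1:
  assumes "x \<in> Hom" "y \<in> Hom" "src y = trg x"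
  shows "blu B (y \<star> x) \<odot> ass (id1 (trg y)) y x = blu B y \<otimes> id2 x"
proof (rule lwhisker_id1_faithful)
  let ?I = "id1 (trg y)"
  let ?A = "ass ?I (?I \<star> y) x" and ?A' = "ass ?I ?I y \<otimes> id2 x"
  \<comment> \<open>Both sides are whiskered by the identity \<open>?I\<close> and precomposed with
    the invertible cell \<open>?A \<odot> ?A'\<close>, where the pentagon applies. The triangle for
    \<open>bru B ?I\<close> is used twice, once at \<open>y \<star> x\<close> and once at
    \<open>y\<close>.\<close>
  have "(id2 ?I \<otimes> blu B (y \<star> x)) \<odot> (id2 ?I \<otimes> ass ?I y x) \<odot> ?A \<odot> ?A'
      = (id2 ?I \<otimes> blu B (y \<star> x)) \<odot> ass ?I ?I (y \<star> x) \<odot> ass (?I \<star> ?I) y x"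
    using assms by (simp add: pentagon)
  also have "\<dots> = (bru B ?I \<otimes> id2 (y \<star> x)) \<odot> ass (?I \<star> ?I) y x"
    by (rule vcomp_reassoc) (use assms triangle[of "y \<star> x" ?I] in simp_all)
  also have "\<dots> = ass ?I y x \<odot> ((bru B ?I \<otimes> id2 y) \<otimes> id2 x)"
    using assms ass_natural[of "id2 x" "id2 y" "bru B ?I"] by simp
  also have "(bru B ?I \<otimes> id2 y) \<otimes> id2 x = ((id2 ?I \<otimes> blu B y) \<otimes> id2 x) \<odot> ?A'"
    using assms by (simp add: triangle[of y ?I, symmetric] rwhisker_vcomp)
  also have "ass ?I y x \<odot> \<dots> = (id2 ?I \<otimes> blu B y \<otimes> id2 x) \<odot> ?A \<odot> ?A'"
    by (rule vcomp_square_reassoc) (use assms ass_natural[of "id2 x" "blu B y" "id2 ?I"] in simp_all)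
  finally have "(id2 ?I \<otimes> (blu B (y \<star> x) \<odot> ass ?I y x)) \<odot> ?A \<odot> ?A' =
      (id2 ?I \<otimes> blu B y \<otimes> id2 x) \<odot> ?A \<odot> ?A'"
    using assms by (simp add: lwhisker_vcomp vassoc)
  then have "id2 ?I \<otimes> (blu B (y \<star> x) \<odot> ass ?I y x) = id2 ?I \<otimes> blu B y \<otimes> id2 x"
    by (rule iso_epic[of "?A \<odot> ?A'", rotated -1]) (use assms in simp_all)
  then show "id2 (id1 (trg (dom2 (blu B (y \<star> x) \<odot> ass ?I y x)))) \<otimes> (blu B (y \<star> x) \<odot> ass ?I y x) =
      id2 (id1 (trg (dom2 (blu B (y \<star> x) \<odot> ass ?I y x)))) \<otimes> blu B y \<otimes> id2 x"
    using assms by simp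
qed (use assms in simp_all)

text \<open>Passes from a pasting law for Beck--Chevalley cells to one for their inverses:
  \<open>\<eta>\<close> is the cell of the pasted square, \<open>\<phi>\<close> and
  \<open>\<rho>\<close> come from the two pieces, and \<open>\<mu>\<close> and \<open>\<nu>\<close>
  come from composition isomorphisms, which keep their direction.\<close>

lemma vcomp_conjugate:
  assumes "\<nu> \<odot> \<eta> = \<phi> \<odot> \<rho> \<odot> \<mu>" "\<phi>i \<odot> \<phi> = id2 (dom2 \<phi>)" "\<rho>i \<odot> \<rho> = id2 (dom2 \<rho>)" "\<eta> \<odot> \<eta>i = id2 (cod2 \<eta>)"
    and [simp]: "\<nu> \<in> Cell" "\<eta> \<in> Cell" "\<phi> \<in> Cell" "\<rho> \<in> Cell" "\<mu> \<in> Cell" "\<phi>i \<in> Cell" "\<rho>i \<in> Cell" "\<eta>i \<in> Cell"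
      "dom2 \<nu> = cod2 \<eta>" "dom2 \<phi> = cod2 \<rho>" "dom2 \<rho> = cod2 \<mu>" "dom2 \<phi>i = cod2 \<phi>" "cod2 \<phi>i = cod2 \<rho>"
      "dom2 \<rho>i = cod2 \<rho>" "cod2 \<rho>i = cod2 \<mu>" "dom2 \<eta>i = cod2 \<eta>" "cod2 \<eta>i = dom2 \<mu>" "dom2 \<eta> = dom2 \<mu>"
      "cod2 \<phi> = cod2 \<nu>"
  shows "\<mu> \<odot> \<eta>i = \<rho>i \<odot> \<phi>i \<odot> \<nu>"
proof -
  have "\<rho>i \<odot> \<phi>i \<odot> \<nu> = \<rho>i \<odot> \<phi>i \<odot> \<nu> \<odot> \<eta> \<odot> \<eta>i"
    using assms(4) by simp
  also have "\<nu> \<odot> \<eta> \<odot> \<eta>i = \<phi> \<odot> \<rho> \<odot> \<mu> \<odot> \<eta>i"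
    using vcomp_reassoc[OF assms(1), of \<eta>i] by (simp add: vassoc)
  also have "\<phi>i \<odot> \<dots> = \<rho> \<odot> \<mu> \<odot> \<eta>i"
    using vcomp_reassoc[OF assms(2), of "\<rho> \<odot> \<mu> \<odot> \<eta>i"] by simp
  also have "\<rho>i \<odot> \<dots> = \<mu> \<odot> \<eta>i"
    using vcomp_reassoc[OF assms(3), of "\<mu> \<odot> \<eta>i"] by simp
  finally show ?thesis ..
qed

end

section \<open>Coherence\<close>

text \<open>Bracketing and units cannot be recovered from a 1-cell of \<open>B\<close>, so normal
  forms are computed from formal composites. \<open>Gen\<close> accepts any 1-cell, also a composite
  that is to be treated as one block.\<close>

datatype ('bo,'bc) expr = Gen 'bc | Unit 'bo | Comp "('bo,'bc) expr" "('bo,'bc) expr"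

context bicat_locale begin

section \<open>Formal composites and their normal forms\<close>

fun ev :: "('bo,'bc) expr \<Rightarrow> 'bc" where
  "ev (Gen x) = x"
| "ev (Unit a) = id1 a"
| "ev (Comp p q) = ev p \<star> ev q"

fun esrc :: "('bo,'bc) expr \<Rightarrow> 'bo" where
  "esrc (Gen x) = src x"
| "esrc (Unit a) = a"
| "esrc (Comp p q) = esrc q"

fun etrg :: "('bo,'bc) expr \<Rightarrow> 'bo" where
  "etrg (Gen x) = trg x"
| "etrg (Unit a) = a"
| "etrg (Comp p q) = etrg p"

fun wf_expr :: "('bo,'bc) expr \<Rightarrow> bool" where
  "wf_expr (Gen x) \<longleftrightarrow> x \<in> Hom"
| "wf_expr (Unit a) \<longleftrightarrow> a \<in> bObj B"
| "wf_expr (Comp p q) \<longleftrightarrow> wf_expr p \<and> wf_expr q \<and> esrc p = etrg q"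

text \<open>\<open>nf p w\<close> is the right-normed composite of the generators of \<open>p\<close> applied to \<open>w\<close>, with units dropped.\<close>
fun nf :: "('bo,'bc) expr \<Rightarrow> 'bc \<Rightarrow> 'bc" where
  "nf (Gen x) w = x \<star> w"
| "nf (Unit a) w = w"
| "nf (Comp p q) w = nf p (nf q w)"

text \<open>The 2-cell part of the functor whose effect on 1-cells is \<open>nf p\<close>.\<close>

fun act :: "('bo,'bc) expr \<Rightarrow> 'bt \<Rightarrow> 'bt" where
  "act (Gen x) \<kappa> = id2 x \<otimes> \<kappa>"
| "act (Unit a) \<kappa> = \<kappa>"
| "act (Comp p q) \<kappa> = act p (act q \<kappa>)"

text \<open>The canonical isomorphism from \<open>ev p \<star> w\<close> to \<open>nf p w\<close>. A
  unit always has something to its right here, so left unitors and associators suffice.\<close>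

fun nrm :: "('bo,'bc) expr \<Rightarrow> 'bc \<Rightarrow> 'bt" where
  "nrm (Gen x) w = id2 (x \<star> w)"
| "nrm (Unit a) w = blu B w"
| "nrm (Comp p q) w = nrm p (nf q w) \<odot> (id2 (ev p) \<otimes> nrm q w) \<odot> ass (ev p) (ev q) w"

lemma ev_hom [simp]:
  "wf_expr p \<Longrightarrow> ev p \<in> Hom \<and> src (ev p) = esrc p \<and> trg (ev p) = etrg p"
  by (induction p) simp_all

lemma nf_hom [simp]:
  "\<lbrakk>wf_expr p; w \<in> Hom; esrc p = trg w\<rbrakk> \<Longrightarrow>
    nf p w \<in> Hom \<and> src (nf p w) = src w \<and> trg (nf p w) = etrg p"
  by (induction p arbitrary: w) auto

lemma nrm_cell [simp]:
  "\<lbrakk>wf_expr p; w \<in> Hom; esrc p = trg w\<rbrakk> \<Longrightarrow>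
    nrm p w \<in> Cell \<and> dom2 (nrm p w) = ev p \<star> w \<and> cod2 (nrm p w) = nf p w \<and> biso B (nrm p w)"
  by (induction p arbitrary: w) auto

lemma act_cell [simp]:
  "\<lbrakk>wf_expr p; \<kappa> \<in> Cell; esrc p = trg (dom2 \<kappa>)\<rbrakk> \<Longrightarrow>
    act p \<kappa> \<in> Cell \<and> dom2 (act p \<kappa>) = nf p (dom2 \<kappa>) \<and> cod2 (act p \<kappa>) = nf p (cod2 \<kappa>)"
  by (induction p arbitrary: \<kappa>) auto

lemma act_id2 [simp]:
  "\<lbrakk>wf_expr p; w \<in> Hom; esrc p = trg w\<rbrakk> \<Longrightarrow> act p (id2 w) = id2 (nf p w)"
  by (induction p arbitrary: w) auto

text \<open>Each case is the naturality of the constraint cell that \<open>nrm\<close> uses there.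
  The outcome is a natural isomorphism between whiskering by \<open>ev p\<close> and the functor
  \<open>nf p\<close>.\<close>

lemma nrm_natural:
  "\<lbrakk>wf_expr p; \<kappa> \<in> Cell; esrc p = trg (dom2 \<kappa>)\<rbrakk> \<Longrightarrow>
    nrm p (cod2 \<kappa>) \<odot> (id2 (ev p) \<otimes> \<kappa>) = act p \<kappa> \<odot> nrm p (dom2 \<kappa>)"
proof (induction p arbitrary: \<kappa>)
  case (Gen x)
  then show ?case by simp
next
  case (Unit a)
  then show ?case using lu_natural[of \<kappa>] by simp
next
  case (Comp p q)
  let ?w = "dom2 \<kappa>" and ?w' = "cod2 \<kappa>"
  let ?P = "ev p" and ?Q = "ev q"
  have [simp]: "wf_expr p" "wf_expr q" "esrc p = etrg q" "esrc q = trg (dom2 \<kappa>)" "\<kappa> \<in> Cell"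
    using Comp.prems by simp_all
  have "nrm (Comp p q) ?w' \<odot> (id2 (ev (Comp p q)) \<otimes> \<kappa>)
     = nrm p (nf q ?w') \<odot> (id2 ?P \<otimes> nrm q ?w') \<odot> ass ?P ?Q ?w' \<odot> ((id2 ?P \<otimes> id2 ?Q) \<otimes> \<kappa>)"
    by (simp add: vassoc)
  also have "ass ?P ?Q ?w' \<odot> ((id2 ?P \<otimes> id2 ?Q) \<otimes> \<kappa>) = (id2 ?P \<otimes> id2 ?Q \<otimes> \<kappa>) \<odot> ass ?P ?Q ?w"
    using ass_natural[of \<kappa> "id2 ?Q" "id2 ?P"] by (simp del: hcomp2_id)
  also have "(id2 ?P \<otimes> nrm q ?w') \<odot> \<dots> = (id2 ?P \<otimes> (nrm q ?w' \<odot> (id2 ?Q \<otimes> \<kappa>))) \<odot> ass ?P ?Q ?w"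
    by (rule vcomp_reassoc) (simp_all add: lwhisker_vcomp)
  also have "nrm q ?w' \<odot> (id2 ?Q \<otimes> \<kappa>) = act q \<kappa> \<odot> nrm q ?w"
    using Comp.IH(2) by simp
  also have "(id2 ?P \<otimes> (act q \<kappa> \<odot> nrm q ?w)) \<odot> ass ?P ?Q ?w
      = (id2 ?P \<otimes> act q \<kappa>) \<odot> (id2 ?P \<otimes> nrm q ?w) \<odot> ass ?P ?Q ?w"
    by (simp add: lwhisker_vcomp vassoc)
  also have "nrm p (nf q ?w') \<odot> \<dots>
      = act p (act q \<kappa>) \<odot> nrm p (nf q ?w) \<odot> (id2 ?P \<otimes> nrm q ?w) \<odot> ass ?P ?Q ?w"
    by (rule vcomp_square_reassoc) (use Comp.IH(1)[of "act q \<kappa>"] in simp_all)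
  finally show ?case by simp
qed

section \<open>Denotations of 2-cells in the strict calculus\<close>

text \<open>\<open>den p q \<sigma> s\<close>: up to the canonical isomorphisms \<open>nrm\<close>, whiskering \<open>\<sigma>\<close> on the right by \<open>w\<close> is
  the cell \<open>s w\<close> between normal forms.\<close>
definition den :: "('bo,'bc) expr \<Rightarrow> ('bo,'bc) expr \<Rightarrow> 'bt \<Rightarrow> ('bc \<Rightarrow> 'bt) \<Rightarrow> bool" where
  "den p q \<sigma> s \<longleftrightarrow> wf_expr p \<and> wf_expr q \<and> esrc q = esrc p \<and> etrg q = etrg p \<and>
     \<sigma> \<in> Cell \<and> dom2 \<sigma> = ev p \<and> cod2 \<sigma> = ev q \<and>
     (\<forall>w\<in>Hom. esrc p = trg w \<longrightarrow> s w \<in> Cell \<and> dom2 (s w) = nf p w \<and> cod2 (s w) = nf q w \<and>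
        nrm q w \<odot> (\<sigma> \<otimes> id2 w) = s w \<odot> nrm p w)"

lemma denD:
  assumes "den p q \<sigma> s"
  shows "wf_expr p" "wf_expr q" "esrc q = esrc p" "etrg q = etrg p" "\<sigma> \<in> Cell" "dom2 \<sigma> = ev p" "cod2 \<sigma> = ev q"
    "\<lbrakk>w \<in> Hom; esrc p = trg w\<rbrakk> \<Longrightarrow> s w \<in> Cell"
    "\<lbrakk>w \<in> Hom; esrc p = trg w\<rbrakk> \<Longrightarrow> dom2 (s w) = nf p w"
    "\<lbrakk>w \<in> Hom; esrc p = trg w\<rbrakk> \<Longrightarrow> cod2 (s w) = nf q w"
    "\<lbrakk>w \<in> Hom; esrc p = trg w\<rbrakk> \<Longrightarrow> nrm q w \<odot> (\<sigma> \<otimes> id2 w) = s w \<odot> nrm p w"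
  using assms unfolding den_def by blast+

lemma den_id: "\<lbrakk>wf_expr p; x = ev p\<rbrakk> \<Longrightarrow> den p p (id2 x) (\<lambda>w. id2 (nf p w))"
  unfolding den_def by auto

lemma den_vcomp:
  assumes s: "den p q \<sigma> s" and t: "den q r \<tau> t"
  shows "den p r (\<tau> \<odot> \<sigma>) (\<lambda>w. t w \<odot> s w)"
proof -
  note [simp] = denD(1-10)[OF s] denD(1-10)[OF t]
  have "nrm r w \<odot> ((\<tau> \<odot> \<sigma>) \<otimes> id2 w) = (t w \<odot> s w) \<odot> nrm p w"
    if [simp]: "w \<in> Hom" "esrc p = trg w" for w
  proof -
    have "nrm r w \<odot> ((\<tau> \<odot> \<sigma>) \<otimes> id2 w) = nrm r w \<odot> (\<tau> \<otimes> id2 w) \<odot> (\<sigma> \<otimes> id2 w)"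
      by (simp add: rwhisker_vcomp)
    also have "\<dots> = t w \<odot> nrm q w \<odot> (\<sigma> \<otimes> id2 w)"
      by (rule vcomp_square_reassoc) (simp_all add: denD(11)[OF t])
    also have "\<dots> = (t w \<odot> s w) \<odot> nrm p w"
      by (simp add: denD(11)[OF s] vassoc)
    finally show ?thesis .
  qed
  then show ?thesis by (simp add: den_def)
qed

text \<open>Conjugation by the natural isomorphisms \<open>nrm\<close> turns this into the
  interchange of \<open>\<sigma>\<close> with \<open>\<kappa>\<close>. It is the form in which
  interchange is applied in the strict calculus.\<close>

lemma den_natural:
  assumes s: "den p q \<sigma> s" and "\<kappa> \<in> Cell" "esrc p = trg (dom2 \<kappa>)"
  shows "s (cod2 \<kappa>) \<odot> act p \<kappa> = act q \<kappa> \<odot> s (dom2 \<kappa>)"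
proof (rule iso_epic)
  note [simp] = denD(1-10)[OF s] assms(2,3)
  let ?w = "dom2 \<kappa>" and ?w' = "cod2 \<kappa>"
  have "(s ?w' \<odot> act p \<kappa>) \<odot> nrm p ?w = s ?w' \<odot> nrm p ?w' \<odot> (id2 (ev p) \<otimes> \<kappa>)"
    by (simp add: vassoc nrm_natural)
  also have "\<dots> = nrm q ?w' \<odot> (\<sigma> \<otimes> id2 ?w') \<odot> (id2 (ev p) \<otimes> \<kappa>)"
    by (rule vcomp_square_reassoc) (simp_all add: denD(11)[OF s])
  also have "(\<sigma> \<otimes> id2 ?w') \<odot> (id2 (ev p) \<otimes> \<kappa>) = (id2 (ev q) \<otimes> \<kappa>) \<odot> (\<sigma> \<otimes> id2 ?w)"
    using whisker_exchange[of \<kappa> \<sigma>] by simp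
  also have "nrm q ?w' \<odot> \<dots> = act q \<kappa> \<odot> nrm q ?w \<odot> (\<sigma> \<otimes> id2 ?w)"
    by (rule vcomp_square_reassoc) (simp_all add: nrm_natural)
  also have "\<dots> = (act q \<kappa> \<odot> s ?w) \<odot> nrm p ?w"
    by (simp add: denD(11)[OF s] vassoc)
  finally show "(s ?w' \<odot> act p \<kappa>) \<odot> nrm p ?w = (act q \<kappa> \<odot> s ?w) \<odot> nrm p ?w" .
  show "biso B (nrm p ?w)" by simp
qed (simp_all add: denD(1-10)[OF s] assms(2,3))

lemma den_hcomp2:
  assumes s: "den p p' \<sigma> s" and t: "den q q' \<tau> t" and pq: "esrc p = etrg q"
  shows "den (Comp p q) (Comp p' q') (\<sigma> \<otimes> \<tau>) (\<lambda>w. s (nf q' w) \<odot> act p (t w))"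
proof -
  note [simp] = denD(1-10)[OF s] denD(1-10)[OF t] pq
  let ?P = "ev p" and ?P' = "ev p'" and ?Q = "ev q" and ?Q' = "ev q'"
  have "nrm (Comp p' q') w \<odot> ((\<sigma> \<otimes> \<tau>) \<otimes> id2 w) = (s (nf q' w) \<odot> act p (t w)) \<odot> nrm (Comp p q) w"
    if [simp]: "w \<in> Hom" "esrc q = trg w" for w
  proof -
    have "nrm (Comp p' q') w \<odot> ((\<sigma> \<otimes> \<tau>) \<otimes> id2 w)
      = nrm p' (nf q' w) \<odot> (id2 ?P' \<otimes> nrm q' w) \<odot> ass ?P' ?Q' w \<odot> ((\<sigma> \<otimes> \<tau>) \<otimes> id2 w)"
      by (simp add: vassoc)
    also have "ass ?P' ?Q' w \<odot> ((\<sigma> \<otimes> \<tau>) \<otimes> id2 w) = (\<sigma> \<otimes> \<tau> \<otimes> id2 w) \<odot> ass ?P ?Q w"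
      using ass_natural[of "id2 w" \<tau> \<sigma>] by simp
    also have "(id2 ?P' \<otimes> nrm q' w) \<odot> \<dots> = (\<sigma> \<otimes> (nrm q' w \<odot> (\<tau> \<otimes> id2 w))) \<odot> ass ?P ?Q w"
      by (rule vcomp_reassoc)
        (use interchange[of "\<tau> \<otimes> id2 w" "nrm q' w" \<sigma> "id2 ?P'"] in simp_all)
    also have "nrm q' w \<odot> (\<tau> \<otimes> id2 w) = t w \<odot> nrm q w"
      by (simp add: denD(11)[OF t])
    \<comment> \<open>Of the two ways to split a horizontal composite, this one lets the right
      factor act first. It fixes the order of \<open>s\<close> and \<open>t\<close> in the
      denotation.\<close>
    also have "\<sigma> \<otimes> (t w \<odot> nrm q w) = (\<sigma> \<otimes> id2 (nf q' w)) \<odot> (id2 ?P \<otimes> (t w \<odot> nrm q w))"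
      using hcomp2_split[of "t w \<odot> nrm q w" \<sigma>] by simp
    also have "nrm p' (nf q' w) \<odot> ((\<sigma> \<otimes> id2 (nf q' w)) \<odot> (id2 ?P \<otimes> (t w \<odot> nrm q w))) \<odot> ass ?P ?Q w
       = nrm p' (nf q' w) \<odot> (\<sigma> \<otimes> id2 (nf q' w)) \<odot> (id2 ?P \<otimes> t w) \<odot> (id2 ?P \<otimes> nrm q w) \<odot> ass ?P ?Q w"
      by (simp add: lwhisker_vcomp vassoc)
    also have "\<dots> = s (nf q' w) \<odot> nrm p (nf q' w) \<odot> (id2 ?P \<otimes> t w) \<odot> (id2 ?P \<otimes> nrm q w) \<odot> ass ?P ?Q w"
      by (rule vcomp_square_reassoc) (simp_all add: denD(11)[OF s])
    also have "nrm p (nf q' w) \<odot> (id2 ?P \<otimes> t w) \<odot> (id2 ?P \<otimes> nrm q w) \<odot> ass ?P ?Q w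
       = act p (t w) \<odot> nrm p (nf q w) \<odot> (id2 ?P \<otimes> nrm q w) \<odot> ass ?P ?Q w"
      by (rule vcomp_square_reassoc) (use nrm_natural[of p "t w"] in simp_all)
    finally show ?thesis by (simp add: vassoc)
  qed
  then show ?thesis by (simp add: den_def)
qed

text \<open>By the pentagon, whiskering the associator by \<open>w\<close> carries the normalisation
  of one bracketing to that of the other. The equations \<open>x = ev p\<close> are premises so that
  resolution also succeeds on 1-cells that are not syntactically of the form
  \<open>ev p\<close>.\<close>

lemma den_ass:
  assumes [simp]: "wf_expr p" "wf_expr q" "wf_expr r" "esrc p = etrg q" "esrc q = etrg r"
    and xyz: "x = ev p" "y = ev q" "z = ev r"
  shows "den (Comp (Comp p q) r) (Comp p (Comp q r)) (ass x y z) (\<lambda>w. id2 (nf p (nf q (nf r w))))"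
proof -
  let ?P = "ev p" and ?Q = "ev q" and ?R = "ev r"
  have "nrm (Comp p (Comp q r)) w \<odot> (ass ?P ?Q ?R \<otimes> id2 w) = nrm (Comp (Comp p q) r) w"
    if [simp]: "w \<in> Hom" "esrc r = trg w" for w
  proof -
    let ?Np = "nrm p (nf q (nf r w))" and ?Nq = "nrm q (nf r w)" and ?Nr = "nrm r w"
    have "nrm (Comp p (Comp q r)) w \<odot> (ass ?P ?Q ?R \<otimes> id2 w)
      = ?Np \<odot> (id2 ?P \<otimes> ?Nq) \<odot> (id2 ?P \<otimes> id2 ?Q \<otimes> ?Nr) \<odot> (id2 ?P \<otimes> ass ?Q ?R w) \<odot>
          ass ?P (?Q \<star> ?R) w \<odot> (ass ?P ?Q ?R \<otimes> id2 w)"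
      by (simp add: vassoc lwhisker_vcomp)
    also have "(id2 ?P \<otimes> ass ?Q ?R w) \<odot> ass ?P (?Q \<star> ?R) w \<odot> (ass ?P ?Q ?R \<otimes> id2 w)
      = ass ?P ?Q (?R \<star> w) \<odot> ass (?P \<star> ?Q) ?R w"
      by (simp add: pentagon)
    also have "(id2 ?P \<otimes> id2 ?Q \<otimes> ?Nr) \<odot> \<dots>
      = ass ?P ?Q (nf r w) \<odot> (id2 (?P \<star> ?Q) \<otimes> ?Nr) \<odot> ass (?P \<star> ?Q) ?R w"
      by (rule vcomp_square_reassoc) (use ass_natural[of ?Nr "id2 ?Q" "id2 ?P"] in simp_all)
    finally show ?thesis by (simp add: vassoc)
  qed
  then show ?thesis unfolding xyz by (simp add: den_def)
qed

text \<open>Naturality of the left unitor at \<open>nrm p w\<close>, followed by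
  \<open>lu_hcomp1\<close>.\<close>

lemma den_lu:
  assumes [simp]: "wf_expr p" and x: "x = ev p" and a: "a = etrg p"
  shows "den (Comp (Unit a) p) p (blu B x) (\<lambda>w. id2 (nf p w))"
proof -
  have "nrm p w \<odot> (blu B (ev p) \<otimes> id2 w) = nrm (Comp (Unit (etrg p)) p) w"
    if [simp]: "w \<in> Hom" "esrc p = trg w" for w
  proof -
    have "nrm (Comp (Unit (etrg p)) p) w
       = blu B (nf p w) \<odot> (id2 (id1 (etrg p)) \<otimes> nrm p w) \<odot> ass (id1 (etrg p)) (ev p) w"
      by simp
    also have "\<dots> = nrm p w \<odot> blu B (ev p \<star> w) \<odot> ass (id1 (etrg p)) (ev p) w"
      by (rule vcomp_square_reassoc)
        (use lu_natural[of "nrm p w"] hom_obj(2)[of "ev p"] in simp_all)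
    also have "\<dots> = nrm p w \<odot> (blu B (ev p) \<otimes> id2 w)"
      using lu_hcomp1[of w "ev p"] by simp
    finally show ?thesis by simp
  qed
  then show ?thesis unfolding x a using hom_obj(2)[of "ev p"] by (simp add: den_def)
qed

text \<open>The normalisation of a trailing unit contains exactly the left-hand side of
  \<open>triangle\<close>.\<close>

lemma den_ru:
  assumes [simp]: "wf_expr p" and x: "x = ev p" and a: "a = esrc p"
  shows "den (Comp p (Unit a)) p (bru B x) (\<lambda>w. id2 (nf p w))"
proof -
  have "nrm p w \<odot> (bru B (ev p) \<otimes> id2 w) = nrm (Comp p (Unit (esrc p))) w"
    if [simp]: "w \<in> Hom" "esrc p = trg w" for w
    using triangle[of w "ev p"] by simp
  then show ?thesis unfolding x a using hom_obj(1)[of "ev p"] by (simp add: den_def)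
qed

text \<open>A left inverse on the strict side is enough, because \<open>\<sigma>\<close> is already
  known to be invertible and its whiskering can be cancelled.\<close>

lemma den_inv:
  assumes s: "den p q \<sigma> s" and iso: "biso B \<sigma>"
    and t: "\<And>w. \<lbrakk>w \<in> Hom; esrc p = trg w\<rbrakk> \<Longrightarrow> t w \<in> Cell \<and> dom2 (t w) = nf q w \<and> cod2 (t w) = nf p w \<and>
      t w \<odot> s w = id2 (nf p w)"
  shows "den q p (binv B \<sigma>) t"
proof -
  note [simp] = denD(1-10)[OF s] iso t
  have "nrm p w \<odot> (binv B \<sigma> \<otimes> id2 w) = t w \<odot> nrm q w" if [simp]: "w \<in> Hom" "esrc p = trg w" for w
  proof (rule iso_epic)
    have "(t w \<odot> nrm q w) \<odot> (\<sigma> \<otimes> id2 w) = t w \<odot> s w \<odot> nrm p w"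
      by (simp add: vassoc denD(11)[OF s])
    also have "\<dots> = nrm p w"
      by (subst vcomp_reassoc[where \<upsilon> = "id2 (nf p w)"]) simp_all
    also have "\<dots> = nrm p w \<odot> ((binv B \<sigma> \<odot> \<sigma>) \<otimes> id2 w)"
      by simp
    also have "\<dots> = (nrm p w \<odot> (binv B \<sigma> \<otimes> id2 w)) \<odot> (\<sigma> \<otimes> id2 w)"
      by (simp add: rwhisker_vcomp vassoc del: inv_cell(4,5))
    finally show "(nrm p w \<odot> (binv B \<sigma> \<otimes> id2 w)) \<odot> (\<sigma> \<otimes> id2 w) = (t w \<odot> nrm q w) \<odot> (\<sigma> \<otimes> id2 w)" ..
  qed simp_all
  then show ?thesis by (simp add: den_def)
qed

lemma den_inv_ass:
  assumes "wf_expr p" "wf_expr q" "wf_expr r" "esrc p = etrg q" "esrc q = etrg r"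
    and "x = ev p" "y = ev q" "z = ev r"
  shows "den (Comp p (Comp q r)) (Comp (Comp p q) r) (binv B (ass x y z)) (\<lambda>w. id2 (nf p (nf q (nf r w))))"
  by (rule den_inv[OF den_ass]) (use assms in simp_all)

text \<open>For a cell that is given abstractly, such as a structure cell of a pseudofunctor,
  \<open>den\<close> forces the denotation: conjugate the whiskering by the normalisations.\<close>

definition hat :: "('bo,'bc) expr \<Rightarrow> ('bo,'bc) expr \<Rightarrow> 'bt \<Rightarrow> 'bc \<Rightarrow> 'bt" where
  "hat p q \<sigma> w = nrm q w \<odot> (\<sigma> \<otimes> id2 w) \<odot> binv B (nrm p w)"

lemma den_hat:
  assumes [simp]: "wf_expr p" "wf_expr q" "esrc q = esrc p" "etrg q = etrg p" "\<sigma> \<in> Cell"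
    "dom2 \<sigma> = ev p" "cod2 \<sigma> = ev q"
  shows "den p q \<sigma> (hat p q \<sigma>)"
  by (simp add: den_def hat_def vassoc)

text \<open>The way from an equation of \<open>B\<close> into the strict calculus: the two sides of
  an axiom are one cell with two computed denotations. The way back is
  \<open>den_eqI\<close>.\<close>

lemma den_unique:
  assumes s: "den p q \<sigma> s" and t: "den p q \<sigma> t" and [simp]: "w \<in> Hom" "esrc p = trg w"
  shows "s w = t w"
  by (rule iso_epic[of "nrm p w"])
    (simp_all add: denD(1-10)[OF s] denD(1-10)[OF t] denD(11)[OF s, symmetric] denD(11)[OF t, symmetric])

text \<open>The single value \<open>w = id1 (esrc p)\<close> already decides equality, since right
  whiskering by an identity is faithful.\<close>

lemma den_eqI:
  assumes s: "den p q \<sigma> s" and t: "den p q \<tau> t"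
    and eq: "\<And>w. \<lbrakk>w \<in> Hom; esrc p = trg w\<rbrakk> \<Longrightarrow> s w = t w"
  shows "\<sigma> = \<tau>"
proof (rule rwhisker_id1_faithful)
  note [simp] = denD(1-7)[OF s] denD(1-7)[OF t]
  let ?I = "id1 (esrc p)"
  have [simp]: "esrc p \<in> bObj B" using hom_obj(1)[of "ev p"] by simp
  have "nrm q ?I \<odot> (\<sigma> \<otimes> id2 ?I) = nrm q ?I \<odot> (\<tau> \<otimes> id2 ?I)"
    using eq[of ?I] by (simp add: denD(11)[OF s] denD(11)[OF t])
  then have "\<sigma> \<otimes> id2 ?I = \<tau> \<otimes> id2 ?I"
    by (rule iso_monic[of "nrm q ?I", rotated -1]) simp_all
  then show "\<sigma> \<otimes> id2 (id1 (src (dom2 \<sigma>))) = \<tau> \<otimes> id2 (id1 (src (dom2 \<sigma>)))" by simp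
qed (simp_all add: denD(1-7)[OF s] denD(1-7)[OF t])

lemma den_cong:
  assumes "den p q \<sigma> s" "\<And>w. \<lbrakk>w \<in> Hom; esrc p = trg w\<rbrakk> \<Longrightarrow> t w = s w"
  shows "den p q \<sigma> t"
  using assms by (simp add: den_def)

end

section \<open>Pullback squares\<close>

locale cat_locale =
  fixes C :: "('o,'a) cat"
  assumes cat: "category C"
begin

abbreviation cmp (infixr "\<bullet>" 70) where "g \<bullet> f \<equiv> ccomp C g f"
abbreviation Ar where "Ar \<equiv> cAr C"
abbreviation dm where "dm \<equiv> cdom C"
abbreviation cd where "cd \<equiv> ccod C"
abbreviation idt where "idt \<equiv> cid C"
abbreviation pb where "pb \<equiv> is_pullback C"

lemma arr_ob [simp]: "f \<in> Ar \<Longrightarrow> dm f \<in> cOb C" "f \<in> Ar \<Longrightarrow> cd f \<in> cOb C"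
  using cat by (simp_all add: category_def)

lemma idt_arr [simp]: "c \<in> cOb C \<Longrightarrow> idt c \<in> Ar" "c \<in> cOb C \<Longrightarrow> dm (idt c) = c" "c \<in> cOb C \<Longrightarrow> cd (idt c) = c"
  using cat by (simp_all add: category_def)

lemma cmp_arr [simp]:
  "\<lbrakk>f \<in> Ar; g \<in> Ar; dm g = cd f\<rbrakk> \<Longrightarrow> g \<bullet> f \<in> Ar"
  "\<lbrakk>f \<in> Ar; g \<in> Ar; dm g = cd f\<rbrakk> \<Longrightarrow> dm (g \<bullet> f) = dm f"
  "\<lbrakk>f \<in> Ar; g \<in> Ar; dm g = cd f\<rbrakk> \<Longrightarrow> cd (g \<bullet> f) = cd g"
  using cat by (simp_all add: category_def)

lemma cmp_idt [simp]: "\<lbrakk>f \<in> Ar; c = cd f\<rbrakk> \<Longrightarrow> idt c \<bullet> f = f" "\<lbrakk>f \<in> Ar; c = dm f\<rbrakk> \<Longrightarrow> f \<bullet> idt c = f"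
  using cat by (simp_all add: category_def)

lemma cmp_assoc:
  "\<lbrakk>f \<in> Ar; g \<in> Ar; h \<in> Ar; dm g = cd f; dm h = cd g\<rbrakk> \<Longrightarrow> (h \<bullet> g) \<bullet> f = h \<bullet> g \<bullet> f"
  using cat by (simp add: category_def)

lemma cmp_square_reassoc:
  assumes "g \<bullet> f = k \<bullet> h" "f \<in> Ar" "g \<in> Ar" "h \<in> Ar" "k \<in> Ar" "dm g = cd f" "dm k = cd h"
    "e \<in> Ar" "dm f = cd e" "dm h = cd e"
  shows "g \<bullet> f \<bullet> e = k \<bullet> h \<bullet> e"
  using assms(1) cmp_assoc[of e f g] cmp_assoc[of e h k] assms(2-) by simp

lemma category_cop: "category (cop C)"
  unfolding category_def by (auto simp: cop_def cmp_assoc)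

definition iso_arr :: "'a \<Rightarrow> bool" where
  "iso_arr f \<longleftrightarrow> f \<in> Ar \<and> (\<exists>g\<in>Ar. dm g = cd f \<and> cd g = dm f \<and> g \<bullet> f = idt (dm f) \<and> f \<bullet> g = idt (cd f))"

lemma iso_arr_arr: "iso_arr f \<Longrightarrow> f \<in> Ar"
  by (simp add: iso_arr_def)

lemma iso_idt: "c \<in> cOb C \<Longrightarrow> iso_arr (idt c)"
  unfolding iso_arr_def by (auto intro!: bexI[of _ "idt c"])

section \<open>Universal property of pullback squares\<close>

lemma pbD:
  assumes "pb t l r b"
  shows "t \<in> Ar" "l \<in> Ar" "r \<in> Ar" "b \<in> Ar" "dm l = dm t" "dm r = cd t" "dm b = cd l" "cd b = cd r"
    "r \<bullet> t = b \<bullet> l"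
  using assms by (auto simp: is_pullback_def)

lemma pb_universal:
  assumes "pb t l r b" "t' \<in> Ar" "l' \<in> Ar" "dm t' = dm l'" "cd t' = cd t" "cd l' = cd l" "r \<bullet> t' = b \<bullet> l'"
  shows "\<exists>!u. u \<in> Ar \<and> dm u = dm t' \<and> cd u = dm t \<and> t \<bullet> u = t' \<and> l \<bullet> u = l'"
proof -
  have "\<forall>t'\<in>Ar. \<forall>l'\<in>Ar. dm t' = dm l' \<and> cd t' = dm r \<and> cd l' = dm b \<and> r \<bullet> t' = b \<bullet> l' \<longrightarrow>
      (\<exists>!u. u \<in> Ar \<and> dm u = dm t' \<and> cd u = dm t \<and> t \<bullet> u = t' \<and> l \<bullet> u = l')"
    using assms(1) unfolding is_pullback_def by (elim conjE) assumption
  from this[rule_format, OF assms(2,3)] show ?thesis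
    using assms(4-) pbD[OF assms(1)] by simp
qed

lemma pb_factor:
  assumes "pb t l r b" "t' \<in> Ar" "l' \<in> Ar" "dm t' = dm l'" "cd t' = cd t" "cd l' = cd l" "r \<bullet> t' = b \<bullet> l'"
  obtains u where "u \<in> Ar" "dm u = dm t'" "cd u = dm t" "t \<bullet> u = t'" "l \<bullet> u = l'"
  using pb_universal[OF assms(1-7)] that by blast

lemma pb_unique:
  assumes "pb t l r b" "u \<in> Ar" "v \<in> Ar" "dm u = dm v" "cd u = dm t" "cd v = dm t"
    "t \<bullet> u = t \<bullet> v" "l \<bullet> u = l \<bullet> v"
  shows "u = v"
proof -
  note D = pbD[OF assms(1)]
  have "r \<bullet> t \<bullet> u = b \<bullet> l \<bullet> u"
    by (rule cmp_square_reassoc) (use D assms(2,5) in simp_all)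
  then have "\<exists>!z. z \<in> Ar \<and> dm z = dm (t \<bullet> u) \<and> cd z = dm t \<and> t \<bullet> z = t \<bullet> u \<and> l \<bullet> z = l \<bullet> u"
    by (intro pb_universal[OF assms(1)]) (use assms(2-6) D in simp_all)
  moreover have "u \<in> Ar \<and> dm u = dm (t \<bullet> u) \<and> cd u = dm t \<and> t \<bullet> u = t \<bullet> u \<and> l \<bullet> u = l \<bullet> u"
    "v \<in> Ar \<and> dm v = dm (t \<bullet> u) \<and> cd v = dm t \<and> t \<bullet> v = t \<bullet> u \<and> l \<bullet> v = l \<bullet> u"
    using assms D by simp_all
  ultimately show ?thesis by blast
qed

text \<open>Unique existence is split into a factorisation and the joint monicity of
  \<open>t\<close> and \<open>l\<close>; under pasting the two are checked by separate
  arguments.\<close>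

lemma pbI:
  assumes "t \<in> Ar" "l \<in> Ar" "r \<in> Ar" "b \<in> Ar" "dm l = dm t" "dm r = cd t" "dm b = cd l" "cd b = cd r"
    "r \<bullet> t = b \<bullet> l"
    and "\<And>t' l'. \<lbrakk>t' \<in> Ar; l' \<in> Ar; dm t' = dm l'; cd t' = cd t; cd l' = cd l; r \<bullet> t' = b \<bullet> l'\<rbrakk> \<Longrightarrow>
      \<exists>u\<in>Ar. dm u = dm t' \<and> cd u = dm t \<and> t \<bullet> u = t' \<and> l \<bullet> u = l'"
    and "\<And>u v. \<lbrakk>u \<in> Ar; v \<in> Ar; dm u = dm v; cd u = dm t; cd v = dm t; t \<bullet> u = t \<bullet> v; l \<bullet> u = l \<bullet> v\<rbrakk> \<Longrightarrow> u = v"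
  shows "pb t l r b"
  unfolding is_pullback_def
proof (intro conjI ballI impI)
  fix t' l' assume a: "t' \<in> Ar" "l' \<in> Ar"
    "dm t' = dm l' \<and> cd t' = dm r \<and> cd l' = dm b \<and> r \<bullet> t' = b \<bullet> l'"
  then obtain u where u: "u \<in> Ar" "dm u = dm t'" "cd u = dm t" "t \<bullet> u = t'" "l \<bullet> u = l'"
    using assms(10)[of t' l'] assms(6,7) by auto
  show "\<exists>!u. u \<in> Ar \<and> dm u = dm t' \<and> cd u = dm t \<and> t \<bullet> u = t' \<and> l \<bullet> u = l'"
  proof (rule ex1I[of _ u])
    fix v assume "v \<in> Ar \<and> dm v = dm t' \<and> cd v = dm t \<and> t \<bullet> v = t' \<and> l \<bullet> v = l'"
    then show "v = u" using u assms(11)[of v u] by simp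
  qed (use u in simp)
qed (use assms in simp_all)

lemma pb_sym:
  assumes "pb t l r b" shows "pb l t b r"
proof (rule pbI)
  note D = pbD[OF assms]
  fix t' l' assume a: "t' \<in> Ar" "l' \<in> Ar" "dm t' = dm l'" "cd t' = cd l" "cd l' = cd t" "b \<bullet> t' = r \<bullet> l'"
  show "\<exists>u\<in>Ar. dm u = dm t' \<and> cd u = dm l \<and> l \<bullet> u = t' \<and> t \<bullet> u = l'"
    by (rule pb_factor[OF assms, of l' t']) (use a D in auto)
next
  fix u v assume "u \<in> Ar" "v \<in> Ar" "dm u = dm v" "cd u = dm l" "cd v = dm l" "l \<bullet> u = l \<bullet> v" "t \<bullet> u = t \<bullet> v"
  then show "u = v" using pb_unique[OF assms, of u v] pbD(5)[OF assms] by simp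
qed (use pbD[OF assms] in simp_all)

section \<open>Pasting and cancellation of pullback squares\<close>

lemma pb_hpaste:
  assumes L: "pb t0 v0 v1 b0" and R: "pb t1 v1 v2 b1"
  shows "pb (t1 \<bullet> t0) v0 v2 (b1 \<bullet> b0)"
proof (rule pbI)
  note D = pbD[OF L] pbD[OF R]
  have "v2 \<bullet> t1 \<bullet> t0 = b1 \<bullet> v1 \<bullet> t0"
    by (rule cmp_square_reassoc) (use D in simp_all)
  also have "\<dots> = b1 \<bullet> b0 \<bullet> v0" using D by simp
  finally show "v2 \<bullet> t1 \<bullet> t0 = (b1 \<bullet> b0) \<bullet> v0" using D by (simp add: cmp_assoc)
next
  fix t' l' assume a: "t' \<in> Ar" "l' \<in> Ar" "dm t' = dm l'" "cd t' = cd (t1 \<bullet> t0)" "cd l' = cd v0"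
    "v2 \<bullet> t' = (b1 \<bullet> b0) \<bullet> l'"
  note D = pbD[OF L] pbD[OF R]
  obtain u where u: "u \<in> Ar" "dm u = dm t'" "cd u = dm t1" "t1 \<bullet> u = t'" "v1 \<bullet> u = b0 \<bullet> l'"
    by (rule pb_factor[OF R, of t' "b0 \<bullet> l'"]) (use a D in \<open>simp_all add: cmp_assoc\<close>)
  obtain z where z: "z \<in> Ar" "dm z = dm u" "cd z = dm t0" "t0 \<bullet> z = u" "v0 \<bullet> z = l'"
    by (rule pb_factor[OF L, of u l']) (use a D u in simp_all)
  show "\<exists>u\<in>Ar. dm u = dm t' \<and> cd u = dm (t1 \<bullet> t0) \<and> (t1 \<bullet> t0) \<bullet> u = t' \<and> v0 \<bullet> u = l'"
    by (rule bexI[of _ z]) (use D u z in \<open>simp_all add: cmp_assoc\<close>)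
next
  fix u v assume a: "u \<in> Ar" "v \<in> Ar" "dm u = dm v" "cd u = dm (t1 \<bullet> t0)" "cd v = dm (t1 \<bullet> t0)"
    "(t1 \<bullet> t0) \<bullet> u = (t1 \<bullet> t0) \<bullet> v" "v0 \<bullet> u = v0 \<bullet> v"
  note D = pbD[OF L] pbD[OF R]
  have "v1 \<bullet> t0 \<bullet> z = b0 \<bullet> v0 \<bullet> z" if "z \<in> Ar" "cd z = dm t0" for z
    by (rule cmp_square_reassoc) (use D that in simp_all)
  then have *: "v1 \<bullet> t0 \<bullet> u = v1 \<bullet> t0 \<bullet> v"
    using D a by simp
  have **: "t0 \<bullet> u = t0 \<bullet> v"
    by (rule pb_unique[OF R]) (use a D * in \<open>simp_all add: cmp_assoc\<close>)
  show "u = v"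
    by (rule pb_unique[OF L]) (use a D ** in simp_all)
qed (use pbD[OF L] pbD[OF R] in simp_all)

lemma pb_vpaste:
  assumes "pb h0 l0 r0 h1" "pb h1 l1 r1 h2"
  shows "pb h0 (l1 \<bullet> l0) (r1 \<bullet> r0) h2"
  using pb_hpaste[OF assms[THEN pb_sym]] by (rule pb_sym)

text \<open>The cancellation half of the pasting law. It produces the corner square of the iterated
  pullback in the associativity proof.\<close>

lemma pb_hcancel:
  assumes R: "pb t1 v1 v2 b1" and O: "pb (t1 \<bullet> t0) v0 v2 (b1 \<bullet> b0)"
    and t0: "t0 \<in> Ar" "cd t0 = dm t1" and b0: "b0 \<in> Ar" "cd b0 = dm b1" "dm b0 = cd v0"
    and comm: "v1 \<bullet> t0 = b0 \<bullet> v0"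
  shows "pb t0 v0 v1 b0"
proof (rule pbI)
  note D = pbD[OF O] pbD[OF R] assms(3-)
  fix t' l' assume a: "t' \<in> Ar" "l' \<in> Ar" "dm t' = dm l'" "cd t' = cd t0" "cd l' = cd v0"
    "v1 \<bullet> t' = b0 \<bullet> l'"
  \<comment> \<open>A cone over the left square is extended along \<open>t1\<close> to one over the
    outer square. That the factorisation has the right first component follows from joint monicity
    of \<open>t1\<close> and \<open>v1\<close>.\<close>
  have "v2 \<bullet> t1 \<bullet> t' = b1 \<bullet> v1 \<bullet> t'"
    by (rule cmp_square_reassoc) (use D a in simp_all)
  then have *: "v2 \<bullet> t1 \<bullet> t' = (b1 \<bullet> b0) \<bullet> l'" using D a by (simp add: cmp_assoc)
  obtain z where z: "z \<in> Ar" "dm z = dm t'" "cd z = dm t0" "(t1 \<bullet> t0) \<bullet> z = t1 \<bullet> t'" "v0 \<bullet> z = l'"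
    by (rule pb_factor[OF O, of "t1 \<bullet> t'" l']) (use a D * in simp_all)
  have "t0 \<bullet> z = t'"
  proof (rule pb_unique[OF R])
    have "v1 \<bullet> t0 \<bullet> z = b0 \<bullet> v0 \<bullet> z"
      by (rule cmp_square_reassoc) (use D z in simp_all)
    also have "\<dots> = v1 \<bullet> t'" using z a by simp
    finally show "v1 \<bullet> t0 \<bullet> z = v1 \<bullet> t'" .
  qed (use D z a in \<open>simp_all add: cmp_assoc\<close>)
  then show "\<exists>u\<in>Ar. dm u = dm t' \<and> cd u = dm t0 \<and> t0 \<bullet> u = t' \<and> v0 \<bullet> u = l'"
    using z by blast
next
  note D = pbD[OF O] pbD[OF R] assms(3-)
  fix u v assume a: "u \<in> Ar" "v \<in> Ar" "dm u = dm v" "cd u = dm t0" "cd v = dm t0"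
    "t0 \<bullet> u = t0 \<bullet> v" "v0 \<bullet> u = v0 \<bullet> v"
  show "u = v"
    by (rule pb_unique[OF O]) (use a D in \<open>simp_all add: cmp_assoc\<close>)
qed (use pbD[OF O] pbD[OF R] assms(3-) in simp_all)

section \<open>Pullback squares with invertible sides, and comparison maps\<close>

lemma pb_iso:
  assumes "iso_arr f" "g \<in> Ar" "dm g = cd f"
  shows "pb f (g \<bullet> f) g (idt (cd g))"
proof -
  obtain f' where f': "f \<in> Ar" "f' \<in> Ar" "dm f' = cd f" "cd f' = dm f"
    "f' \<bullet> f = idt (dm f)" "f \<bullet> f' = idt (cd f)"
    using assms(1) unfolding iso_arr_def by blast
  show ?thesis
  proof (rule pbI)
    fix t' l' assume a: "t' \<in> Ar" "l' \<in> Ar" "dm t' = dm l'" "cd t' = cd f" "cd l' = cd (g \<bullet> f)"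
      "g \<bullet> t' = idt (cd g) \<bullet> l'"
    have "f \<bullet> f' \<bullet> t' = t'" using f' a by (simp flip: cmp_assoc)
    then show "\<exists>u\<in>Ar. dm u = dm t' \<and> cd u = dm f \<and> f \<bullet> u = t' \<and> (g \<bullet> f) \<bullet> u = l'"
      using a f' assms by (intro bexI[of _ "f' \<bullet> t'"]) (simp_all add: cmp_assoc)
  next
    fix u v assume a: "u \<in> Ar" "v \<in> Ar" "dm u = dm v" "cd u = dm f" "cd v = dm f" "f \<bullet> u = f \<bullet> v"
    show "u = v"
      using cmp_assoc[of u f f'] cmp_assoc[of v f f'] a f' by simp
  qed (use assms f' in simp_all)
qed

lemma pb_iso': "\<lbrakk>iso_arr f; h \<in> Ar; dm h = cd f\<rbrakk> \<Longrightarrow> pb (h \<bullet> f) f (idt (cd h)) h"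
  by (rule pb_sym) (rule pb_iso)

lemma pb_iso_idt:
  assumes "iso_arr f" shows "pb f f (idt (cd f)) (idt (cd f))"
  using pb_iso[OF assms, of "idt (cd f)"] iso_arr_arr[OF assms] by simp

lemma pb_hunit: "f \<in> Ar \<Longrightarrow> pb (idt (dm f)) f f (idt (cd f))"
  using pb_iso[OF iso_idt, of "dm f" f] by simp

lemma pb_vunit: "f \<in> Ar \<Longrightarrow> pb f (idt (dm f)) (idt (cd f)) f"
  by (rule pb_sym) (rule pb_hunit)

text \<open>The legs of each pullback factor through the other, and joint monicity makes the two
  factorisations inverse. Every apex map that must be shown invertible below, including those of the
  unit constraints, is recognised as such a comparison map.\<close>

lemma pb_comparison_iso:
  assumes P: "pb t l r b" and Q: "pb (t \<bullet> u) (l \<bullet> u) r b" and u: "u \<in> Ar" "cd u = dm t"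
  shows "iso_arr u"
proof -
  note D = pbD[OF P] pbD[OF Q] u
  obtain v where v: "v \<in> Ar" "dm v = dm t" "cd v = dm (t \<bullet> u)" "(t \<bullet> u) \<bullet> v = t" "(l \<bullet> u) \<bullet> v = l"
    by (rule pb_factor[OF Q, of t l]) (use D in simp_all)
  have "u \<bullet> v = idt (dm t)"
    by (rule pb_unique[OF P]) (use D v in \<open>simp_all flip: cmp_assoc\<close>)
  moreover have "v \<bullet> u = idt (dm u)"
    by (rule pb_unique[OF Q]) (use D v in \<open>simp_all flip: cmp_assoc\<close>)
  ultimately show ?thesis
    using D v unfolding iso_arr_def by (intro conjI bexI[of _ v]) simp_all
qed

lemma pbmap_props:
  assumes "pb (fst P) (snd P) r b" "x \<in> Ar" "y \<in> Ar" "dm x = dm y" "cd x = cd (fst P)" "cd y = cd (snd P)"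
    "r \<bullet> x = b \<bullet> y"
  shows "pbmap C P x y \<in> Ar" "dm (pbmap C P x y) = dm x" "cd (pbmap C P x y) = dm (fst P)"
    "fst P \<bullet> pbmap C P x y = x" "snd P \<bullet> pbmap C P x y = y"
  using theI'[OF pb_universal[OF assms]] unfolding pbmap_def by simp_all

lemma pb_pbk:
  assumes "has_pullbacks C" "r \<in> Ar" "b \<in> Ar" "cd r = cd b"
  shows "pb (fst (pbk C r b)) (snd (pbk C r b)) r b"
proof -
  have "\<exists>p. case p of (t, l) \<Rightarrow> pb t l r b"
    using assms unfolding has_pullbacks_def by auto
  then have "case pbk C r b of (t, l) \<Rightarrow> pb t l r b"
    unfolding pbk_def by (rule someI_ex)
  then show ?thesis by (simp add: case_prod_beta)
qed

end

section \<open>Beck--Chevalley systems\<close>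

context bicat_locale begin

text \<open>Stated for an arbitrary category \<open>D\<close>, so that it serves both for
  \<open>U\<close> on \<open>C\<close> and for \<open>V\<close> on \<open>cop C\<close>.\<close>

lemma pseudofunctor_ldisc:
  assumes D: "category D" and F: "pseudofunctor (ldisc D) B F"
  shows "\<And>c. c \<in> cOb D \<Longrightarrow> PO F c \<in> bObj B"
    and "\<And>f. f \<in> cAr D \<Longrightarrow> P1 F f \<in> Hom \<and> src (P1 F f) = PO F (cdom D f) \<and> trg (P1 F f) = PO F (ccod D f)"
    and "\<And>f g. \<lbrakk>f \<in> cAr D; g \<in> cAr D; cdom D g = ccod D f\<rbrakk> \<Longrightarrow>
      Pcmp F g f \<in> Cell \<and> dom2 (Pcmp F g f) = P1 F (ccomp D g f) \<and> cod2 (Pcmp F g f) = P1 F g \<star> P1 F f \<and>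
      biso B (Pcmp F g f)"
    and "\<And>c. c \<in> cOb D \<Longrightarrow> Pid F c \<in> Cell \<and> dom2 (Pid F c) = P1 F (cid D c) \<and> cod2 (Pid F c) = id1 (PO F c) \<and>
      biso B (Pid F c)"
    and "\<And>f g h. \<lbrakk>f \<in> cAr D; g \<in> cAr D; h \<in> cAr D; cdom D g = ccod D f; cdom D h = ccod D g\<rbrakk> \<Longrightarrow>
      ass (P1 F h) (P1 F g) (P1 F f) \<odot> (Pcmp F h g \<otimes> id2 (P1 F f)) \<odot> Pcmp F (ccomp D h g) f =
      (id2 (P1 F h) \<otimes> Pcmp F g f) \<odot> Pcmp F h (ccomp D g f)"
    and "\<And>f. f \<in> cAr D \<Longrightarrow>
      blu B (P1 F f) \<odot> (Pid F (ccod D f) \<otimes> id2 (P1 F f)) \<odot> Pcmp F (cid D (ccod D f)) f = id2 (P1 F f)"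
    and "\<And>f. f \<in> cAr D \<Longrightarrow>
      bru B (P1 F f) \<odot> (id2 (P1 F f) \<otimes> Pid F (cdom D f)) \<odot> Pcmp F f (cid D (cdom D f)) = id2 (P1 F f)"
proof -
  interpret D: cat_locale D by unfold_locales (rule D)
  note F' = F[unfolded pseudofunctor_def]
  show ob: "\<And>c. c \<in> cOb D \<Longrightarrow> PO F c \<in> bObj B"
    using F'[THEN conjunct1] by (simp add: ldisc_def)
  note F' = F'[THEN conjunct2]
  show hom: "\<And>f. f \<in> cAr D \<Longrightarrow>
      P1 F f \<in> Hom \<and> src (P1 F f) = PO F (cdom D f) \<and> trg (P1 F f) = PO F (ccod D f)"
    using F'[THEN conjunct1] by (simp add: ldisc_def)
  note F' = F'[THEN conjunct2, THEN conjunct2]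
  \<comment> \<open>In \<open>ldisc D\<close> the 2-cell \<open>f\<close> is the identity on
    \<open>f\<close>, so preservation of identities determines \<open>P2\<close>, and it disappears
    from the coherence laws.\<close>
  have P2: "\<And>f. f \<in> cAr D \<Longrightarrow> P2 F f = id2 (P1 F f)"
    using F'[THEN conjunct1] by (simp add: ldisc_def)
  note F' = F'[THEN conjunct2, THEN conjunct2]
  show cmp: "\<And>f g. \<lbrakk>f \<in> cAr D; g \<in> cAr D; cdom D g = ccod D f\<rbrakk> \<Longrightarrow>
      Pcmp F g f \<in> Cell \<and> dom2 (Pcmp F g f) = P1 F (ccomp D g f) \<and> cod2 (Pcmp F g f) = P1 F g \<star> P1 F f \<and>
      biso B (Pcmp F g f)"
    using F'[THEN conjunct1] by (simp add: ldisc_def)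
  note F' = F'[THEN conjunct2, THEN conjunct2]
  show "\<And>c. c \<in> cOb D \<Longrightarrow> Pid F c \<in> Cell \<and> dom2 (Pid F c) = P1 F (cid D c) \<and> cod2 (Pid F c) = id1 (PO F c) \<and>
      biso B (Pid F c)"
    using F'[THEN conjunct1] by (simp add: ldisc_def)
  note F' = F'[THEN conjunct2]
  show "\<And>f g h. \<lbrakk>f \<in> cAr D; g \<in> cAr D; h \<in> cAr D; cdom D g = ccod D f; cdom D h = ccod D g\<rbrakk> \<Longrightarrow>
      ass (P1 F h) (P1 F g) (P1 F f) \<odot> (Pcmp F h g \<otimes> id2 (P1 F f)) \<odot> Pcmp F (ccomp D h g) f =
      (id2 (P1 F h) \<otimes> Pcmp F g f) \<odot> Pcmp F h (ccomp D g f)"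
    using F'[THEN conjunct1] by (simp add: ldisc_def P2 cmp)
  note F' = F'[THEN conjunct2]
  show "\<And>f. f \<in> cAr D \<Longrightarrow>
      blu B (P1 F f) \<odot> (Pid F (ccod D f) \<otimes> id2 (P1 F f)) \<odot> Pcmp F (cid D (ccod D f)) f = id2 (P1 F f)"
    using F'[THEN conjunct1] by (simp add: ldisc_def P2)
  show "\<And>f. f \<in> cAr D \<Longrightarrow>
      bru B (P1 F f) \<odot> (id2 (P1 F f) \<otimes> Pid F (cdom D f)) \<odot> Pcmp F f (cid D (cdom D f)) = id2 (P1 F f)"
    using F'[THEN conjunct2] by (simp add: ldisc_def P2)
qed

end

locale pbc_locale = bicat_locale B + cat_locale C
  for B :: "('bo,'bc,'bt) bicat" and C :: "('o,'a) cat" +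
  fixes U V :: "('o,'a,'a,'bo,'bc,'bt) pfun"
    and BC :: "'a \<Rightarrow> 'a \<Rightarrow> 'a \<Rightarrow> 'a \<Rightarrow> 'bt"
  assumes sys: "pbc_system C B U V BC"
begin

lemmas pbc_axioms0 = sys[unfolded pbc_system_def]
lemmas pbc_axioms1 = pbc_axioms0[THEN conjunct2]
lemmas pbc_axioms2 = pbc_axioms1[THEN conjunct2]
lemmas pbc_axioms3 = pbc_axioms2[THEN conjunct2]
lemmas pbc_axioms4 = pbc_axioms3[THEN conjunct2]
lemmas pbc_axioms5 = pbc_axioms4[THEN conjunct2]
lemmas pbc_axioms6 = pbc_axioms5[THEN conjunct2]

abbreviation ob where "ob \<equiv> PO U"
abbreviation u where "u \<equiv> P1 U"
abbreviation v where "v \<equiv> P1 V"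
abbreviation X where "X f \<kappa> \<equiv> id2 (P1 U f) \<otimes> \<kappa>"
abbreviation Y where "Y f \<kappa> \<equiv> id2 (P1 V f) \<otimes> \<kappa>"
abbreviation gu where "gu f \<equiv> Gen (P1 U f)"
abbreviation gv where "gv f \<equiv> Gen (P1 V f)"

lemmas U_facts = pseudofunctor_ldisc[OF cat pbc_axioms0[THEN conjunct1]]
lemmas V_facts = pseudofunctor_ldisc[OF category_cop pbc_axioms1[THEN conjunct1], unfolded cop_def, simplified]

lemma obV [simp]: "c \<in> cOb C \<Longrightarrow> PO V c = ob c"
  using pbc_axioms2[THEN conjunct1] by simp

lemma u_hom [simp]: "c \<in> cOb C \<Longrightarrow> ob c \<in> bObj B" "f \<in> Ar \<Longrightarrow> u f \<in> Hom"
  "f \<in> Ar \<Longrightarrow> src (u f) = ob (dm f)" "f \<in> Ar \<Longrightarrow> trg (u f) = ob (cd f)"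
  using U_facts(1,2) by simp_all

lemma v_hom [simp]: "f \<in> Ar \<Longrightarrow> v f \<in> Hom" "f \<in> Ar \<Longrightarrow> src (v f) = ob (cd f)" "f \<in> Ar \<Longrightarrow> trg (v f) = ob (dm f)"
  using V_facts(2) by simp_all

section \<open>Structure cells of the system as actions on normal forms\<close>

text \<open>Actions of the structure cells on normal forms; note that \<open>V_comp g f\<close> is the action of
  \<open>V(gf) \<rightarrow> V(f) V(g)\<close>, which is \<open>Pcmp V f g\<close>.\<close>
definition U_comp where "U_comp g f = hat (gu (g \<bullet> f)) (Comp (gu g) (gu f)) (Pcmp U g f)"
definition V_comp where "V_comp g f = hat (gv (g \<bullet> f)) (Comp (gv f) (gv g)) (Pcmp V f g)"
definition U_unit where "U_unit c = hat (gu (idt c)) (Unit (ob c)) (Pid U c)"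
definition V_unit where "V_unit c = hat (gv (idt c)) (Unit (ob c)) (Pid V c)"
definition BC_act where "BC_act t l r b = hat (Comp (gv b) (gu r)) (Comp (gu l) (gv t)) (BC t l r b)"
definition BC_inv where "BC_inv t l r b = hat (Comp (gu l) (gv t)) (Comp (gv b) (gu r)) (binv B (BC t l r b))"

lemma BC_cell: "pb t l r b \<Longrightarrow> BC t l r b \<in> Cell \<and> dom2 (BC t l r b) = v b \<star> u r \<and>
   cod2 (BC t l r b) = u l \<star> v t \<and> biso B (BC t l r b)"
  using pbc_axioms3[THEN conjunct1] by blast

lemma den_U_comp: "\<lbrakk>f \<in> Ar; g \<in> Ar; dm g = cd f; h = g \<bullet> f\<rbrakk> \<Longrightarrow>
    den (gu h) (Comp (gu g) (gu f)) (Pcmp U g f) (U_comp g f)"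
  unfolding U_comp_def by (simp, rule den_hat) (simp_all add: U_facts(3))

lemma den_V_comp: "\<lbrakk>f \<in> Ar; g \<in> Ar; dm g = cd f; h = g \<bullet> f\<rbrakk> \<Longrightarrow>
    den (gv h) (Comp (gv f) (gv g)) (Pcmp V f g) (V_comp g f)"
  unfolding V_comp_def by (simp, rule den_hat) (simp_all add: V_facts(3))

lemma den_U_unit: "c \<in> cOb C \<Longrightarrow> den (gu (idt c)) (Unit (ob c)) (Pid U c) (U_unit c)"
  unfolding U_unit_def by (rule den_hat) (simp_all add: U_facts(4))

lemma den_V_unit: "c \<in> cOb C \<Longrightarrow> den (gv (idt c)) (Unit (ob c)) (Pid V c) (V_unit c)"
  unfolding V_unit_def by (rule den_hat) (simp_all add: V_facts(4))

lemma den_BC_act: "pb t l r b \<Longrightarrow> den (Comp (gv b) (gu r)) (Comp (gu l) (gv t)) (BC t l r b) (BC_act t l r b)"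
  unfolding BC_act_def by (rule den_hat) (use BC_cell[of t l r b] pbD[of t l r b] in simp_all)

lemma den_BC_inv: "pb t l r b \<Longrightarrow>
    den (Comp (gu l) (gv t)) (Comp (gv b) (gu r)) (binv B (BC t l r b)) (BC_inv t l r b)"
  unfolding BC_inv_def by (rule den_hat) (use BC_cell[of t l r b] pbD[of t l r b] in simp_all)

text \<open>Syntax-directed rules: resolution along the structure of a composite cell computes its
  denotation.\<close>

lemmas den_intros = den_vcomp den_hcomp2 den_id den_ass den_inv_ass den_lu den_ru den_U_comp den_V_comp den_U_unit den_V_unit den_BC_act den_BC_inv

lemma U_comp_cell [simp]:
  assumes "f \<in> Ar" "g \<in> Ar" "dm g = cd f" "w \<in> Hom" "trg w = ob (dm f)"
  shows "U_comp g f w \<in> Cell" "dom2 (U_comp g f w) = u (g \<bullet> f) \<star> w" "cod2 (U_comp g f w) = u g \<star> u f \<star> w"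
  using denD(8-10)[OF den_U_comp[OF assms(1-3) refl], of w] assms by simp_all

lemma V_comp_cell [simp]:
  assumes "f \<in> Ar" "g \<in> Ar" "dm g = cd f" "w \<in> Hom" "trg w = ob (cd g)"
  shows "V_comp g f w \<in> Cell" "dom2 (V_comp g f w) = v (g \<bullet> f) \<star> w" "cod2 (V_comp g f w) = v f \<star> v g \<star> w"
  using denD(8-10)[OF den_V_comp[OF assms(1-3) refl], of w] assms by simp_all

lemma U_unit_cell [simp]:
  assumes "c \<in> cOb C" "w \<in> Hom" "trg w = ob c"
  shows "U_unit c w \<in> Cell" "dom2 (U_unit c w) = u (idt c) \<star> w" "cod2 (U_unit c w) = w"
  using denD(8-10)[OF den_U_unit[OF assms(1)], of w] assms by simp_all

lemma V_unit_cell [simp]: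
  assumes "c \<in> cOb C" "w \<in> Hom" "trg w = ob c"
  shows "V_unit c w \<in> Cell" "dom2 (V_unit c w) = v (idt c) \<star> w" "cod2 (V_unit c w) = w"
  using denD(8-10)[OF den_V_unit[OF assms(1)], of w] assms by simp_all

lemma BC_act_cell [simp]:
  assumes "pb t l r b" "w \<in> Hom" "trg w = ob (cd t)"
  shows "BC_act t l r b w \<in> Cell" "dom2 (BC_act t l r b w) = v b \<star> u r \<star> w" "cod2 (BC_act t l r b w) = u l \<star> v t \<star> w"
  using denD(8-10)[OF den_BC_act[OF assms(1)], of w] assms pbD[OF assms(1)] by simp_all

lemma BC_inv_cell [simp]:
  assumes "pb t l r b" "w \<in> Hom" "trg w = ob (cd t)"
  shows "BC_inv t l r b w \<in> Cell" "dom2 (BC_inv t l r b w) = u l \<star> v t \<star> w" "cod2 (BC_inv t l r b w) = v b \<star> u r \<star> w"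
  using denD(8-10)[OF den_BC_inv[OF assms(1)], of w] assms pbD[OF assms(1)] by simp_all

section \<open>Naturality and coherence of the composition and unit cells\<close>

lemma U_comp_natural:
  assumes "f \<in> Ar" "g \<in> Ar" "dm g = cd f" "\<kappa> \<in> Cell" "trg (dom2 \<kappa>) = ob (dm f)" "w = dom2 \<kappa>" "w' = cod2 \<kappa>"
  shows "U_comp g f w' \<odot> X (g \<bullet> f) \<kappa> = X g (X f \<kappa>) \<odot> U_comp g f w"
  using den_natural[OF den_U_comp[OF assms(1-3) refl], of \<kappa>] assms by simp

lemma U_unit_natural:
  assumes "c \<in> cOb C" "\<kappa> \<in> Cell" "trg (dom2 \<kappa>) = ob c" "w = dom2 \<kappa>" "w' = cod2 \<kappa>"
  shows "U_unit c w' \<odot> X (idt c) \<kappa> = \<kappa> \<odot> U_unit c w"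
  using den_natural[OF den_U_unit[OF assms(1)], of \<kappa>] assms by simp

lemma V_unit_natural:
  assumes "c \<in> cOb C" "\<kappa> \<in> Cell" "trg (dom2 \<kappa>) = ob c" "w = dom2 \<kappa>" "w' = cod2 \<kappa>"
  shows "V_unit c w' \<odot> Y (idt c) \<kappa> = \<kappa> \<odot> V_unit c w"
  using den_natural[OF den_V_unit[OF assms(1)], of \<kappa>] assms by simp

lemma BC_inv_natural:
  assumes "pb t l r b" "\<kappa> \<in> Cell" "trg (dom2 \<kappa>) = ob (cd t)" "w = dom2 \<kappa>" "w' = cod2 \<kappa>"
  shows "BC_inv t l r b w' \<odot> X l (Y t \<kappa>) = Y b (X r \<kappa>) \<odot> BC_inv t l r b w"
  using den_natural[OF den_BC_inv[OF assms(1)], of \<kappa>] assms pbD[OF assms(1)] by simp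

text \<open>The pattern of the coherence laws below: both sides of the axiom are denoted by the
  rules, \<open>den_unique\<close> equates the results, and the constraint cells of \<open>B\<close>
  vanish because they denote identities.\<close>

lemma U_comp_assoc:
  assumes [simp]: "f \<in> Ar" "g \<in> Ar" "h \<in> Ar" "dm g = cd f" "dm h = cd g" "w \<in> Hom" "trg w = ob (dm f)"
  shows "X h (U_comp g f w) \<odot> U_comp h (g \<bullet> f) w = U_comp h g (u f \<star> w) \<odot> U_comp (h \<bullet> g) f w"
proof -
  let ?p = "gu (h \<bullet> g \<bullet> f)" and ?q = "Comp (gu h) (Comp (gu g) (gu f))"
  note eq = U_facts(5)[of f g h, simplified]
  have 1: "den ?p ?q (ass (u h) (u g) (u f) \<odot> (Pcmp U h g \<otimes> id2 (u f)) \<odot> Pcmp U (h \<bullet> g) f)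
     (\<lambda>w. id2 (nf (gu h) (nf (gu g) (nf (gu f) w))) \<odot>
         (U_comp h g (nf (gu f) w) \<odot> act (gu (h \<bullet> g)) (id2 (nf (gu f) w))) \<odot> U_comp (h \<bullet> g) f w)"
    by (rule den_intros | simp add: cmp_assoc)+
  have 2: "den ?p ?q ((id2 (u h) \<otimes> Pcmp U g f) \<odot> Pcmp U h (g \<bullet> f))
     (\<lambda>w. (id2 (nf (gu h) (nf (Comp (gu g) (gu f)) w)) \<odot> act (gu h) (U_comp g f w)) \<odot> U_comp h (g \<bullet> f) w)"
    by (rule den_intros | simp add: cmp_assoc)+
  show ?thesis
    using den_unique[OF 1[unfolded eq] 2, of w] by (simp add: cmp_assoc)
qed

lemma U_comp_lunit:
  assumes [simp]: "f \<in> Ar" "w \<in> Hom" "trg w = ob (dm f)" and c: "c = cd f"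
  shows "U_unit c (u f \<star> w) \<odot> U_comp (idt c) f w = id2 (u f \<star> w)"
proof -
  note eq = U_facts(6)[of f, simplified]
  have 1: "den (gu f) (gu f) (blu B (u f) \<odot> (Pid U (cd f) \<otimes> id2 (u f)) \<odot> Pcmp U (idt (cd f)) f)
     (\<lambda>w. id2 (nf (gu f) w) \<odot> (U_unit (cd f) (nf (gu f) w) \<odot> act (gu (idt (cd f))) (id2 (nf (gu f) w))) \<odot>
        U_comp (idt (cd f)) f w)"
    by (rule den_intros | simp)+
  have 2: "den (gu f) (gu f) (id2 (u f)) (\<lambda>w. id2 (nf (gu f) w))"
    by (rule den_intros | simp)+
  show ?thesis unfolding c
    using den_unique[OF 1[unfolded eq] 2, of w] by simp
qed

lemma U_comp_runit:
  assumes [simp]: "f \<in> Ar" "w \<in> Hom" "trg w = ob (dm f)" and c: "c = dm f"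
  shows "X f (U_unit c w) \<odot> U_comp f (idt c) w = id2 (u f \<star> w)"
proof -
  note eq = U_facts(7)[of f, simplified]
  have 1: "den (gu f) (gu f) (bru B (u f) \<odot> (id2 (u f) \<otimes> Pid U (dm f)) \<odot> Pcmp U f (idt (dm f)))
     (\<lambda>w. id2 (nf (gu f) w) \<odot> (id2 (nf (gu f) (nf (Unit (ob (dm f))) w)) \<odot> act (gu f) (U_unit (dm f) w)) \<odot>
        U_comp f (idt (dm f)) w)"
    by (rule den_intros | simp)+
  have 2: "den (gu f) (gu f) (id2 (u f)) (\<lambda>w. id2 (nf (gu f) w))"
    by (rule den_intros | simp)+
  show ?thesis unfolding c
    using den_unique[OF 1[unfolded eq] 2, of w] by simp
qed

lemma V_comp_assoc:
  assumes [simp]: "f \<in> Ar" "g \<in> Ar" "h \<in> Ar" "dm g = cd f" "dm h = cd g" "w \<in> Hom" "trg w = ob (cd h)"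
  shows "Y f (V_comp h g w) \<odot> V_comp (h \<bullet> g) f w = V_comp g f (v h \<star> w) \<odot> V_comp h (g \<bullet> f) w"
proof -
  let ?p = "gv (h \<bullet> g \<bullet> f)" and ?q = "Comp (gv f) (Comp (gv g) (gv h))"
  \<comment> \<open>\<open>V\<close> is a pseudofunctor on \<open>cop C\<close>, so the composable
    triple is read backwards.\<close>
  note eq = V_facts(5)[of h g f, simplified]
  have 1: "den ?p ?q (ass (v f) (v g) (v h) \<odot> (Pcmp V f g \<otimes> id2 (v h)) \<odot> Pcmp V (g \<bullet> f) h)
     (\<lambda>w. id2 (nf (gv f) (nf (gv g) (nf (gv h) w))) \<odot>
         (V_comp g f (nf (gv h) w) \<odot> act (gv (g \<bullet> f)) (id2 (nf (gv h) w))) \<odot> V_comp h (g \<bullet> f) w)"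
    by (rule den_intros | simp add: cmp_assoc)+
  have 2: "den ?p ?q ((id2 (v f) \<otimes> Pcmp V g h) \<odot> Pcmp V f (h \<bullet> g))
     (\<lambda>w. (id2 (nf (gv f) (nf (Comp (gv g) (gv h)) w)) \<odot> act (gv f) (V_comp h g w)) \<odot> V_comp (h \<bullet> g) f w)"
    by (rule den_intros | simp add: cmp_assoc)+
  show ?thesis
    using den_unique[OF 1[unfolded eq] 2, of w] by (simp add: cmp_assoc)
qed

text \<open>The left unit axiom of \<open>V\<close> on \<open>cop C\<close> is a right unit law for
  composition in \<open>C\<close>.\<close>

lemma V_comp_runit:
  assumes [simp]: "f \<in> Ar" "w \<in> Hom" "trg w = ob (cd f)" and c: "c = dm f"
  shows "V_unit c (v f \<star> w) \<odot> V_comp f (idt c) w = id2 (v f \<star> w)"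
proof -
  note eq = V_facts(6)[of f, simplified]
  have 1: "den (gv f) (gv f) (blu B (v f) \<odot> (Pid V (dm f) \<otimes> id2 (v f)) \<odot> Pcmp V (idt (dm f)) f)
     (\<lambda>w. id2 (nf (gv f) w) \<odot> (V_unit (dm f) (nf (gv f) w) \<odot> act (gv (idt (dm f))) (id2 (nf (gv f) w))) \<odot>
        V_comp f (idt (dm f)) w)"
    by (rule den_intros | simp)+
  have 2: "den (gv f) (gv f) (id2 (v f)) (\<lambda>w. id2 (nf (gv f) w))"
    by (rule den_intros | simp)+
  show ?thesis unfolding c
    using den_unique[OF 1[unfolded eq] 2, of w] by simp
qed

lemma V_comp_lunit:
  assumes [simp]: "f \<in> Ar" "w \<in> Hom" "trg w = ob (cd f)" and c: "c = cd f"
  shows "Y f (V_unit c w) \<odot> V_comp (idt c) f w = id2 (v f \<star> w)"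
proof -
  note eq = V_facts(7)[of f, simplified]
  have 1: "den (gv f) (gv f) (bru B (v f) \<odot> (id2 (v f) \<otimes> Pid V (cd f)) \<odot> Pcmp V f (idt (cd f)))
     (\<lambda>w. id2 (nf (gv f) w) \<odot> (id2 (nf (gv f) (nf (Unit (ob (cd f))) w)) \<odot> act (gv f) (V_unit (cd f) w)) \<odot>
        V_comp (idt (cd f)) f w)"
    by (rule den_intros | simp)+
  have 2: "den (gv f) (gv f) (id2 (v f)) (\<lambda>w. id2 (nf (gv f) w))"
    by (rule den_intros | simp)+
  show ?thesis unfolding c
    using den_unique[OF 1[unfolded eq] 2, of w] by simp
qed

section \<open>Beck--Chevalley axioms for the inverse cells\<close>

lemma BC_inv_act:
  assumes P: "pb t l r b" and [simp]: "w \<in> Hom" "trg w = ob (cd t)"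
  shows "BC_inv t l r b w \<odot> BC_act t l r b w = id2 (v b \<star> u r \<star> w)"
    "BC_act t l r b w \<odot> BC_inv t l r b w = id2 (u l \<star> v t \<star> w)"
proof -
  note [simp] = pbD[OF P]
  have *: "biso B (BC t l r b)" "dom2 (BC t l r b) = v b \<star> u r" "cod2 (BC t l r b) = u l \<star> v t"
    using BC_cell[OF P] by simp_all
  have 1: "den (Comp (gv b) (gu r)) (Comp (gv b) (gu r)) (binv B (BC t l r b) \<odot> BC t l r b)
      (\<lambda>w. BC_inv t l r b w \<odot> BC_act t l r b w)"
    by (rule den_intros P)+
  have 2: "den (Comp (gv b) (gu r)) (Comp (gv b) (gu r)) (id2 (v b \<star> u r)) (\<lambda>w. id2 (nf (Comp (gv b) (gu r)) w))"
    by (rule den_id) simp_all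
  show "BC_inv t l r b w \<odot> BC_act t l r b w = id2 (v b \<star> u r \<star> w)"
    using den_unique[OF 1[unfolded inv_cell(4)[OF *(1)] *(2)] 2, of w] by simp
  have 1: "den (Comp (gu l) (gv t)) (Comp (gu l) (gv t)) (BC t l r b \<odot> binv B (BC t l r b))
      (\<lambda>w. BC_act t l r b w \<odot> BC_inv t l r b w)"
    by (rule den_intros P)+
  have 2: "den (Comp (gu l) (gv t)) (Comp (gu l) (gv t)) (id2 (u l \<star> v t)) (\<lambda>w. id2 (nf (Comp (gu l) (gv t)) w))"
    by (rule den_id) simp_all
  show "BC_act t l r b w \<odot> BC_inv t l r b w = id2 (u l \<star> v t \<star> w)"
    using den_unique[OF 1[unfolded inv_cell(5)[OF *(1)] *(3)] 2, of w] by simp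
qed

text \<open>Read in the strict calculus, the pasting axiom retains only its Beck--Chevalley and
  composition cells. It is then solved for the inverse of the pasted cell, which reverses the order
  of the two pieces.\<close>

lemma BC_inv_hpaste:
  assumes L: "pb t0 v0 v1 b0" and R: "pb t1 v1 v2 b1" and [simp]: "w \<in> Hom" "trg w = ob (cd t1)"
  shows "V_comp b1 b0 (u v2 \<star> w) \<odot> BC_inv (t1 \<bullet> t0) v0 v2 (b1 \<bullet> b0) w =
    Y b0 (BC_inv t1 v1 v2 b1 w) \<odot> BC_inv t0 v0 v1 b0 (v t1 \<star> w) \<odot> X v0 (V_comp t1 t0 w)"
proof -
  note H = pb_hpaste[OF L R]
  note D [simp] = pbD(1-4)[OF L] pbD(1-4)[OF R]
  have [simp]: "dm v0 = dm t0" "dm v1 = cd t0" "dm t1 = cd t0" "dm b0 = cd v0" "dm v2 = cd t1"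
    "cd b0 = cd v1" "dm b1 = cd v1" "cd b1 = cd v2"
    using pbD(5-8)[OF L] pbD(5-8)[OF R] by simp_all
  note [simp] = L R H
  let ?p = "Comp (gv (b1 \<bullet> b0)) (gu v2)" and ?q = "Comp (gu v0) (Comp (gv t0) (gv t1))"
  \<comment> \<open>The denotation is left existential: the rules determine it by unification, and
    only its value at \<open>w\<close> matters.\<close>
  have "\<exists>s. den ?p ?q ((id2 (u v0) \<otimes> Pcmp V t0 t1) \<odot> BC (t1 \<bullet> t0) v0 v2 (b1 \<bullet> b0)) s \<and>
    s w = X v0 (V_comp t1 t0 w) \<odot> BC_act (t1 \<bullet> t0) v0 v2 (b1 \<bullet> b0) w"
    by (rule exI, rule conjI, (rule den_intros | simp)+)
  then obtain s where s: "den ?p ?q ((id2 (u v0) \<otimes> Pcmp V t0 t1) \<odot> BC (t1 \<bullet> t0) v0 v2 (b1 \<bullet> b0)) s"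
    and s': "s w = X v0 (V_comp t1 t0 w) \<odot> BC_act (t1 \<bullet> t0) v0 v2 (b1 \<bullet> b0) w" by blast
  have "\<exists>t. den ?p ?q (ass (u v0) (v t0) (v t1) \<odot> (BC t0 v0 v1 b0 \<otimes> id2 (v t1)) \<odot> binv B (ass (v b0) (u v1) (v t1)) \<odot>
      (id2 (v b0) \<otimes> BC t1 v1 v2 b1) \<odot> ass (v b0) (v b1) (u v2) \<odot> (Pcmp V b0 b1 \<otimes> id2 (u v2))) t \<and>
      t w = BC_act t0 v0 v1 b0 (v t1 \<star> w) \<odot> Y b0 (BC_act t1 v1 v2 b1 w) \<odot> V_comp b1 b0 (u v2 \<star> w)"
    by (rule exI, rule conjI, (rule den_intros | simp)+)
  then obtain t where t: "den ?p ?q (ass (u v0) (v t0) (v t1) \<odot> (BC t0 v0 v1 b0 \<otimes> id2 (v t1)) \<odot>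
      binv B (ass (v b0) (u v1) (v t1)) \<odot>
      (id2 (v b0) \<otimes> BC t1 v1 v2 b1) \<odot> ass (v b0) (v b1) (u v2) \<odot> (Pcmp V b0 b1 \<otimes> id2 (u v2))) t"
    and t': "t w = BC_act t0 v0 v1 b0 (v t1 \<star> w) \<odot> Y b0 (BC_act t1 v1 v2 b1 w) \<odot> V_comp b1 b0 (u v2 \<star> w)" by blast
  have eq: "X v0 (V_comp t1 t0 w) \<odot> BC_act (t1 \<bullet> t0) v0 v2 (b1 \<bullet> b0) w =
      BC_act t0 v0 v1 b0 (v t1 \<star> w) \<odot> Y b0 (BC_act t1 v1 v2 b1 w) \<odot> V_comp b1 b0 (u v2 \<star> w)"
    unfolding s'[symmetric] t'[symmetric]
    by (rule den_unique[OF s]) (use t pbc_axioms4[THEN conjunct1, rule_format, of t0 v0 v1 b0 t1 v2 b1] in simp_all)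
  show ?thesis
    by (rule vcomp_conjugate[OF eq]) (simp_all add: BC_inv_act lwhisker_vcomp[symmetric])
qed

lemma BC_inv_vpaste:
  assumes T: "pb h0 l0 r0 h1" and Bt: "pb h1 l1 r1 h2" and [simp]: "w \<in> Hom" "trg w = ob (cd h0)"
  shows "Y h2 (U_comp r1 r0 w) \<odot> BC_inv h0 (l1 \<bullet> l0) (r1 \<bullet> r0) h2 w =
    BC_inv h1 l1 r1 h2 (u r0 \<star> w) \<odot> X l1 (BC_inv h0 l0 r0 h1 w) \<odot> U_comp l1 l0 (v h0 \<star> w)"
proof -
  note H = pb_vpaste[OF T Bt]
  note D [simp] = pbD(1-4)[OF T] pbD(1-4)[OF Bt]
  have [simp]: "dm l0 = dm h0" "dm r0 = cd h0" "dm h1 = cd l0" "cd h1 = cd r0" "dm l1 = cd l0" "dm r1 = cd r0"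
    "dm h2 = cd l1" "cd h2 = cd r1"
    using pbD(5-8)[OF T] pbD(5-8)[OF Bt] by simp_all
  note [simp] = T Bt H
  let ?p = "Comp (gv h2) (gu (r1 \<bullet> r0))" and ?q = "Comp (Comp (gu l1) (gu l0)) (gv h0)"
  have "\<exists>s. den ?p ?q ((Pcmp U l1 l0 \<otimes> id2 (v h0)) \<odot> BC h0 (l1 \<bullet> l0) (r1 \<bullet> r0) h2) s \<and>
    s w = U_comp l1 l0 (v h0 \<star> w) \<odot> BC_act h0 (l1 \<bullet> l0) (r1 \<bullet> r0) h2 w"
    by (rule exI, rule conjI, (rule den_intros | simp)+)
  then obtain s where s: "den ?p ?q ((Pcmp U l1 l0 \<otimes> id2 (v h0)) \<odot> BC h0 (l1 \<bullet> l0) (r1 \<bullet> r0) h2) s"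
    and s': "s w = U_comp l1 l0 (v h0 \<star> w) \<odot> BC_act h0 (l1 \<bullet> l0) (r1 \<bullet> r0) h2 w" by blast
  have "\<exists>t. den ?p ?q (binv B (ass (u l1) (u l0) (v h0)) \<odot> (id2 (u l1) \<otimes> BC h0 l0 r0 h1) \<odot>
      ass (u l1) (v h1) (u r0) \<odot> (BC h1 l1 r1 h2 \<otimes> id2 (u r0)) \<odot> binv B (ass (v h2) (u r1) (u r0)) \<odot>
      (id2 (v h2) \<otimes> Pcmp U r1 r0)) t \<and>
      t w = X l1 (BC_act h0 l0 r0 h1 w) \<odot> BC_act h1 l1 r1 h2 (u r0 \<star> w) \<odot> Y h2 (U_comp r1 r0 w)"
    by (rule exI, rule conjI, (rule den_intros | simp)+)
  then obtain t where t: "den ?p ?q (binv B (ass (u l1) (u l0) (v h0)) \<odot> (id2 (u l1) \<otimes> BC h0 l0 r0 h1) \<odot>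
      ass (u l1) (v h1) (u r0) \<odot> (BC h1 l1 r1 h2 \<otimes> id2 (u r0)) \<odot> binv B (ass (v h2) (u r1) (u r0)) \<odot>
      (id2 (v h2) \<otimes> Pcmp U r1 r0)) t"
    and t': "t w = X l1 (BC_act h0 l0 r0 h1 w) \<odot> BC_act h1 l1 r1 h2 (u r0 \<star> w) \<odot> Y h2 (U_comp r1 r0 w)" by blast
  have eq: "U_comp l1 l0 (v h0 \<star> w) \<odot> BC_act h0 (l1 \<bullet> l0) (r1 \<bullet> r0) h2 w =
      X l1 (BC_act h0 l0 r0 h1 w) \<odot> BC_act h1 l1 r1 h2 (u r0 \<star> w) \<odot> Y h2 (U_comp r1 r0 w)"
    unfolding s'[symmetric] t'[symmetric]
    by (rule den_unique[OF s]) (use t pbc_axioms5[THEN conjunct1, rule_format, of h0 l0 r0 h1 l1 r1 h2] in simp_all)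
  show ?thesis
    by (rule vcomp_conjugate[OF eq]) (simp_all add: BC_inv_act lwhisker_vcomp[symmetric])
qed

lemma BC_inv_hunit:
  assumes [simp]: "f \<in> Ar" "w \<in> Hom" "trg w = ob (dm f)" and cc': "c = dm f" "c' = cd f"
  shows "V_unit c' (u f \<star> w) \<odot> BC_inv (idt c) f f (idt c') w = X f (V_unit c w)"
proof -
  note [simp] = pb_hunit
  let ?p = "Comp (gv (idt (cd f))) (gu f)" and ?q = "gu f"
  have "\<exists>s. den ?p ?q (bru B (u f) \<odot> (id2 (u f) \<otimes> Pid V (dm f)) \<odot> BC (idt (dm f)) f f (idt (cd f))) s \<and>
    s w = X f (V_unit (dm f) w) \<odot> BC_act (idt (dm f)) f f (idt (cd f)) w"
    by (rule exI, rule conjI, (rule den_intros | simp)+)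
  then obtain s where s: "den ?p ?q (bru B (u f) \<odot> (id2 (u f) \<otimes> Pid V (dm f)) \<odot> BC (idt (dm f)) f f (idt (cd f))) s"
    and s': "s w = X f (V_unit (dm f) w) \<odot> BC_act (idt (dm f)) f f (idt (cd f)) w" by blast
  have "\<exists>t. den ?p ?q (blu B (u f) \<odot> (Pid V (cd f) \<otimes> id2 (u f))) t \<and> t w = V_unit (cd f) (u f \<star> w)"
    by (rule exI, rule conjI, (rule den_intros | simp)+)
  then obtain t where t: "den ?p ?q (blu B (u f) \<odot> (Pid V (cd f) \<otimes> id2 (u f))) t"
    and t': "t w = V_unit (cd f) (u f \<star> w)" by blast
  have eq: "V_unit (cd f) (u f \<star> w) = X f (V_unit (dm f) w) \<odot> BC_act (idt (dm f)) f f (idt (cd f)) w"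
    unfolding s'[symmetric] t'[symmetric]
    by (rule den_unique[OF t]) (use s pbc_axioms6[THEN conjunct1, rule_format, of f] in simp_all)
  show ?thesis
    unfolding eq cc' by (simp add: vassoc BC_inv_act)
qed

lemma BC_inv_vunit:
  assumes [simp]: "f \<in> Ar" "w \<in> Hom" "trg w = ob (cd f)" and cc': "c = dm f" "c' = cd f"
  shows "Y f (U_unit c' w) \<odot> BC_inv f (idt c) (idt c') f w = U_unit c (v f \<star> w)"
proof -
  note [simp] = pb_vunit
  let ?p = "Comp (gv f) (gu (idt (cd f)))" and ?q = "gv f"
  have "\<exists>s. den ?p ?q (blu B (v f) \<odot> (Pid U (dm f) \<otimes> id2 (v f)) \<odot> BC f (idt (dm f)) (idt (cd f)) f) s \<and>
    s w = U_unit (dm f) (v f \<star> w) \<odot> BC_act f (idt (dm f)) (idt (cd f)) f w"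
    by (rule exI, rule conjI, (rule den_intros | simp)+)
  then obtain s where s: "den ?p ?q (blu B (v f) \<odot> (Pid U (dm f) \<otimes> id2 (v f)) \<odot> BC f (idt (dm f)) (idt (cd f)) f) s"
    and s': "s w = U_unit (dm f) (v f \<star> w) \<odot> BC_act f (idt (dm f)) (idt (cd f)) f w" by blast
  have "\<exists>t. den ?p ?q (bru B (v f) \<odot> (id2 (v f) \<otimes> Pid U (cd f))) t \<and> t w = Y f (U_unit (cd f) w)"
    by (rule exI, rule conjI, (rule den_intros | simp)+)
  then obtain t where t: "den ?p ?q (bru B (v f) \<odot> (id2 (v f) \<otimes> Pid U (cd f))) t"
    and t': "t w = Y f (U_unit (cd f) w)" by blast
  have eq: "Y f (U_unit (cd f) w) = U_unit (dm f) (v f \<star> w) \<odot> BC_act f (idt (dm f)) (idt (cd f)) f w"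
    unfolding s'[symmetric] t'[symmetric]
    by (rule den_unique[OF t]) (use s pbc_axioms6[THEN conjunct2, rule_format, of f] in simp_all)
  show ?thesis
    unfolding eq cc' by (simp add: vassoc BC_inv_act)
qed

section \<open>Moving isomorphisms around a pullback square\<close>

definition eta where
  "eta f w = V_unit (cd f) w \<odot> Y (idt (cd f)) (U_unit (cd f) w) \<odot> BC_inv f f (idt (cd f)) (idt (cd f)) w"

text \<open>The left unitor in \<open>bc_eta\<close> acts as an identity, which is why
  \<open>eta\<close> has no factor for it.\<close>

lemma den_eta:
  assumes f: "iso_arr f"
  shows "den (Comp (gu f) (gv f)) (Unit (ob (cd f))) (bc_eta C B U V BC f) (eta f)"
proof -
  note [simp] = iso_arr_arr[OF f] pb_iso_idt[OF f]
  have "\<exists>s. den (Comp (gu f) (gv f)) (Unit (ob (cd f))) (bc_eta C B U V BC f) s \<and>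
     (\<forall>w. w \<in> Hom \<and> trg w = ob (cd f) \<longrightarrow> s w = eta f w)"
    unfolding bc_eta_def Let_def
    by (rule exI, rule conjI, (rule den_intros | simp)+) (auto simp: eta_def vassoc)
  then show ?thesis by (auto intro: den_cong)
qed

lemma eta_cell [simp]:
  assumes "iso_arr f" "w \<in> Hom" "trg w = ob (cd f)"
  shows "eta f w \<in> Cell" "dom2 (eta f w) = u f \<star> v f \<star> w" "cod2 (eta f w) = w"
  using denD(8-10)[OF den_eta[OF assms(1)], of w] assms iso_arr_arr[OF assms(1)] by simp_all

lemma eta_natural:
  assumes "iso_arr f" "\<kappa> \<in> Cell" "trg (dom2 \<kappa>) = ob (cd f)" "w = dom2 \<kappa>" "w' = cod2 \<kappa>"
  shows "eta f w' \<odot> X f (Y f \<kappa>) = \<kappa> \<odot> eta f w"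
  using den_natural[OF den_eta[OF assms(1)], of \<kappa>] assms iso_arr_arr[OF assms(1)] by simp

text \<open>The square \<open>(t f, f, 1, t)\<close> is the horizontal pasting of
  \<open>(f, f, 1, 1)\<close>, whose inverse cell is \<open>eta f\<close> up to units, with the
  vertical unit square of \<open>t\<close>.\<close>

lemma BC_inv_iso_right_leg:
  assumes iso: "iso_arr f" and [simp]: "t \<in> Ar" "dm t = cd f" "w \<in> Hom" "trg w = ob (cd t)"
  shows "Y t (U_unit (cd t) w) \<odot> BC_inv (t \<bullet> f) f (idt (cd t)) t w = eta f (v t \<star> w) \<odot> X f (V_comp t f w)"
proof -
  let ?c = "cd f" and ?d = "cd t"
  have [simp]: "f \<in> Ar" using iso by (rule iso_arr_arr)
  note [simp] = pb_iso_idt[OF iso] pb_iso'[OF iso, of t]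
  have [simp]: "pb t (idt ?c) (idt ?d) t" using pb_vunit[of t] by simp
  let ?H = "BC_inv (t \<bullet> f) f (idt ?d) t w" and ?R = "BC_inv t (idt ?c) (idt ?d) t w"
    and ?L = "BC_inv f f (idt ?c) (idt ?c) (v t \<star> w)" and ?w = "u (idt ?d) \<star> w"
  \<comment> \<open>Horizontal pasting needs the bottom side in the form
    \<open>t \<bullet> idt (cd f)\<close>; a unit law of \<open>V\<close> is inserted to supply the
    missing cell \<open>V_comp t (idt (cd f))\<close>.\<close>
  have "Y t (U_unit ?d w) \<odot> ?H = Y t (U_unit ?d w) \<odot> (V_unit ?c (v t \<star> ?w) \<odot> V_comp t (idt ?c) ?w) \<odot> ?H"
    by (simp add: V_comp_runit)
  also have "\<dots> = Y t (U_unit ?d w) \<odot> V_unit ?c (v t \<star> ?w) \<odot> V_comp t (idt ?c) ?w \<odot> ?H"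
    by (simp add: vassoc)
  also have "V_comp t (idt ?c) ?w \<odot> ?H = Y (idt ?c) ?R \<odot> ?L \<odot> X f (V_comp t f w)"
    using BC_inv_hpaste[of f f "idt ?c" "idt ?c" t "idt ?d" t w] by simp
  also have "Y t (U_unit ?d w) \<odot> V_unit ?c (v t \<star> ?w) \<odot> \<dots>
     = V_unit ?c (v t \<star> w) \<odot> Y (idt ?c) (Y t (U_unit ?d w)) \<odot> Y (idt ?c) ?R \<odot> ?L \<odot> X f (V_comp t f w)"
    by (rule vcomp_square_reassoc) (simp_all add: V_unit_natural)
  also have "\<dots> = V_unit ?c (v t \<star> w) \<odot> Y (idt ?c) (Y t (U_unit ?d w) \<odot> ?R) \<odot> ?L \<odot> X f (V_comp t f w)"
    by (simp add: vassoc lwhisker_vcomp)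
  also have "Y t (U_unit ?d w) \<odot> ?R = U_unit ?c (v t \<star> w)"
    by (simp add: BC_inv_vunit)
  finally show ?thesis by (simp add: eta_def vassoc)
qed

lemma BC_inv_precomp_iso:
  assumes P: "pb t l r b" and iso: "iso_arr f" and f: "cd f = dm t" and [simp]: "w \<in> Hom" "trg w = ob (cd t)"
  shows "pb (t \<bullet> f) (l \<bullet> f) r b"
    and "BC_inv (t \<bullet> f) (l \<bullet> f) r b w =
      BC_inv t l r b w \<odot> X l (eta f (v t \<star> w) \<odot> X f (V_comp t f w)) \<odot> U_comp l f (v (t \<bullet> f) \<star> w)"
proof -
  have [simp]: "f \<in> Ar" "t \<in> Ar" "l \<in> Ar" "r \<in> Ar" "b \<in> Ar" "dm l = cd f" "dm t = cd f" "dm r = cd t" "dm b = cd l" "cd b = cd r"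
    using pbD[OF P] iso_arr_arr[OF iso] f by simp_all
  note [simp] = P iso pb_iso'[OF iso, of t]
  let ?d = "cd t"
  show Q: "pb (t \<bullet> f) (l \<bullet> f) r b"
    using pb_vpaste[OF pb_iso'[OF iso, of t] , of l r b] by simp
  note [simp] = Q
  let ?T = "BC_inv (t \<bullet> f) f (idt ?d) t w" and ?M = "U_comp l f (v (t \<bullet> f) \<star> w)"
  \<comment> \<open>Vertical pasting has right side \<open>r \<bullet> idt (cd t)\<close>, so a unit
    law of \<open>U\<close> is inserted to supply \<open>U_comp r (idt (cd t))\<close>.\<close>
  have "BC_inv (t \<bullet> f) (l \<bullet> f) r b w
      = Y b (X r (U_unit ?d w) \<odot> U_comp r (idt ?d) w) \<odot> BC_inv (t \<bullet> f) (l \<bullet> f) r b w"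
    by (simp add: U_comp_runit)
  also have "\<dots> = Y b (X r (U_unit ?d w)) \<odot> Y b (U_comp r (idt ?d) w) \<odot> BC_inv (t \<bullet> f) (l \<bullet> f) r b w"
    by (simp add: vassoc lwhisker_vcomp)
  also have "Y b (U_comp r (idt ?d) w) \<odot> BC_inv (t \<bullet> f) (l \<bullet> f) r b w
      = BC_inv t l r b (u (idt ?d) \<star> w) \<odot> X l ?T \<odot> ?M"
    using BC_inv_vpaste[of "t \<bullet> f" f "idt ?d" t l r b w] by simp
  also have "Y b (X r (U_unit ?d w)) \<odot> \<dots> = BC_inv t l r b w \<odot> X l (Y t (U_unit ?d w)) \<odot> X l ?T \<odot> ?M"
    by (rule vcomp_square_reassoc) (simp_all add: BC_inv_natural)
  also have "\<dots> = BC_inv t l r b w \<odot> X l (Y t (U_unit ?d w) \<odot> ?T) \<odot> ?M"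
    by (simp add: vassoc lwhisker_vcomp)
  also have "Y t (U_unit ?d w) \<odot> ?T = eta f (v t \<star> w) \<odot> X f (V_comp t f w)"
    by (simp add: BC_inv_iso_right_leg)
  finally show "BC_inv (t \<bullet> f) (l \<bullet> f) r b w = BC_inv t l r b w \<odot> X l (eta f (v t \<star> w) \<odot> X f (V_comp t f w)) \<odot> ?M" .
qed

text \<open>The square \<open>(f, g f, g, 1)\<close> is the horizontal unit square of
  \<open>g\<close> precomposed with the isomorphism \<open>f\<close>. The contraction
  \<open>V_unit\<close> absorbs the unit square by its axiom and the factor
  \<open>V_comp (idt (cd f)) f\<close> by a unit law of \<open>V\<close>.\<close>

lemma BC_inv_iso_bottom_leg:
  assumes iso: "iso_arr f" and [simp]: "g \<in> Ar" "dm g = cd f" "w \<in> Hom" "trg w = ob (cd f)"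
  shows "V_unit (cd g) (u g \<star> w) \<odot> BC_inv f (g \<bullet> f) g (idt (cd g)) w = X g (eta f w) \<odot> U_comp g f (v f \<star> w)"
proof -
  let ?c = "cd f" and ?d = "cd g"
  have [simp]: "f \<in> Ar" using iso by (rule iso_arr_arr)
  have [simp]: "pb (idt ?c) g g (idt ?d)" using pb_hunit[of g] by simp
  note [simp] = iso
  have "V_unit ?d (u g \<star> w) \<odot> BC_inv f (g \<bullet> f) g (idt ?d) w
     = V_unit ?d (u g \<star> w) \<odot> BC_inv (idt ?c) g g (idt ?d) w \<odot>
         X g (eta f (v (idt ?c) \<star> w) \<odot> X f (V_comp (idt ?c) f w)) \<odot> U_comp g f (v f \<star> w)"
    using BC_inv_precomp_iso(2)[of "idt ?c" g g "idt ?d" f w] by simp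
  also have "\<dots> = X g (V_unit ?c w) \<odot> X g (eta f (v (idt ?c) \<star> w) \<odot> X f (V_comp (idt ?c) f w)) \<odot> U_comp g f (v f \<star> w)"
    by (rule vcomp_reassoc) (simp_all add: BC_inv_hunit)
  also have "\<dots> = X g ((V_unit ?c w \<odot> eta f (v (idt ?c) \<star> w)) \<odot> X f (V_comp (idt ?c) f w)) \<odot> U_comp g f (v f \<star> w)"
    by (simp add: vassoc lwhisker_vcomp)
  also have "V_unit ?c w \<odot> eta f (v (idt ?c) \<star> w) = eta f w \<odot> X f (Y f (V_unit ?c w))"
    by (simp add: eta_natural)
  also have "(eta f w \<odot> X f (Y f (V_unit ?c w))) \<odot> X f (V_comp (idt ?c) f w)
      = eta f w \<odot> X f (Y f (V_unit ?c w) \<odot> V_comp (idt ?c) f w)"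
    by (simp add: vassoc lwhisker_vcomp)
  also have "\<dots> = eta f w"
    by (simp add: V_comp_lunit)
  finally show ?thesis .
qed

text \<open>Pasting the square \<open>(h f, f, 1, h)\<close> below the given one moves
  \<open>f\<close> from the bottom side to the left side.\<close>

lemma BC_inv_iso_left:
  assumes P: "pb t l r (h \<bullet> f)" and iso: "iso_arr f" and h: "h \<in> Ar" "dm h = cd f"
    and [simp]: "w \<in> Hom" "trg w = ob (cd t)"
  shows "pb t (f \<bullet> l) r h"
    and "BC_inv t (f \<bullet> l) r h w = eta f (v h \<star> u r \<star> w) \<odot> X f (V_comp h f (u r \<star> w) \<odot> BC_inv t l r (h \<bullet> f) w) \<odot> U_comp f l (v t \<star> w)"
proof -
  have [simp]: "f \<in> Ar" "h \<in> Ar" "dm h = cd f" using iso_arr_arr[OF iso] h by simp_all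
  have [simp]: "t \<in> Ar" "l \<in> Ar" "r \<in> Ar" "dm l = dm t" "dm r = cd t" "dm f = cd l" "cd h = cd r"
    using pbD[OF P] by simp_all
  let ?d = "cd r"
  have [simp]: "pb (h \<bullet> f) f (idt ?d) h"
    using pb_iso'[OF iso, of h] by simp
  show Q: "pb t (f \<bullet> l) r h"
    using pb_vpaste[OF P, of f "idt ?d" h] by simp
  note [simp] = P Q iso
  let ?T = "BC_inv t l r (h \<bullet> f) w" and ?M = "U_comp f l (v t \<star> w)"
  have "BC_inv t (f \<bullet> l) r h w = Y h (U_unit ?d (u r \<star> w) \<odot> U_comp (idt ?d) r w) \<odot> BC_inv t (f \<bullet> l) r h w"
    by (simp add: U_comp_lunit)
  also have "\<dots> = Y h (U_unit ?d (u r \<star> w)) \<odot> Y h (U_comp (idt ?d) r w) \<odot> BC_inv t (f \<bullet> l) r h w"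
    by (simp add: vassoc lwhisker_vcomp)
  also have "Y h (U_comp (idt ?d) r w) \<odot> BC_inv t (f \<bullet> l) r h w
      = BC_inv (h \<bullet> f) f (idt ?d) h (u r \<star> w) \<odot> X f ?T \<odot> ?M"
    using BC_inv_vpaste[of t l r "h \<bullet> f" f "idt ?d" h w] by simp
  also have "Y h (U_unit ?d (u r \<star> w)) \<odot> \<dots>
      = (eta f (v h \<star> u r \<star> w) \<odot> X f (V_comp h f (u r \<star> w))) \<odot> X f ?T \<odot> ?M"
    by (rule vcomp_reassoc) (use BC_inv_iso_right_leg[OF iso, of h "u r \<star> w"] in simp_all)
  finally show "BC_inv t (f \<bullet> l) r h w = eta f (v h \<star> u r \<star> w) \<odot> X f (V_comp h f (u r \<star> w) \<odot> ?T) \<odot> ?M"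
    by (simp add: vassoc lwhisker_vcomp)
qed

text \<open>Pasting the square \<open>(f, g f, g, 1)\<close> to the right of the given one moves
  \<open>f\<close> from the right side to the top side.\<close>

lemma BC_inv_iso_top:
  assumes P: "pb t l (g \<bullet> f) b" and iso: "iso_arr f" and g: "g \<in> Ar" "dm g = cd f"
    and [simp]: "w \<in> Hom" "trg w = ob (cd f)"
  shows "pb (f \<bullet> t) l g b"
    and "BC_inv (f \<bullet> t) l g b w =
      Y b (X g (eta f w) \<odot> U_comp g f (v f \<star> w)) \<odot> BC_inv t l (g \<bullet> f) b (v f \<star> w) \<odot> X l (V_comp f t w)"
proof -
  have [simp]: "f \<in> Ar" "g \<in> Ar" "dm g = cd f" using iso_arr_arr[OF iso] g by simp_all
  have [simp]: "t \<in> Ar" "l \<in> Ar" "b \<in> Ar" "dm l = dm t" "dm f = cd t" "dm b = cd l" "cd b = cd g"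
    using pbD[OF P] by simp_all
  let ?d = "cd g"
  have [simp]: "pb f (g \<bullet> f) g (idt ?d)"
    using pb_iso[OF iso, of g] by simp
  show Q: "pb (f \<bullet> t) l g b"
    using pb_hpaste[OF P, of f g "idt ?d"] by simp
  note [simp] = P Q iso
  let ?L = "BC_inv t l (g \<bullet> f) b (v f \<star> w)" and ?R = "BC_inv f (g \<bullet> f) g (idt ?d) w" and ?N = "X l (V_comp f t w)"
  have "BC_inv (f \<bullet> t) l g b w = (Y b (V_unit ?d (u g \<star> w)) \<odot> V_comp (idt ?d) b (u g \<star> w)) \<odot> BC_inv (f \<bullet> t) l g b w"
    by (simp add: V_comp_lunit)
  also have "\<dots> = Y b (V_unit ?d (u g \<star> w)) \<odot> V_comp (idt ?d) b (u g \<star> w) \<odot> BC_inv (f \<bullet> t) l g b w"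
    by (simp add: vassoc)
  also have "V_comp (idt ?d) b (u g \<star> w) \<odot> BC_inv (f \<bullet> t) l g b w = Y b ?R \<odot> ?L \<odot> ?N"
    using BC_inv_hpaste[of t l "g \<bullet> f" b f g "idt ?d" w] by simp
  also have "Y b (V_unit ?d (u g \<star> w)) \<odot> \<dots> = Y b (V_unit ?d (u g \<star> w) \<odot> ?R) \<odot> ?L \<odot> ?N"
    by (simp add: vassoc lwhisker_vcomp)
  also have "V_unit ?d (u g \<star> w) \<odot> ?R = X g (eta f w) \<odot> U_comp g f (v f \<star> w)"
    by (simp add: BC_inv_iso_bottom_leg)
  finally show "BC_inv (f \<bullet> t) l g b w = Y b (X g (eta f w) \<odot> U_comp g f (v f \<star> w)) \<odot> ?L \<odot> ?N" .
qed

lemma eta_idt: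
  assumes [simp]: "c \<in> cOb C" "w \<in> Hom" "trg w = ob c"
  shows "eta (idt c) w = U_unit c w \<odot> X (idt c) (V_unit c w)"
proof -
  have [simp]: "pb (idt c) (idt c) (idt c) (idt c)" using pb_hunit[of "idt c"] by simp
  have "eta (idt c) w = V_unit c w \<odot> Y (idt c) (U_unit c w) \<odot> BC_inv (idt c) (idt c) (idt c) (idt c) w"
    by (simp add: eta_def)
  \<comment> \<open>Sliding \<open>V_unit\<close> past \<open>U_unit\<close> brings it next to the
    Beck--Chevalley cell, where the horizontal unit axiom applies.\<close>
  also have "\<dots> = U_unit c w \<odot> V_unit c (u (idt c) \<star> w) \<odot> BC_inv (idt c) (idt c) (idt c) (idt c) w"
    by (rule vcomp_square_reassoc) (simp_all add: V_unit_natural)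
  also have "\<dots> = U_unit c w \<odot> X (idt c) (V_unit c w)"
    by (simp add: BC_inv_hunit)
  finally show ?thesis .
qed

section \<open>Composition cells and 2-cells of spans in the strict calculus\<close>

text \<open>The actions of the composition cells and of the 2-cells \<open>F(\<phi>)\<close>. The former is defined for any
  pullback square, not only the chosen one, so that it can be compared along isomorphisms of apices.\<close>
definition span_cmp where
  "span_cmp f k t l r b w = X k (BC_inv t l r b (v f \<star> w) \<odot> X l (V_comp f t w)) \<odot> U_comp k l (v (f \<bullet> t) \<star> w)"

definition span2 where
  "span2 f g \<phi> w = X g (eta \<phi> (v f \<star> w) \<odot> X \<phi> (V_comp f \<phi> w)) \<odot> U_comp g \<phi> (v (f \<bullet> \<phi>) \<star> w)"

lemma span_cmp_cell:
  assumes "pb t l r b" "f \<in> Ar" "dm f = cd t" "k \<in> Ar" "dm k = cd l" "w \<in> Hom" "trg w = ob (cd f)"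
  shows "span_cmp f k t l r b w \<in> Cell" "dom2 (span_cmp f k t l r b w) = u (k \<bullet> l) \<star> v (f \<bullet> t) \<star> w"
    "cod2 (span_cmp f k t l r b w) = u k \<star> v b \<star> u r \<star> v f \<star> w"
  using assms pbD[OF assms(1)] unfolding span_cmp_def by simp_all

lemma span2_cell:
  assumes "iso_arr \<phi>" "f \<in> Ar" "dm f = cd \<phi>" "g \<in> Ar" "dm g = cd \<phi>" "w \<in> Hom" "trg w = ob (cd f)"
  shows "span2 f g \<phi> w \<in> Cell" "dom2 (span2 f g \<phi> w) = u (g \<bullet> \<phi>) \<star> v (f \<bullet> \<phi>) \<star> w"
    "cod2 (span2 f g \<phi> w) = u g \<star> v f \<star> w"
  using assms iso_arr_arr[OF assms(1)] unfolding span2_def by simp_all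

lemma span2_idt:
  assumes [simp]: "f \<in> Ar" "g \<in> Ar" "dm g = dm f" "w \<in> Hom" "trg w = ob (cd f)"
  shows "span2 f g (idt (dm f)) w = id2 (u g \<star> v f \<star> w)"
proof -
  let ?c = "dm f" and ?w = "v f \<star> w"
  have "span2 f g (idt ?c) w = X g (U_unit ?c ?w \<odot> X (idt ?c) (V_unit ?c ?w \<odot> V_comp f (idt ?c) w)) \<odot> U_comp g (idt ?c) ?w"
    by (simp add: span2_def eta_idt vassoc lwhisker_vcomp)
  also have "\<dots> = id2 (u g \<star> ?w)"
    by (simp add: V_comp_runit U_comp_runit)
  finally show ?thesis .
qed

text \<open>This is \<open>BC_inv_precomp_iso\<close> dressed with composition cells: associativity
  of \<open>U_comp\<close> and \<open>V_comp\<close> regroups \<open>k l \<phi>\<close> and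
  \<open>f t \<phi>\<close>, and naturality moves the remaining factors together. It allows one
  pullback of a cospan to be exchanged for another.\<close>

lemma span_cmp_span2:
  assumes P: "pb t l r b" and iso: "iso_arr \<phi>" and \<phi>: "cd \<phi> = dm t"
    and [simp]: "f \<in> Ar" "dm f = cd t" "k \<in> Ar" "dm k = cd l" "w \<in> Hom" "trg w = ob (cd f)"
  shows "span_cmp f k t l r b w \<odot> span2 (f \<bullet> t) (k \<bullet> l) \<phi> w = span_cmp f k (t \<bullet> \<phi>) (l \<bullet> \<phi>) r b w"
proof -
  have [simp]: "\<phi> \<in> Ar" "t \<in> Ar" "l \<in> Ar" "r \<in> Ar" "b \<in> Ar" "dm l = cd \<phi>" "dm t = cd \<phi>" "dm r = cd t"
    "dm b = cd l" "cd b = cd r"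
    using pbD[OF P] iso_arr_arr[OF iso] \<phi> by simp_all
  note [simp] = P iso BC_inv_precomp_iso(1)[OF P iso \<phi>, of "v f \<star> w"]
  let ?w = "v f \<star> w" and ?W = "v (f \<bullet> t \<bullet> \<phi>) \<star> w" and ?th = "BC_inv t l r b (v f \<star> w)"
  let ?E = "eta \<phi> (v (f \<bullet> t) \<star> w)" and ?N = "V_comp (f \<bullet> t) \<phi> w" and ?N' = "V_comp f t w"
  have "span_cmp f k t l r b w \<odot> span2 (f \<bullet> t) (k \<bullet> l) \<phi> w
     = X k (?th \<odot> X l ?N') \<odot> (U_comp k l (v (f \<bullet> t) \<star> w) \<odot> X (k \<bullet> l) (?E \<odot> X \<phi> ?N)) \<odot> U_comp (k \<bullet> l) \<phi> ?W"
    by (simp add: span_cmp_def span2_def vassoc cmp_assoc)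
  also have "U_comp k l (v (f \<bullet> t) \<star> w) \<odot> X (k \<bullet> l) (?E \<odot> X \<phi> ?N)
     = X k (X l (?E \<odot> X \<phi> ?N)) \<odot> U_comp k l (u \<phi> \<star> ?W)"
    by (rule U_comp_natural) (simp_all add: cmp_assoc)
  also have "X k (?th \<odot> X l ?N') \<odot> (X k (X l (?E \<odot> X \<phi> ?N)) \<odot> U_comp k l (u \<phi> \<star> ?W)) \<odot> U_comp (k \<bullet> l) \<phi> ?W
     = X k (?th \<odot> X l ((?N' \<odot> ?E) \<odot> X \<phi> ?N)) \<odot> U_comp k l (u \<phi> \<star> ?W) \<odot> U_comp (k \<bullet> l) \<phi> ?W"
    by (simp add: vassoc lwhisker_vcomp cmp_assoc)
  also have "U_comp k l (u \<phi> \<star> ?W) \<odot> U_comp (k \<bullet> l) \<phi> ?W = X k (U_comp l \<phi> ?W) \<odot> U_comp k (l \<bullet> \<phi>) ?W"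
    by (simp add: U_comp_assoc)
  also have "?N' \<odot> ?E = eta \<phi> (v t \<star> ?w) \<odot> X \<phi> (Y \<phi> ?N')"
    by (simp add: eta_natural)
  also have "(eta \<phi> (v t \<star> ?w) \<odot> X \<phi> (Y \<phi> ?N')) \<odot> X \<phi> ?N = eta \<phi> (v t \<star> ?w) \<odot> X \<phi> (Y \<phi> ?N' \<odot> ?N)"
    by (simp add: vassoc lwhisker_vcomp cmp_assoc)
  also have "Y \<phi> ?N' \<odot> ?N = V_comp t \<phi> ?w \<odot> V_comp f (t \<bullet> \<phi>) w"
    by (simp add: V_comp_assoc)
  also have "X k (?th \<odot> X l (eta \<phi> (v t \<star> ?w) \<odot> X \<phi> (V_comp t \<phi> ?w \<odot> V_comp f (t \<bullet> \<phi>) w))) \<odot> X k (U_comp l \<phi> ?W) \<odot> U_comp k (l \<bullet> \<phi>) ?W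
     = X k (?th \<odot> X l (eta \<phi> (v t \<star> ?w) \<odot> X \<phi> (V_comp t \<phi> ?w)) \<odot> X l (X \<phi> (V_comp f (t \<bullet> \<phi>) w)) \<odot> U_comp l \<phi> ?W) \<odot> U_comp k (l \<bullet> \<phi>) ?W"
    by (simp add: vassoc lwhisker_vcomp cmp_assoc)
  also have "X l (X \<phi> (V_comp f (t \<bullet> \<phi>) w)) \<odot> U_comp l \<phi> ?W = U_comp l \<phi> (v (t \<bullet> \<phi>) \<star> ?w) \<odot> X (l \<bullet> \<phi>) (V_comp f (t \<bullet> \<phi>) w)"
    by (simp add: U_comp_natural)
  also have "?th \<odot> X l (eta \<phi> (v t \<star> ?w) \<odot> X \<phi> (V_comp t \<phi> ?w)) \<odot> U_comp l \<phi> (v (t \<bullet> \<phi>) \<star> ?w) \<odot> X (l \<bullet> \<phi>) (V_comp f (t \<bullet> \<phi>) w)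
     = (?th \<odot> X l (eta \<phi> (v t \<star> ?w) \<odot> X \<phi> (V_comp t \<phi> ?w)) \<odot> U_comp l \<phi> (v (t \<bullet> \<phi>) \<star> ?w)) \<odot> X (l \<bullet> \<phi>) (V_comp f (t \<bullet> \<phi>) w)"
    by (simp add: vassoc lwhisker_vcomp cmp_assoc)
  also have "?th \<odot> X l (eta \<phi> (v t \<star> ?w) \<odot> X \<phi> (V_comp t \<phi> ?w)) \<odot> U_comp l \<phi> (v (t \<bullet> \<phi>) \<star> ?w)
     = BC_inv (t \<bullet> \<phi>) (l \<bullet> \<phi>) r b ?w"
    using BC_inv_precomp_iso(2)[OF P iso \<phi>, of ?w] by simp
  finally show ?thesis by (simp add: span_cmp_def)
qed

text \<open>Since \<open>eta\<close> is an inverse Beck--Chevalley cell followed by unit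
  contractions, a 2-cell of spans is itself a composition cell up to units. Vertical composition
  thereby becomes a case of \<open>span_cmp_span2\<close>.\<close>

lemma span2_via_span_cmp:
  assumes iso: "iso_arr \<phi>" and [simp]: "f \<in> Ar" "dm f = cd \<phi>" "g \<in> Ar" "dm g = cd \<phi>" "w \<in> Hom" "trg w = ob (cd f)"
  shows "span2 f g \<phi> w = X g (V_unit (cd \<phi>) (v f \<star> w) \<odot> Y (idt (cd \<phi>)) (U_unit (cd \<phi>) (v f \<star> w))) \<odot>
     span_cmp f g \<phi> \<phi> (idt (cd \<phi>)) (idt (cd \<phi>)) w"
proof -
  note [simp] = iso iso_arr_arr[OF iso] pb_iso_idt[OF iso]
  show ?thesis by (simp add: span2_def span_cmp_def eta_def vassoc lwhisker_vcomp)
qed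

lemma span2_comp:
  assumes iso: "iso_arr \<phi>" "iso_arr \<psi>" and [simp]: "cd \<phi> = dm \<psi>" "f \<in> Ar" "dm f = cd \<psi>" "g \<in> Ar" "dm g = cd \<psi>"
    "w \<in> Hom" "trg w = ob (cd f)"
  shows "iso_arr (\<psi> \<bullet> \<phi>)" "span2 f g (\<psi> \<bullet> \<phi>) w = span2 f g \<psi> w \<odot> span2 (f \<bullet> \<psi>) (g \<bullet> \<psi>) \<phi> w"
proof -
  note [simp] = iso iso_arr_arr[OF iso(1)] iso_arr_arr[OF iso(2)]
  have P: "pb \<psi> \<psi> (idt (cd \<psi>)) (idt (cd \<psi>))" by (rule pb_iso_idt) simp
  have Q: "pb (\<psi> \<bullet> \<phi>) (\<psi> \<bullet> \<phi>) (idt (cd \<psi>)) (idt (cd \<psi>))"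
    using BC_inv_precomp_iso(1)[OF P iso(1), of "v f \<star> w"] by simp
  show I: "iso_arr (\<psi> \<bullet> \<phi>)"
  \<comment> \<open>Both legs of the pullback \<open>Q\<close> of two identities are
    \<open>\<psi> \<bullet> \<phi>\<close>. Comparison with the unit square, another pullback of
    these identities, makes this arrow invertible.\<close>
  proof (rule pb_comparison_iso[OF pb_hunit])
    show "pb (idt (dm (idt (cd \<psi>))) \<bullet> \<psi> \<bullet> \<phi>) (idt (cd \<psi>) \<bullet> \<psi> \<bullet> \<phi>) (idt (cd \<psi>)) (idt (cd (idt (cd \<psi>))))"
      using Q by simp
  qed simp_all
  let ?JI = "X g (V_unit (cd \<psi>) (v f \<star> w) \<odot> Y (idt (cd \<psi>)) (U_unit (cd \<psi>) (v f \<star> w)))"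
  note [simp] = span_cmp_cell[OF P] span_cmp_cell[OF Q] span2_cell
  have "span2 f g \<psi> w \<odot> span2 (f \<bullet> \<psi>) (g \<bullet> \<psi>) \<phi> w
     = ?JI \<odot> span_cmp f g \<psi> \<psi> (idt (cd \<psi>)) (idt (cd \<psi>)) w \<odot> span2 (f \<bullet> \<psi>) (g \<bullet> \<psi>) \<phi> w"
    by (subst span2_via_span_cmp) (simp_all add: vassoc cmp_assoc)
  also have "\<dots> = span2 f g (\<psi> \<bullet> \<phi>) w"
    by (simp add: span_cmp_span2[OF P] span2_via_span_cmp[OF I])
  finally show "span2 f g (\<psi> \<bullet> \<phi>) w = span2 f g \<psi> w \<odot> span2 (f \<bullet> \<psi>) (g \<bullet> \<psi>) \<phi> w" ..
qed

text \<open>The isomorphism \<open>\<phi>\<close> moves from the right side to the top and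
  \<open>\<psi>\<close> from the bottom to the left side, one corner at a time; \<open>span2\<close>
  is exactly the correction that these two moves produce.\<close>

lemma span_cmp_natural:
  assumes P: "pb t l (g \<bullet> \<phi>) (h \<bullet> \<psi>)" and iso: "iso_arr \<phi>" "iso_arr \<psi>"
    and [simp]: "f \<in> Ar" "g \<in> Ar" "h \<in> Ar" "k \<in> Ar" "dm f = cd \<phi>" "dm g = cd \<phi>" "dm h = cd \<psi>" "dm k = cd \<psi>"
      "w \<in> Hom" "trg w = ob (cd f)"
  shows "pb (\<phi> \<bullet> t) (\<psi> \<bullet> l) g h"
    and "span2 h k \<psi> (u g \<star> v f \<star> w) \<odot> X (k \<bullet> \<psi>) (Y (h \<bullet> \<psi>) (span2 f g \<phi> w)) \<odot>
       span_cmp (f \<bullet> \<phi>) (k \<bullet> \<psi>) t l (g \<bullet> \<phi>) (h \<bullet> \<psi>) w = span_cmp f k (\<phi> \<bullet> t) (\<psi> \<bullet> l) g h w"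
proof -
  have [simp]: "\<phi> \<in> Ar" "\<psi> \<in> Ar" using iso by (simp_all add: iso_arr_arr)
  have [simp]: "t \<in> Ar" "l \<in> Ar" "dm l = dm t" "dm \<phi> = cd t" "dm \<psi> = cd l" "cd h = cd g"
    using pbD[OF P] by simp_all
  let ?w = "v f \<star> w" and ?W = "v (f \<bullet> \<phi> \<bullet> t) \<star> w" and ?E = "u g \<star> v f \<star> w"
  have Q: "pb (\<phi> \<bullet> t) l g (h \<bullet> \<psi>)"
    by (rule BC_inv_iso_top(1)[OF P iso(1), of ?w]) simp_all
  show R: "pb (\<phi> \<bullet> t) (\<psi> \<bullet> l) g h"
    by (rule BC_inv_iso_left(1)[OF Q iso(2), of ?w]) simp_all
  note [simp] = P Q R iso span2_cell
  let ?L = "BC_inv t l (g \<bullet> \<phi>) (h \<bullet> \<psi>)" and ?\<nu> = "V_comp f (\<phi> \<bullet> t) w"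
  let ?T = "BC_inv (\<phi> \<bullet> t) l g (h \<bullet> \<psi>) ?w"
  let ?Z = "Y (h \<bullet> \<psi>) (span2 f g \<phi> w) \<odot> ?L (v (f \<bullet> \<phi>) \<star> w) \<odot> X l (V_comp (f \<bullet> \<phi>) t w)"
  let ?N = "V_comp f \<phi> w" and ?G = "eta \<psi> (v h \<star> ?E) \<odot> X \<psi> (V_comp h \<psi> ?E)"
  \<comment> \<open>The factors standing under \<open>X (k \<bullet> \<psi>)\<close> do not involve
    the target span of \<open>\<psi>\<close>; among them \<open>\<phi>\<close> is absorbed first, by
    \<open>BC_inv_iso_top\<close>.\<close>
  have Z: "?Z = ?T \<odot> X l ?\<nu>"
  proof -
    have "?Z = Y (h \<bullet> \<psi>) (X g (eta \<phi> ?w)) \<odot> Y (h \<bullet> \<psi>) (X g (X \<phi> ?N) \<odot> U_comp g \<phi> (v (f \<bullet> \<phi>) \<star> w)) \<odot>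
        ?L (v (f \<bullet> \<phi>) \<star> w) \<odot> X l (V_comp (f \<bullet> \<phi>) t w)"
      by (simp add: span2_def vassoc lwhisker_vcomp cmp_assoc)
    also have "X g (X \<phi> ?N) \<odot> U_comp g \<phi> (v (f \<bullet> \<phi>) \<star> w) = U_comp g \<phi> (v \<phi> \<star> ?w) \<odot> X (g \<bullet> \<phi>) ?N"
      by (simp add: U_comp_natural)
    also have "Y (h \<bullet> \<psi>) (X g (eta \<phi> ?w)) \<odot> Y (h \<bullet> \<psi>) (U_comp g \<phi> (v \<phi> \<star> ?w) \<odot> X (g \<bullet> \<phi>) ?N) \<odot>
        ?L (v (f \<bullet> \<phi>) \<star> w) \<odot> X l (V_comp (f \<bullet> \<phi>) t w)
      = Y (h \<bullet> \<psi>) (X g (eta \<phi> ?w) \<odot> U_comp g \<phi> (v \<phi> \<star> ?w)) \<odot>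
        (Y (h \<bullet> \<psi>) (X (g \<bullet> \<phi>) ?N) \<odot> ?L (v (f \<bullet> \<phi>) \<star> w)) \<odot> X l (V_comp (f \<bullet> \<phi>) t w)"
      by (simp add: vassoc lwhisker_vcomp cmp_assoc)
    also have "Y (h \<bullet> \<psi>) (X (g \<bullet> \<phi>) ?N) \<odot> ?L (v (f \<bullet> \<phi>) \<star> w) = ?L (v \<phi> \<star> ?w) \<odot> X l (Y t ?N)"
      by (simp add: BC_inv_natural)
    also have "(?L (v \<phi> \<star> ?w) \<odot> X l (Y t ?N)) \<odot> X l (V_comp (f \<bullet> \<phi>) t w) = ?L (v \<phi> \<star> ?w) \<odot> X l (Y t ?N \<odot> V_comp (f \<bullet> \<phi>) t w)"
      by (simp add: vassoc lwhisker_vcomp cmp_assoc)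
    also have "Y t ?N \<odot> V_comp (f \<bullet> \<phi>) t w = V_comp \<phi> t ?w \<odot> ?\<nu>"
      by (simp add: V_comp_assoc)
    also have "Y (h \<bullet> \<psi>) (X g (eta \<phi> ?w) \<odot> U_comp g \<phi> (v \<phi> \<star> ?w)) \<odot> ?L (v \<phi> \<star> ?w) \<odot> X l (V_comp \<phi> t ?w \<odot> ?\<nu>)
      = (Y (h \<bullet> \<psi>) (X g (eta \<phi> ?w) \<odot> U_comp g \<phi> (v \<phi> \<star> ?w)) \<odot> ?L (v \<phi> \<star> ?w) \<odot> X l (V_comp \<phi> t ?w)) \<odot> X l ?\<nu>"
      by (simp add: vassoc lwhisker_vcomp cmp_assoc)
    also have "Y (h \<bullet> \<psi>) (X g (eta \<phi> ?w) \<odot> U_comp g \<phi> (v \<phi> \<star> ?w)) \<odot> ?L (v \<phi> \<star> ?w) \<odot> X l (V_comp \<phi> t ?w) = ?T"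
      by (rule BC_inv_iso_top(2)[OF P iso(1), symmetric]) simp_all
    finally show ?thesis .
  qed
  have Zc [simp]: "?Z \<in> Cell" "dom2 ?Z = u l \<star> ?W" "cod2 ?Z = v (h \<bullet> \<psi>) \<star> ?E"
    unfolding Z by (simp_all add: cmp_assoc)
  have "span2 h k \<psi> ?E \<odot> X (k \<bullet> \<psi>) (Y (h \<bullet> \<psi>) (span2 f g \<phi> w)) \<odot> span_cmp (f \<bullet> \<phi>) (k \<bullet> \<psi>) t l (g \<bullet> \<phi>) (h \<bullet> \<psi>) w
    = X k ?G \<odot> (U_comp k \<psi> (v (h \<bullet> \<psi>) \<star> ?E) \<odot> X (k \<bullet> \<psi>) ?Z) \<odot> U_comp (k \<bullet> \<psi>) l ?W"
    by (simp add: span_cmp_def span2_def[of h k] vassoc lwhisker_vcomp cmp_assoc)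
  \<comment> \<open>The cell \<open>?Z\<close> moves past the composition cell of \<open>k\<close>
    and \<open>\<psi>\<close> as a whole, so that \<open>\<psi>\<close> can then be absorbed by
    \<open>BC_inv_iso_left\<close>.\<close>
  also have "U_comp k \<psi> (v (h \<bullet> \<psi>) \<star> ?E) \<odot> X (k \<bullet> \<psi>) ?Z = X k (X \<psi> ?Z) \<odot> U_comp k \<psi> (u l \<star> ?W)"
    by (rule U_comp_natural) (simp_all only: Zc, simp_all)
  also have "X k ?G \<odot> (X k (X \<psi> ?Z) \<odot> U_comp k \<psi> (u l \<star> ?W)) \<odot> U_comp (k \<bullet> \<psi>) l ?W
    = X k (?G \<odot> X \<psi> ?Z) \<odot> U_comp k \<psi> (u l \<star> ?W) \<odot> U_comp (k \<bullet> \<psi>) l ?W"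
    unfolding Z by (simp add: vassoc lwhisker_vcomp cmp_assoc)
  also have "U_comp k \<psi> (u l \<star> ?W) \<odot> U_comp (k \<bullet> \<psi>) l ?W = X k (U_comp \<psi> l ?W) \<odot> U_comp k (\<psi> \<bullet> l) ?W"
    by (simp add: U_comp_assoc)
  also have "X k (?G \<odot> X \<psi> ?Z) \<odot> X k (U_comp \<psi> l ?W) \<odot> U_comp k (\<psi> \<bullet> l) ?W
    = X k (?G \<odot> X \<psi> ?T \<odot> X \<psi> (X l ?\<nu>) \<odot> U_comp \<psi> l ?W) \<odot> U_comp k (\<psi> \<bullet> l) ?W"
    unfolding Z by (simp add: vassoc lwhisker_vcomp cmp_assoc)
  also have "X \<psi> (X l ?\<nu>) \<odot> U_comp \<psi> l ?W = U_comp \<psi> l (v (\<phi> \<bullet> t) \<star> ?w) \<odot> X (\<psi> \<bullet> l) ?\<nu>"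
    by (simp add: U_comp_natural)
  also have "?G \<odot> X \<psi> ?T \<odot> U_comp \<psi> l (v (\<phi> \<bullet> t) \<star> ?w) \<odot> X (\<psi> \<bullet> l) ?\<nu>
    = (eta \<psi> (v h \<star> ?E) \<odot> X \<psi> (V_comp h \<psi> ?E \<odot> ?T) \<odot> U_comp \<psi> l (v (\<phi> \<bullet> t) \<star> ?w)) \<odot> X (\<psi> \<bullet> l) ?\<nu>"
    by (simp add: vassoc lwhisker_vcomp cmp_assoc)
  also have "eta \<psi> (v h \<star> ?E) \<odot> X \<psi> (V_comp h \<psi> ?E \<odot> ?T) \<odot> U_comp \<psi> l (v (\<phi> \<bullet> t) \<star> ?w) = BC_inv (\<phi> \<bullet> t) (\<psi> \<bullet> l) g h ?w"
    by (rule BC_inv_iso_left(2)[OF Q iso(2), symmetric]) simp_all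
  finally show "span2 h k \<psi> ?E \<odot> X (k \<bullet> \<psi>) (Y (h \<bullet> \<psi>) (span2 f g \<phi> w)) \<odot>
       span_cmp (f \<bullet> \<phi>) (k \<bullet> \<psi>) t l (g \<bullet> \<phi>) (h \<bullet> \<psi>) w = span_cmp f k (\<phi> \<bullet> t) (\<psi> \<bullet> l) g h w"
    by (simp add: span_cmp_def cmp_assoc)
qed

text \<open>Both sides factor through the corner square \<open>S\<close> between the apices of the
  two composition squares: \<open>S\<close> to the left of \<open>P\<close> gives the square of one
  iterated composite, \<open>S\<close> on top of \<open>R\<close> that of the other. The rest is
  naturality and associativity of the composition cells.\<close>

lemma span_cmp_assoc:
  assumes R: "pb c1 c2 k p" and P: "pb a1 a2 g h" and S: "pb s d2 a2 c1"
    and [simp]: "f \<in> Ar" "dm f = cd a1" "q \<in> Ar" "dm q = cd c2" "w \<in> Hom" "trg w = ob (cd f)"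
  shows "span_cmp h q c1 c2 k p (u g \<star> v f \<star> w) \<odot> span_cmp f (q \<bullet> c2) (a1 \<bullet> s) d2 g (h \<bullet> c1) w =
    X q (Y p (span_cmp f k a1 a2 g h w)) \<odot> span_cmp (f \<bullet> a1) q s (c2 \<bullet> d2) (k \<bullet> a2) p w"
proof -
  have [simp]: "c1 \<in> Ar" "c2 \<in> Ar" "k \<in> Ar" "p \<in> Ar" "a1 \<in> Ar" "a2 \<in> Ar" "g \<in> Ar" "h \<in> Ar" "s \<in> Ar" "d2 \<in> Ar"
    "dm d2 = dm s" "dm a2 = cd s" "dm a1 = cd s" "dm c1 = cd d2" "dm c2 = cd d2" "cd c1 = cd a2"
    "dm k = cd a2" "dm p = cd c2" "cd p = cd k" "dm g = cd a1" "dm h = cd a2" "cd h = cd g"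
    using pbD(1-8)[OF R] pbD(1-8)[OF P] pbD(1-8)[OF S] by simp_all
  note H = pb_hpaste[OF S P] and K = pb_vpaste[OF S R]
  note [simp] = R P S H K span_cmp_cell[OF R] span_cmp_cell[OF P] span_cmp_cell[OF H] span_cmp_cell[OF K]
  let ?E = "u g \<star> v f \<star> w" and ?w = "v f \<star> w" and ?W = "v (f \<bullet> a1 \<bullet> s) \<star> w" and ?w' = "v (f \<bullet> a1) \<star> w"
  let ?R = "BC_inv c1 c2 k p" and ?P = "BC_inv a1 a2 g h ?w" and ?S = "BC_inv s d2 a2 c1"
    and ?H = "BC_inv (a1 \<bullet> s) d2 g (h \<bullet> c1) ?w" and ?K = "BC_inv s (c2 \<bullet> d2) (k \<bullet> a2) p ?w'"
  let ?\<nu> = "V_comp f (a1 \<bullet> s) w" and ?\<nu>' = "V_comp (f \<bullet> a1) s w" and ?N = "V_comp f a1 w"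
  let ?\<omega> = "?P \<odot> X a2 ?N"
  have [simp]: "?w \<in> Hom" "trg (?w) = ob (cd a1)" by simp_all
  have [simp]: "?E \<in> Hom" "trg (?E) = ob (cd g)" by simp_all
  have [simp]: "v h \<star> ?E \<in> Hom" "trg (v h \<star> ?E) = ob (cd a2)" by simp_all
  have [simp]: "u k \<star> v h \<star> ?E \<in> Hom" "trg (u k \<star> v h \<star> ?E) = ob (cd k)" by simp_all
  have [simp]: "v p \<star> u k \<star> v h \<star> ?E \<in> Hom" "trg (v p \<star> u k \<star> v h \<star> ?E) = ob (cd c2)" by simp_all
  have [simp]: "v c1 \<star> v h \<star> ?E \<in> Hom" "trg (v c1 \<star> v h \<star> ?E) = ob (cd d2)" by simp_all
  have [simp]: "v (h \<bullet> c1) \<star> ?E \<in> Hom" "trg (v (h \<bullet> c1) \<star> ?E) = ob (cd d2)" by simp_all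
  have [simp]: "u c2 \<star> v c1 \<star> v h \<star> ?E \<in> Hom" "trg (u c2 \<star> v c1 \<star> v h \<star> ?E) = ob (cd c2)" by simp_all
  have [simp]: "u c2 \<star> v (h \<bullet> c1) \<star> ?E \<in> Hom" "trg (u c2 \<star> v (h \<bullet> c1) \<star> ?E) = ob (cd c2)" by simp_all
  have [simp]: "v a1 \<star> ?w \<in> Hom" "trg (v a1 \<star> ?w) = ob (cd s)" by simp_all
  have [simp]: "u a2 \<star> v a1 \<star> ?w \<in> Hom" "trg (u a2 \<star> v a1 \<star> ?w) = ob (cd a2)" by simp_all
  have [simp]: "v s \<star> v a1 \<star> ?w \<in> Hom" "trg (v s \<star> v a1 \<star> ?w) = ob (dm s)" by simp_all
  have [simp]: "u d2 \<star> v s \<star> v a1 \<star> ?w \<in> Hom" "trg (u d2 \<star> v s \<star> v a1 \<star> ?w) = ob (cd d2)" by simp_all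
  have [simp]: "v c1 \<star> u a2 \<star> v a1 \<star> ?w \<in> Hom" "trg (v c1 \<star> u a2 \<star> v a1 \<star> ?w) = ob (cd d2)" by simp_all
  have [simp]: "?w' \<in> Hom" "trg (?w') = ob (cd s)" by simp_all
  have [simp]: "u a2 \<star> ?w' \<in> Hom" "trg (u a2 \<star> ?w') = ob (cd a2)" by simp_all
  have [simp]: "u k \<star> u a2 \<star> ?w' \<in> Hom" "trg (u k \<star> u a2 \<star> ?w') = ob (cd k)" by simp_all
  have [simp]: "v p \<star> u k \<star> u a2 \<star> ?w' \<in> Hom" "trg (v p \<star> u k \<star> u a2 \<star> ?w') = ob (cd c2)" by simp_all
  have [simp]: "v s \<star> ?w' \<in> Hom" "trg (v s \<star> ?w') = ob (dm s)" by simp_all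
  have [simp]: "u d2 \<star> v s \<star> ?w' \<in> Hom" "trg (u d2 \<star> v s \<star> ?w') = ob (cd d2)" by simp_all
  have [simp]: "u c2 \<star> u d2 \<star> v s \<star> ?w' \<in> Hom" "trg (u c2 \<star> u d2 \<star> v s \<star> ?w') = ob (cd c2)" by simp_all
  have [simp]: "v c1 \<star> u a2 \<star> ?w' \<in> Hom" "trg (v c1 \<star> u a2 \<star> ?w') = ob (cd d2)" by simp_all
  have [simp]: "u c2 \<star> v c1 \<star> u a2 \<star> ?w' \<in> Hom" "trg (u c2 \<star> v c1 \<star> u a2 \<star> ?w') = ob (cd c2)" by simp_all
  have [simp]: "v (a1 \<bullet> s) \<star> ?w \<in> Hom" "trg (v (a1 \<bullet> s) \<star> ?w) = ob (dm s)" by simp_all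
  have [simp]: "u d2 \<star> v (a1 \<bullet> s) \<star> ?w \<in> Hom" "trg (u d2 \<star> v (a1 \<bullet> s) \<star> ?w) = ob (cd d2)" by simp_all
  have [simp]: "?W \<in> Hom" "trg (?W) = ob (dm s)" by simp_all
  have [simp]: "u d2 \<star> ?W \<in> Hom" "trg (u d2 \<star> ?W) = ob (cd d2)" by simp_all
  have [simp]: "u c2 \<star> u d2 \<star> ?W \<in> Hom" "trg (u c2 \<star> u d2 \<star> ?W) = ob (cd c2)" by simp_all
  have [simp]: "u (c2 \<bullet> d2) \<star> ?W \<in> Hom" "trg (u (c2 \<bullet> d2) \<star> ?W) = ob (cd c2)" by simp_all
  \<comment> \<open>The horizontal pasting of \<open>S\<close> with \<open>P\<close>, with the
    three-fold composite \<open>f a1 s\<close> regrouped by \<open>V_comp_assoc\<close>.\<close>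
  have "V_comp h c1 ?E \<odot> ?H \<odot> X d2 ?\<nu> = (Y c1 ?P \<odot> ?S (v a1 \<star> ?w) \<odot> X d2 (V_comp a1 s ?w)) \<odot> X d2 ?\<nu>"
    by (rule vcomp_reassoc) (use BC_inv_hpaste[OF S P, of ?w] in simp_all)
  also have "\<dots> = Y c1 ?P \<odot> ?S (v a1 \<star> ?w) \<odot> X d2 (V_comp a1 s ?w \<odot> ?\<nu>)"
    by (simp add: vassoc lwhisker_vcomp cmp_assoc)
  also have "V_comp a1 s ?w \<odot> ?\<nu> = Y s ?N \<odot> ?\<nu>'"
    by (simp add: V_comp_assoc)
  also have "Y c1 ?P \<odot> ?S (v a1 \<star> ?w) \<odot> X d2 (Y s ?N \<odot> ?\<nu>') = Y c1 ?P \<odot> (?S (v a1 \<star> ?w) \<odot> X d2 (Y s ?N)) \<odot> X d2 ?\<nu>'"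
    by (simp add: vassoc lwhisker_vcomp cmp_assoc)
  also have "?S (v a1 \<star> ?w) \<odot> X d2 (Y s ?N) = Y c1 (X a2 ?N) \<odot> ?S ?w'"
    by (simp add: BC_inv_natural)
  finally have 1: "V_comp h c1 ?E \<odot> ?H \<odot> X d2 ?\<nu> = Y c1 ?\<omega> \<odot> ?S ?w' \<odot> X d2 ?\<nu>'"
    by (simp add: vassoc lwhisker_vcomp cmp_assoc)
  have "span_cmp h q c1 c2 k p ?E \<odot> span_cmp f (q \<bullet> c2) (a1 \<bullet> s) d2 g (h \<bullet> c1) w
    = X q (?R (v h \<star> ?E) \<odot> X c2 (V_comp h c1 ?E)) \<odot> (U_comp q c2 (v (h \<bullet> c1) \<star> ?E) \<odot> X (q \<bullet> c2) (?H \<odot> X d2 ?\<nu>)) \<odot>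
      U_comp (q \<bullet> c2) d2 ?W"
    by (simp add: span_cmp_def vassoc cmp_assoc)
  also have "U_comp q c2 (v (h \<bullet> c1) \<star> ?E) \<odot> X (q \<bullet> c2) (?H \<odot> X d2 ?\<nu>) = X q (X c2 (?H \<odot> X d2 ?\<nu>)) \<odot> U_comp q c2 (u d2 \<star> ?W)"
    by (rule U_comp_natural) simp_all
  also have "X q (?R (v h \<star> ?E) \<odot> X c2 (V_comp h c1 ?E)) \<odot> (X q (X c2 (?H \<odot> X d2 ?\<nu>)) \<odot> U_comp q c2 (u d2 \<star> ?W)) \<odot>
      U_comp (q \<bullet> c2) d2 ?W
    = X q (?R (v h \<star> ?E) \<odot> X c2 (V_comp h c1 ?E \<odot> ?H \<odot> X d2 ?\<nu>)) \<odot> U_comp q c2 (u d2 \<star> ?W) \<odot> U_comp (q \<bullet> c2) d2 ?W"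
    by (simp add: vassoc lwhisker_vcomp cmp_assoc)
  also have "U_comp q c2 (u d2 \<star> ?W) \<odot> U_comp (q \<bullet> c2) d2 ?W = X q (U_comp c2 d2 ?W) \<odot> U_comp q (c2 \<bullet> d2) ?W"
    by (simp add: U_comp_assoc)
  also note 1
  also have "X q (?R (v h \<star> ?E) \<odot> X c2 (Y c1 ?\<omega> \<odot> ?S ?w' \<odot> X d2 ?\<nu>')) \<odot> X q (U_comp c2 d2 ?W) \<odot> U_comp q (c2 \<bullet> d2) ?W
    = X q ((?R (v h \<star> ?E) \<odot> X c2 (Y c1 ?\<omega>)) \<odot> X c2 (?S ?w') \<odot> X c2 (X d2 ?\<nu>') \<odot> U_comp c2 d2 ?W) \<odot> U_comp q (c2 \<bullet> d2) ?W"
    by (simp add: vassoc lwhisker_vcomp cmp_assoc)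
  also have "?R (v h \<star> ?E) \<odot> X c2 (Y c1 ?\<omega>) = Y p (X k ?\<omega>) \<odot> ?R (u a2 \<star> ?w')"
    by (rule BC_inv_natural) simp_all
  also have "X c2 (X d2 ?\<nu>') \<odot> U_comp c2 d2 ?W = U_comp c2 d2 (v s \<star> ?w') \<odot> X (c2 \<bullet> d2) ?\<nu>'"
    by (simp add: U_comp_natural cmp_assoc)
  also have "X q ((Y p (X k ?\<omega>) \<odot> ?R (u a2 \<star> ?w')) \<odot> X c2 (?S ?w') \<odot> U_comp c2 d2 (v s \<star> ?w') \<odot> X (c2 \<bullet> d2) ?\<nu>') \<odot>
      U_comp q (c2 \<bullet> d2) ?W
    = X q (Y p (X k ?\<omega>)) \<odot> X q ((?R (u a2 \<star> ?w') \<odot> X c2 (?S ?w') \<odot> U_comp c2 d2 (v s \<star> ?w')) \<odot> X (c2 \<bullet> d2) ?\<nu>') \<odot>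
      U_comp q (c2 \<bullet> d2) ?W"
    by (simp add: vassoc lwhisker_vcomp cmp_assoc)
  \<comment> \<open>The vertical pasting of \<open>S\<close> onto \<open>R\<close>. These two
    pastings are the only Beck--Chevalley axioms that the lemma uses.\<close>
  also have "?R (u a2 \<star> ?w') \<odot> X c2 (?S ?w') \<odot> U_comp c2 d2 (v s \<star> ?w') = Y p (U_comp k a2 ?w') \<odot> ?K"
    using BC_inv_vpaste[OF S R, of ?w'] by simp
  finally show ?thesis
    by (simp add: span_cmp_def vassoc lwhisker_vcomp cmp_assoc)
qed

text \<open>Naturality moves \<open>U_unit\<close> past the other factors until it cancels against
  \<open>U_comp\<close>. What remains is the square treated by
  \<open>BC_inv_iso_bottom_leg\<close>.\<close>

lemma span_cmp_lunit:
  assumes P: "pb t (g \<bullet> t) g (idt c)" and iso: "iso_arr t" and [simp]: "f \<in> Ar" "g \<in> Ar" "dm g = cd t" "dm f = cd t"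
    "w \<in> Hom" "trg w = ob (cd f)" and c: "c = cd g"
  shows "(U_unit c (u g \<star> v f \<star> w) \<odot> X (idt c) (V_unit c (u g \<star> v f \<star> w))) \<odot> span_cmp f (idt c) t (g \<bullet> t) g (idt c) w = span2 f g t w"
proof -
  note [simp] = P[unfolded c] iso iso_arr_arr[OF iso] c
  let ?w = "v f \<star> w" and ?W = "v (f \<bullet> t) \<star> w" and ?E = "u g \<star> v f \<star> w" and ?N = "V_comp f t w"
  let ?T = "(V_unit c ?E \<odot> BC_inv t (g \<bullet> t) g (idt c) ?w) \<odot> X (g \<bullet> t) ?N"
  have "(U_unit c ?E \<odot> X (idt c) (V_unit c ?E)) \<odot> span_cmp f (idt c) t (g \<bullet> t) g (idt c) w
     = (U_unit c ?E \<odot> X (idt c) ?T) \<odot> U_comp (idt c) (g \<bullet> t) ?W"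
    by (simp add: span_cmp_def vassoc lwhisker_vcomp)
  also have "U_unit c ?E \<odot> X (idt c) ?T = ?T \<odot> U_unit c (u (g \<bullet> t) \<star> ?W)"
    by (rule U_unit_natural) simp_all
  also have "(?T \<odot> U_unit c (u (g \<bullet> t) \<star> ?W)) \<odot> U_comp (idt c) (g \<bullet> t) ?W = ?T"
    by (simp add: vassoc U_comp_lunit)
  also have "V_unit c ?E \<odot> BC_inv t (g \<bullet> t) g (idt c) ?w = X g (eta t ?w) \<odot> U_comp g t (v t \<star> ?w)"
    using BC_inv_iso_bottom_leg[OF iso, of g ?w] by simp
  also have "(X g (eta t ?w) \<odot> U_comp g t (v t \<star> ?w)) \<odot> X (g \<bullet> t) ?N = X g (eta t ?w) \<odot> U_comp g t (v t \<star> ?w) \<odot> X (g \<bullet> t) ?N"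
    by (simp add: vassoc)
  also have "U_comp g t (v t \<star> ?w) \<odot> X (g \<bullet> t) ?N = X g (X t ?N) \<odot> U_comp g t ?W"
    by (simp add: U_comp_natural)
  finally show ?thesis by (simp add: span2_def vassoc lwhisker_vcomp)
qed

text \<open>Here naturality of the Beck--Chevalley cell carries \<open>V_unit\<close> to
  \<open>V_comp\<close>, where a unit law cancels it. What remains is the square treated by
  \<open>BC_inv_iso_right_leg\<close>.\<close>

lemma span_cmp_runit:
  assumes P: "pb (f \<bullet> t) t (idt c) f" and iso: "iso_arr t" and [simp]: "f \<in> Ar" "g \<in> Ar" "dm g = cd t" "dm f = cd t"
    "w \<in> Hom" "trg w = ob (cd f)" and c: "c = cd f"
  shows "X g (Y f (U_unit c w \<odot> X (idt c) (V_unit c w))) \<odot> span_cmp (idt c) g (f \<bullet> t) t (idt c) f w = span2 f g t w"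
proof -
  note [simp] = P[unfolded c] iso iso_arr_arr[OF iso] c
  let ?H = "BC_inv (f \<bullet> t) t (idt c) f" and ?W = "v (f \<bullet> t) \<star> w" and ?N = "V_comp (idt c) (f \<bullet> t) w"
  have "X g (Y f (U_unit c w \<odot> X (idt c) (V_unit c w))) \<odot> span_cmp (idt c) g (f \<bullet> t) t (idt c) f w
    = X g (Y f (U_unit c w) \<odot> (Y f (X (idt c) (V_unit c w)) \<odot> ?H (v (idt c) \<star> w)) \<odot> X t ?N) \<odot> U_comp g t ?W"
    by (simp add: span_cmp_def vassoc lwhisker_vcomp)
  also have "Y f (X (idt c) (V_unit c w)) \<odot> ?H (v (idt c) \<star> w) = ?H w \<odot> X t (Y (f \<bullet> t) (V_unit c w))"
    by (simp add: BC_inv_natural)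
  also have "(?H w \<odot> X t (Y (f \<bullet> t) (V_unit c w))) \<odot> X t ?N = ?H w \<odot> X t (Y (f \<bullet> t) (V_unit c w) \<odot> ?N)"
    by (simp add: vassoc lwhisker_vcomp)
  also have "Y (f \<bullet> t) (V_unit c w) \<odot> ?N = id2 ?W"
    by (simp add: V_comp_lunit)
  also have "Y f (U_unit c w) \<odot> ?H w \<odot> X t (id2 ?W) = Y f (U_unit c w) \<odot> ?H w"
    by simp
  also have "Y f (U_unit c w) \<odot> ?H w = eta t (v f \<star> w) \<odot> X t (V_comp f t w)"
    using BC_inv_iso_right_leg[OF iso, of f w] by simp
  finally show ?thesis by (simp add: span2_def)
qed

section \<open>The prescribed cells in B and the pseudofunctor laws they satisfy\<close>

abbreviation span_expr where "span_expr f g \<equiv> Comp (gu g) (gv f)"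

text \<open>This and the next two definitions repeat the composites of the theorem verbatim, so that
  its clauses hold by unfolding. Here \<open>(f, g)\<close> is the target span; the source legs are
  \<open>f \<bullet> \<phi>\<close> and \<open>g \<bullet> \<phi>\<close>.\<close>

definition Fcell where
  "Fcell f g \<phi> =
         bvc B (bhcc B (bru B (P1 U g)) (bidc B (P1 V f)))
          (bvc B (bhcc B (bhcc B (bidc B (P1 U g)) (bc_eta C B U V BC \<phi>)) (bidc B (P1 V f)))
           (bvc B (bhcc B (bassoc B (P1 U g) (P1 U \<phi>) (P1 V \<phi>)) (bidc B (P1 V f)))
            (bvc B (binv B (bassoc B (bhc B (P1 U g) (P1 U \<phi>)) (P1 V \<phi>) (P1 V f)))
             (bhcc B (Pcmp U g \<phi>) (Pcmp V \<phi> f)))))"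

definition Fcmp where
  "Fcmp f g h k t l =
         bvc B (bassoc B (bhc B (P1 U k) (P1 V h)) (P1 U g) (P1 V f))
          (bvc B (bhcc B (binv B (bassoc B (P1 U k) (P1 V h) (P1 U g))) (bidc B (P1 V f)))
           (bvc B (bhcc B (bhcc B (bidc B (P1 U k)) (binv B (BC t l g h))) (bidc B (P1 V f)))
            (bvc B (bhcc B (bassoc B (P1 U k) (P1 U l) (P1 V t)) (bidc B (P1 V f)))
             (bvc B (binv B (bassoc B (bhc B (P1 U k) (P1 U l)) (P1 V t) (P1 V f)))
              (bhcc B (Pcmp U k l) (Pcmp V t f))))))"

definition Funit where
  "Funit c = bvc B (blu B (bid B (PO U c))) (bhcc B (Pid U c) (Pid V c))"

lemma den_Fcell:
  assumes iso: "iso_arr \<phi>" and [simp]: "f \<in> Ar" "g \<in> Ar" "dm f = cd \<phi>" "dm g = cd \<phi>" and f'g': "f' = f \<bullet> \<phi>" "g' = g \<bullet> \<phi>"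
  shows "den (span_expr f' g') (span_expr f g) (Fcell f g \<phi>) (span2 f g \<phi>)"
proof -
  note [simp] = iso iso_arr_arr[OF iso] f'g'
  have "\<exists>s. den (span_expr f' g') (span_expr f g) (Fcell f g \<phi>) s \<and>
     (\<forall>w. w \<in> Hom \<and> trg w = ob (cd f) \<longrightarrow>
       s w = X g (eta \<phi> (v f \<star> w)) \<odot> U_comp g \<phi> (v \<phi> \<star> v f \<star> w) \<odot> X (g \<bullet> \<phi>) (V_comp f \<phi> w))"
    unfolding Fcell_def
    by (rule exI, rule conjI, (rule den_intros den_eta | simp add: vassoc)+)
  then show ?thesis
    \<comment> \<open>The rules leave \<open>V_comp\<close> as the first factor; naturality of
      \<open>U_comp\<close> moves it into the position it has in \<open>span2\<close>.\<close>
    by (elim exE conjE) (rule den_cong, assumption, simp add: span2_def U_comp_natural vassoc lwhisker_vcomp)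
qed

lemma den_Fcmp:
  assumes P: "pb t l g h" and [simp]: "f \<in> Ar" "k \<in> Ar" "dm f = cd t" "dm k = cd l" and f'g': "f' = f \<bullet> t" "k' = k \<bullet> l"
  shows "den (span_expr f' k') (Comp (span_expr h k) (span_expr f g)) (Fcmp f g h k t l) (span_cmp f k t l g h)"
proof -
  note [simp] = P pbD(1-8)[OF P] f'g'
  have "\<exists>s. den (span_expr f' k') (Comp (span_expr h k) (span_expr f g)) (Fcmp f g h k t l) s \<and>
     (\<forall>w. w \<in> Hom \<and> trg w = ob (cd f) \<longrightarrow>
       s w = X k (BC_inv t l g h (v f \<star> w)) \<odot> U_comp k l (v t \<star> v f \<star> w) \<odot> X (k \<bullet> l) (V_comp f t w))"
    unfolding Fcmp_def
    by (rule exI, rule conjI, (rule den_intros | simp add: vassoc)+)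
  then show ?thesis
    by (elim exE conjE) (rule den_cong, assumption, simp add: span_cmp_def U_comp_natural vassoc lwhisker_vcomp)
qed

lemma den_Funit:
  assumes [simp]: "c \<in> cOb C"
  shows "den (span_expr (idt c) (idt c)) (Unit (ob c)) (Funit c) (\<lambda>w. U_unit c w \<odot> X (idt c) (V_unit c w))"
proof -
  have "\<exists>s. den (span_expr (idt c) (idt c)) (Unit (ob c)) (Funit c) s \<and>
     (\<forall>w. w \<in> Hom \<and> trg w = ob c \<longrightarrow> s w = U_unit c w \<odot> X (idt c) (V_unit c w))"
    unfolding Funit_def
    by (rule exI, rule conjI, (rule den_intros | simp add: vassoc)+)
  then show ?thesis
    by (elim exE conjE) (rule den_cong, assumption, simp)
qed

lemma Fcell_cell:
  assumes "iso_arr \<phi>" "f \<in> Ar" "g \<in> Ar" "dm f = cd \<phi>" "dm g = cd \<phi>"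
  shows "Fcell f g \<phi> \<in> Cell" "dom2 (Fcell f g \<phi>) = u (g \<bullet> \<phi>) \<star> v (f \<bullet> \<phi>)" "cod2 (Fcell f g \<phi>) = u g \<star> v f"
  using denD(5-7)[OF den_Fcell[OF assms refl refl]] by simp_all

lemma Fcmp_cell:
  assumes P: "pb t l g h" and k: "f \<in> Ar" "k \<in> Ar" "dm f = cd t" "dm k = cd l"
  shows "Fcmp f g h k t l \<in> Cell" "dom2 (Fcmp f g h k t l) = u (k \<bullet> l) \<star> v (f \<bullet> t)"
    "cod2 (Fcmp f g h k t l) = (u k \<star> v h) \<star> u g \<star> v f" "biso B (Fcmp f g h k t l)"
proof -
  show "Fcmp f g h k t l \<in> Cell" "dom2 (Fcmp f g h k t l) = u (k \<bullet> l) \<star> v (f \<bullet> t)"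
    "cod2 (Fcmp f g h k t l) = (u k \<star> v h) \<star> u g \<star> v f"
    using denD(5-7)[OF den_Fcmp[OF assms refl refl]] by simp_all
  show "biso B (Fcmp f g h k t l)"
    unfolding Fcmp_def
    using BC_cell[OF P] pbD(1-8)[OF P] k U_facts(3)[of l k] V_facts(3)[of f t] by simp
qed

lemma Funit_cell:
  assumes "c \<in> cOb C"
  shows "Funit c \<in> Cell" "dom2 (Funit c) = u (idt c) \<star> v (idt c)" "cod2 (Funit c) = id1 (ob c)" "biso B (Funit c)"
proof -
  show "Funit c \<in> Cell" "dom2 (Funit c) = u (idt c) \<star> v (idt c)" "cod2 (Funit c) = id1 (ob c)"
    using denD(5-7)[OF den_Funit[OF assms]] by simp_all
  show "biso B (Funit c)"
    unfolding Funit_def using assms U_facts(4)[of c] V_facts(4)[of c] by simp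
qed

lemma Fcell_idt:
  assumes [simp]: "f \<in> Ar" "g \<in> Ar" "dm g = dm f"
  shows "Fcell f g (idt (dm f)) = id2 (u g \<star> v f)"
proof (rule den_eqI)
  show "den (span_expr f g) (span_expr f g) (Fcell f g (idt (dm f))) (span2 f g (idt (dm f)))"
    by (rule den_Fcell) (simp_all add: iso_idt)
  show "den (span_expr f g) (span_expr f g) (id2 (u g \<star> v f)) (\<lambda>w. id2 (nf (span_expr f g) w))"
    by (rule den_id) simp_all
qed (simp_all add: span2_idt)

lemma Fcell_comp:
  assumes iso [simp]: "iso_arr \<phi>" "iso_arr \<psi>" and [simp]: "cd \<phi> = dm \<psi>" "f \<in> Ar" "g \<in> Ar" "dm f = cd \<psi>" "dm g = cd \<psi>"
  shows "Fcell f g (\<psi> \<bullet> \<phi>) = Fcell f g \<psi> \<odot> Fcell (f \<bullet> \<psi>) (g \<bullet> \<psi>) \<phi>"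
proof (rule den_eqI)
  note [simp] = iso_arr_arr[OF iso(1)] iso_arr_arr[OF iso(2)]
  have [simp]: "iso_arr (\<psi> \<bullet> \<phi>)"
    by (rule span2_comp(1)[OF iso, of f g "id1 (ob (cd f))"]) simp_all
  show "den (span_expr (f \<bullet> \<psi> \<bullet> \<phi>) (g \<bullet> \<psi> \<bullet> \<phi>)) (span_expr f g) (Fcell f g (\<psi> \<bullet> \<phi>)) (span2 f g (\<psi> \<bullet> \<phi>))"
    by (rule den_Fcell) simp_all
  show "den (span_expr (f \<bullet> \<psi> \<bullet> \<phi>) (g \<bullet> \<psi> \<bullet> \<phi>)) (span_expr f g) (Fcell f g \<psi> \<odot> Fcell (f \<bullet> \<psi>) (g \<bullet> \<psi>) \<phi>)
      (\<lambda>w. span2 f g \<psi> w \<odot> span2 (f \<bullet> \<psi>) (g \<bullet> \<psi>) \<phi> w)"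
    by (rule den_vcomp[OF den_Fcell den_Fcell]) (simp_all add: cmp_assoc)
qed (simp_all add: span2_comp(2) iso_arr_arr)

text \<open>The map \<open>\<chi>\<close> is known only through its projections, which make it a
  comparison map and hence invertible. Both composites denote \<open>span_cmp\<close> of the square
  \<open>(\<phi> t, \<psi> l, g, h)\<close>: one by absorbing \<open>\<chi>\<close> into the square
  \<open>P'\<close>, the other by \<open>span_cmp_natural\<close>.\<close>

lemma Fcmp_natural:
  assumes P: "pb t l (g \<bullet> \<phi>) (h \<bullet> \<psi>)" and P': "pb t' l' g h" and iso: "iso_arr \<phi>" "iso_arr \<psi>"
    and \<chi>: "\<chi> \<in> Ar" "cd \<chi> = dm t'" "t' \<bullet> \<chi> = \<phi> \<bullet> t" "l' \<bullet> \<chi> = \<psi> \<bullet> l"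
    and fk: "f \<in> Ar" "k \<in> Ar" "dm f = cd \<phi>" "dm k = cd \<psi>" "dm g = cd \<phi>" "dm h = cd \<psi>"
  shows "Fcmp f g h k t' l' \<odot> Fcell (f \<bullet> t') (k \<bullet> l') \<chi> =
    (Fcell h k \<psi> \<otimes> Fcell f g \<phi>) \<odot> Fcmp (f \<bullet> \<phi>) (g \<bullet> \<phi>) (h \<bullet> \<psi>) (k \<bullet> \<psi>) t l"
proof (rule den_eqI)
  have [simp]: "\<phi> \<in> Ar" "\<psi> \<in> Ar" using iso by (simp_all add: iso_arr_arr)
  have [simp]: "g \<in> Ar" "h \<in> Ar" "t' \<in> Ar" "l' \<in> Ar" "cd t' = cd \<phi>" "cd l' = cd \<psi>" "dm l' = dm t'" "cd h = cd g"
    using pbD(1-8)[OF P'] fk by simp_all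
  have [simp]: "t \<in> Ar" "l \<in> Ar" "dm l = dm t" "dm \<phi> = cd t" "dm \<psi> = cd l"
    using pbD(1-8)[OF P] fk by simp_all
  note [simp] = fk \<chi>(1,2)
  let ?I = "id1 (ob (cd f))"
  have Q: "pb (\<phi> \<bullet> t) (\<psi> \<bullet> l) g h"
    by (rule span_cmp_natural(1)[OF P iso, of f k ?I]) simp_all
  have iso\<chi>: "iso_arr \<chi>"
    by (rule pb_comparison_iso[OF P']) (simp_all add: \<chi> Q)
  note [simp] = iso iso\<chi> span2_cell span_cmp_cell[OF P]
  let ?p = "span_expr (f \<bullet> \<phi> \<bullet> t) (k \<bullet> \<psi> \<bullet> l)" and ?q = "Comp (span_expr h k) (span_expr f g)"
  have *: "f \<bullet> t' \<bullet> \<chi> = f \<bullet> \<phi> \<bullet> t" "k \<bullet> l' \<bullet> \<chi> = k \<bullet> \<psi> \<bullet> l" by (simp_all add: \<chi>)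
  show "den ?p ?q (Fcmp f g h k t' l' \<odot> Fcell (f \<bullet> t') (k \<bullet> l') \<chi>)
      (\<lambda>w. span_cmp f k t' l' g h w \<odot> span2 (f \<bullet> t') (k \<bullet> l') \<chi> w)"
    by (rule den_vcomp[OF den_Fcell den_Fcmp[OF P']]) (simp_all add: cmp_assoc *)
  show "den ?p ?q ((Fcell h k \<psi> \<otimes> Fcell f g \<phi>) \<odot> Fcmp (f \<bullet> \<phi>) (g \<bullet> \<phi>) (h \<bullet> \<psi>) (k \<bullet> \<psi>) t l)
      (\<lambda>w. (span2 h k \<psi> (nf (span_expr f g) w) \<odot> act (span_expr (h \<bullet> \<psi>) (k \<bullet> \<psi>)) (span2 f g \<phi> w)) \<odot>
         span_cmp (f \<bullet> \<phi>) (k \<bullet> \<psi>) t l (g \<bullet> \<phi>) (h \<bullet> \<psi>) w)"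
    by (rule den_vcomp[OF den_Fcmp[OF P] den_hcomp2[OF den_Fcell den_Fcell]]) (simp_all add: cmp_assoc)
  fix w assume w: "w \<in> Hom" "esrc ?p = trg w"
  then have [simp]: "w \<in> Hom" "trg w = ob (cd f)" by simp_all
  have "span_cmp f k t' l' g h w \<odot> span2 (f \<bullet> t') (k \<bullet> l') \<chi> w = span_cmp f k (\<phi> \<bullet> t) (\<psi> \<bullet> l) g h w"
    using span_cmp_span2[OF P' iso\<chi>, of f k w] by (simp add: \<chi>)
  also have "\<dots> = span2 h k \<psi> (u g \<star> v f \<star> w) \<odot> X (k \<bullet> \<psi>) (Y (h \<bullet> \<psi>) (span2 f g \<phi> w)) \<odot>
       span_cmp (f \<bullet> \<phi>) (k \<bullet> \<psi>) t l (g \<bullet> \<phi>) (h \<bullet> \<psi>) w"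
    by (rule span_cmp_natural(2)[OF P iso, symmetric]) simp_all
  finally show "span_cmp f k t' l' g h w \<odot> span2 (f \<bullet> t') (k \<bullet> l') \<chi> w =
     (span2 h k \<psi> (nf (span_expr f g) w) \<odot> act (span_expr (h \<bullet> \<psi>) (k \<bullet> \<psi>)) (span2 f g \<phi> w)) \<odot>
         span_cmp (f \<bullet> \<phi>) (k \<bullet> \<psi>) t l (g \<bullet> \<phi>) (h \<bullet> \<psi>) w"
    by (simp add: vassoc)
qed

text \<open>Here \<open>a\<close> is the apex map of the associator of spans and \<open>s\<close>
  its component at the apex of \<open>P\<close>. The associator only exchanges the pullback
  \<open>Q\<close> for the pasting of the corner square with \<open>R\<close>, which reduces the
  claim to \<open>span_cmp_assoc\<close>.\<close>

lemma Fcmp_assoc: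
  assumes R: "pb c1 c2 k p" and T: "pb d1 d2 g (h \<bullet> c1)" and P: "pb a1 a2 g h" and Q: "pb q1 q2 (k \<bullet> a2) p"
    and s: "s \<in> Ar" "cd s = dm a1" "a1 \<bullet> s = d1" "a2 \<bullet> s = c1 \<bullet> d2"
    and a: "a \<in> Ar" "cd a = dm q1" "q1 \<bullet> a = s" "q2 \<bullet> a = c2 \<bullet> d2"
    and fq: "f \<in> Ar" "q \<in> Ar" "dm f = dm g" "dm q = dm p" and hk: "dm h = dm k"
  shows "ass (u q \<star> v p) (u k \<star> v h) (u g \<star> v f) \<odot> (Fcmp h k p q c1 c2 \<otimes> id2 (u g \<star> v f)) \<odot>
      Fcmp f g (h \<bullet> c1) (q \<bullet> c2) d1 d2 =
    (id2 (u q \<star> v p) \<otimes> Fcmp f g h k a1 a2) \<odot> Fcmp (f \<bullet> a1) (k \<bullet> a2) p q q1 q2 \<odot>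
      Fcell ((f \<bullet> a1) \<bullet> q1) (q \<bullet> q2) a"
proof (rule den_eqI)
  have [simp]: "c1 \<in> Ar" "c2 \<in> Ar" "k \<in> Ar" "p \<in> Ar" "g \<in> Ar" "h \<in> Ar" "a1 \<in> Ar" "a2 \<in> Ar" "d2 \<in> Ar" "q1 \<in> Ar" "q2 \<in> Ar"
    "dm c2 = dm c1" "dm k = cd a2" "cd c1 = cd a2" "dm p = cd c2" "cd p = cd k" "dm a1 = cd s" "dm a2 = cd s" "dm g = cd a1" "dm h = cd a2"
    "cd h = cd g" "dm q2 = dm q1" "cd q1 = cd s" "cd q2 = cd c2"
    using pbD(1-8)[OF R] pbD(1-8)[OF P] pbD(1-8)[OF Q] pbD(2)[OF T] hk s by simp_all
  have [simp]: "dm d2 = dm s" "cd d2 = dm c1"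
    using pbD(5-8)[OF T] s(3) s(1,2) by auto
  have [simp]: "f \<in> Ar" "q \<in> Ar" "dm f = cd a1" "dm q = cd c2" "s \<in> Ar" "a \<in> Ar" "cd a = dm q1" using fq s(1) a(1,2) by simp_all
  \<comment> \<open>\<open>T\<close> is the pasting of the corner square with \<open>P\<close>, so
    cancelling \<open>P\<close> leaves the corner square.\<close>
  have S: "pb s d2 a2 c1"
    by (rule pb_hcancel[OF P]) (use T s in simp_all)
  \<comment> \<open>The other pasting of the corner square is a pullback of the same cospan as
    \<open>Q\<close>, with legs that factor through \<open>a\<close>.\<close>
  have K: "pb (q1 \<bullet> a) (q2 \<bullet> a) (k \<bullet> a2) p"
    using pb_vpaste[OF S R] by (simp add: a)
  have isoa: "iso_arr a"
    by (rule pb_comparison_iso[OF Q K]) simp_all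
  note [simp] = isoa span2_cell span_cmp_cell[OF pb_vpaste[OF S R]] span_cmp_cell[OF P] span_cmp_cell[OF Q] span_cmp_cell[OF R] span_cmp_cell[OF T]
  have T': "pb (a1 \<bullet> s) d2 g (h \<bullet> c1)" using T s by simp
  have dm_a: "dm a = dm s" using a(3) by auto
  have d1: "d1 = a1 \<bullet> s" using s by simp
  let ?p = "span_expr (f \<bullet> a1 \<bullet> s) (q \<bullet> c2 \<bullet> d2)" and ?q = "Comp (span_expr p q) (Comp (span_expr h k) (span_expr f g))"
  have *: "f \<bullet> a1 \<bullet> q1 \<bullet> a = f \<bullet> a1 \<bullet> s" "q \<bullet> q2 \<bullet> a = q \<bullet> c2 \<bullet> d2" by (simp_all add: a)
  show "den ?p ?q (ass (u q \<star> v p) (u k \<star> v h) (u g \<star> v f) \<odot> (Fcmp h k p q c1 c2 \<otimes> id2 (u g \<star> v f)) \<odot>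
      Fcmp f g (h \<bullet> c1) (q \<bullet> c2) d1 d2)
     (\<lambda>w. id2 (nf (span_expr p q) (nf (span_expr h k) (nf (span_expr f g) w))) \<odot>
       (span_cmp h q c1 c2 k p (nf (span_expr f g) w) \<odot> act (span_expr (h \<bullet> c1) (q \<bullet> c2)) (id2 (nf (span_expr f g) w))) \<odot>
       span_cmp f (q \<bullet> c2) (a1 \<bullet> s) d2 g (h \<bullet> c1) w)"
    unfolding d1
    by (rule den_vcomp[OF den_vcomp[OF den_Fcmp[OF T'] den_hcomp2[OF den_Fcmp[OF R] den_id]] den_ass])
      (simp_all add: cmp_assoc)
  show "den ?p ?q ((id2 (u q \<star> v p) \<otimes> Fcmp f g h k a1 a2) \<odot> Fcmp (f \<bullet> a1) (k \<bullet> a2) p q q1 q2 \<odot>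
      Fcell ((f \<bullet> a1) \<bullet> q1) (q \<bullet> q2) a)
     (\<lambda>w. (id2 (nf (span_expr p q) (nf (Comp (span_expr h k) (span_expr f g)) w)) \<odot> act (span_expr p q) (span_cmp f k a1 a2 g h w)) \<odot>
        span_cmp (f \<bullet> a1) q q1 q2 (k \<bullet> a2) p w \<odot> span2 ((f \<bullet> a1) \<bullet> q1) (q \<bullet> q2) a w)"
    by (rule den_vcomp[OF den_vcomp[OF den_Fcell den_Fcmp[OF Q]] den_hcomp2[OF den_id den_Fcmp[OF P]]])
      (simp_all add: cmp_assoc *)
  fix w assume w: "w \<in> Hom" "esrc ?p = trg w"
  then have [simp]: "w \<in> Hom" "trg w = ob (cd f)" by simp_all
  have "span_cmp h q c1 c2 k p (u g \<star> v f \<star> w) \<odot> span_cmp f (q \<bullet> c2) (a1 \<bullet> s) d2 g (h \<bullet> c1) w =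
    X q (Y p (span_cmp f k a1 a2 g h w)) \<odot> span_cmp (f \<bullet> a1) q s (c2 \<bullet> d2) (k \<bullet> a2) p w"
    by (rule span_cmp_assoc[OF R P S]) simp_all
  moreover have "span_cmp (f \<bullet> a1) q q1 q2 (k \<bullet> a2) p w \<odot> span2 ((f \<bullet> a1) \<bullet> q1) (q \<bullet> q2) a w =
      span_cmp (f \<bullet> a1) q s (c2 \<bullet> d2) (k \<bullet> a2) p w"
    using span_cmp_span2[OF Q isoa, of "f \<bullet> a1" q w] by (simp add: a)
  ultimately show "id2 (nf (span_expr p q) (nf (span_expr h k) (nf (span_expr f g) w))) \<odot>
       (span_cmp h q c1 c2 k p (nf (span_expr f g) w) \<odot> act (span_expr (h \<bullet> c1) (q \<bullet> c2)) (id2 (nf (span_expr f g) w))) \<odot>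
       span_cmp f (q \<bullet> c2) (a1 \<bullet> s) d2 g (h \<bullet> c1) w =
      (id2 (nf (span_expr p q) (nf (Comp (span_expr h k) (span_expr f g)) w)) \<odot> act (span_expr p q) (span_cmp f k a1 a2 g h w)) \<odot>
        span_cmp (f \<bullet> a1) q q1 q2 (k \<bullet> a2) p w \<odot> span2 ((f \<bullet> a1) \<bullet> q1) (q \<bullet> q2) a w"
    using span_cmp_cell[OF T', of f "q \<bullet> c2" w] by simp
qed

text \<open>A pullback along an identity need not be trivial, but commutativity forces
  \<open>l = g \<bullet> t\<close>, and comparison with the horizontal unit square of
  \<open>g\<close> makes \<open>t\<close> invertible. The unit constraint of spans is this
  \<open>t\<close>.\<close>

lemma Fcmp_lunit:
  assumes P: "pb t l g (idt c)" and f: "f \<in> Ar" "dm f = dm g" and c: "c = cd g"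
  shows "blu B (u g \<star> v f) \<odot> (Funit c \<otimes> id2 (u g \<star> v f)) \<odot> Fcmp f g (idt c) (idt c) t l = Fcell f g t"
proof (rule den_eqI)
  have [simp]: "t \<in> Ar" "g \<in> Ar" "dm g = cd t" "f \<in> Ar" "dm f = cd t"
    using pbD(1-8)[OF P] f by simp_all
  have "c \<in> cOb C" "l \<in> Ar" "cd l = c" using pbD(2,7)[OF P] c by simp_all
  then have l: "l = g \<bullet> t" using pbD(9)[OF P] by simp
  have P': "pb t (g \<bullet> t) g (idt c)" using P l by simp
  have iso: "iso_arr t"
    by (rule pb_comparison_iso[OF pb_hunit[of g]]) (use P' c in simp_all)
  note [simp] = iso span2_cell span_cmp_cell[OF P']
  have [simp]: "c \<in> cOb C" "cd g = c" using c by simp_all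
  show "den (span_expr (f \<bullet> t) (g \<bullet> t)) (span_expr f g)
     (blu B (u g \<star> v f) \<odot> (Funit c \<otimes> id2 (u g \<star> v f)) \<odot> Fcmp f g (idt c) (idt c) t l)
     (\<lambda>w. id2 (nf (span_expr f g) w) \<odot> ((U_unit c (nf (span_expr f g) w) \<odot> X (idt c) (V_unit c (nf (span_expr f g) w))) \<odot>
        act (span_expr (idt c) (idt c)) (id2 (nf (span_expr f g) w))) \<odot> span_cmp f (idt c) t (g \<bullet> t) g (idt c) w)"
    unfolding l
    by (rule den_vcomp[OF den_vcomp[OF den_Fcmp[OF P'] den_hcomp2[OF den_Funit den_id]] den_lu]) simp_all
  show "den (span_expr (f \<bullet> t) (g \<bullet> t)) (span_expr f g) (Fcell f g t) (span2 f g t)"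
    by (rule den_Fcell) simp_all
  fix w assume "w \<in> Hom" "esrc (span_expr (f \<bullet> t) (g \<bullet> t)) = trg w"
  then have [simp]: "w \<in> Hom" "trg w = ob (cd f)" by simp_all
  show "id2 (nf (span_expr f g) w) \<odot> ((U_unit c (nf (span_expr f g) w) \<odot> X (idt c) (V_unit c (nf (span_expr f g) w))) \<odot>
        act (span_expr (idt c) (idt c)) (id2 (nf (span_expr f g) w))) \<odot> span_cmp f (idt c) t (g \<bullet> t) g (idt c) w = span2 f g t w"
    using span_cmp_lunit[OF P' iso, of f w] by simp
qed

text \<open>The mirror case: commutativity forces \<open>t = f \<bullet> l\<close>, and comparison
  with the vertical unit square of \<open>f\<close> makes \<open>l\<close> invertible.\<close>

lemma Fcmp_runit:
  assumes P: "pb t l (idt c) f" and g: "g \<in> Ar" "dm f = dm g" and c: "c = cd f"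
  shows "bru B (u g \<star> v f) \<odot> (id2 (u g \<star> v f) \<otimes> Funit c) \<odot> Fcmp (idt c) (idt c) f g t l = Fcell f g l"
proof (rule den_eqI)
  have [simp]: "l \<in> Ar" "g \<in> Ar" "dm g = cd l" "f \<in> Ar" "dm f = cd l"
    using pbD(1-8)[OF P] g by simp_all
  have "c \<in> cOb C" "t \<in> Ar" "cd t = c" using pbD(1,6)[OF P] c by simp_all
  then have t: "t = f \<bullet> l" using pbD(9)[OF P] by simp
  have P': "pb (f \<bullet> l) l (idt c) f" using P t by simp
  have iso: "iso_arr l"
    by (rule pb_comparison_iso[OF pb_vunit[of f]]) (use P' c in simp_all)
  note [simp] = iso span_cmp_cell[OF P']
  have [simp]: "c \<in> cOb C" "cd f = c" using c by simp_all
  show "den (span_expr (f \<bullet> l) (g \<bullet> l)) (span_expr f g)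
     (bru B (u g \<star> v f) \<odot> (id2 (u g \<star> v f) \<otimes> Funit c) \<odot> Fcmp (idt c) (idt c) f g t l)
     (\<lambda>w. id2 (nf (span_expr f g) w) \<odot> (id2 (nf (span_expr f g) (nf (Unit (ob c)) w)) \<odot>
        act (span_expr f g) (U_unit c w \<odot> X (idt c) (V_unit c w))) \<odot> span_cmp (idt c) g (f \<bullet> l) l (idt c) f w)"
    unfolding t
    by (rule den_vcomp[OF den_vcomp[OF den_Fcmp[OF P'] den_hcomp2[OF den_id den_Funit]] den_ru]) simp_all
  show "den (span_expr (f \<bullet> l) (g \<bullet> l)) (span_expr f g) (Fcell f g l) (span2 f g l)"
    by (rule den_Fcell) simp_all
  fix w assume "w \<in> Hom" "esrc (span_expr (f \<bullet> l) (g \<bullet> l)) = trg w"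
  then have [simp]: "w \<in> Hom" "trg w = ob c" by simp_all
  let ?K = "X g (Y f (U_unit c w \<odot> X (idt c) (V_unit c w)))" and ?c = "span_cmp (idt c) g (f \<bullet> l) l (idt c) f w"
  have K: "?K \<in> Cell" "cod2 ?K = u g \<star> v f \<star> w" by simp_all
  have "?c \<in> Cell" "dom2 ?K = cod2 ?c"
    using span_cmp_cell[OF P', of "idt c" g w] by simp_all
  with K have "cod2 (?K \<odot> ?c) = u g \<star> v f \<star> w" "?K \<odot> ?c \<in> Cell" by simp_all
  moreover have "?K \<odot> ?c = span2 f g l w"
    by (rule span_cmp_runit[OF P' iso]) simp_all
  ultimately show "id2 (nf (span_expr f g) w) \<odot> (id2 (nf (span_expr f g) (nf (Unit (ob c)) w)) \<odot>
        act (span_expr f g) (U_unit c w \<odot> X (idt c) (V_unit c w))) \<odot> span_cmp (idt c) g (f \<bullet> l) l (idt c) f w = span2 f g l w"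
    using K by simp
qed

end

section \<open>The pseudofunctor on spans\<close>

lemma Pith_span_simps [simp]:
  "bObj (Pith (span_bicat C)) = cOb C"
  "bHom (Pith (span_bicat C)) = {(l, r). l \<in> cAr C \<and> r \<in> cAr C \<and> cdom C l = cdom C r}"
  "bsrc (Pith (span_bicat C)) S = ccod C (fst S)"
  "btrg (Pith (span_bicat C)) S = ccod C (snd S)"
  "bdom (Pith (span_bicat C)) \<sigma> = fst \<sigma>"
  "bcod (Pith (span_bicat C)) \<sigma> = fst (snd \<sigma>)"
  "bvc (Pith (span_bicat C)) \<tau> \<sigma> = (fst \<sigma>, fst (snd \<tau>), ccomp C (snd (snd \<tau>)) (snd (snd \<sigma>)))"
  "bhc (Pith (span_bicat C)) = span_hc C"
  "bhcc (Pith (span_bicat C)) = span_hcc C"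
  "bid (Pith (span_bicat C)) c = (cid C c, cid C c)"
  "bidc (Pith (span_bicat C)) S = (S, S, cid C (cdom C (fst S)))"
  "bassoc (Pith (span_bicat C)) = span_assoc C"
  "blu (Pith (span_bicat C)) = span_lu C"
  "bru (Pith (span_bicat C)) = span_ru C"
  by (simp_all add: Pith_def span_bicat_def)

context cat_locale begin

text \<open>A normal form for 2-cells: the source legs are determined by the target legs and the
  apex map, and an inverse 2-cell of spans has an inverse of the apex map as its last
  component.\<close>

lemma Pith_span_cell:
  assumes "\<sigma> \<in> bCell (Pith (span_bicat C))"
  obtains f g \<phi> where "\<sigma> = ((f \<bullet> \<phi>, g \<bullet> \<phi>), (f, g), \<phi>)" "f \<in> Ar" "g \<in> Ar" "iso_arr \<phi>" "dm f = cd \<phi>" "dm g = cd \<phi>"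
proof -
  obtain S T \<phi> where "\<sigma> = (S, T, \<phi>)" by (rule prod_cases3)
  moreover obtain f' g' where "S = (f', g')" by (cases S)
  moreover obtain f g where "T = (f, g)" by (cases T)
  ultimately have \<sigma>: "\<sigma> = ((f', g'), (f, g), \<phi>)" by simp
  have cell: "((f', g'), (f, g), \<phi>) \<in> bCell (span_bicat C) \<longleftrightarrow>
      f' \<in> Ar \<and> g' \<in> Ar \<and> dm f' = dm g' \<and> f \<in> Ar \<and> g \<in> Ar \<and> dm f = dm g \<and> cd f' = cd f \<and> cd g' = cd g \<and>
      \<phi> \<in> Ar \<and> dm \<phi> = dm f' \<and> cd \<phi> = dm f \<and> f \<bullet> \<phi> = f' \<and> g \<bullet> \<phi> = g'" for f g f' g' \<phi>
    by (simp add: span_bicat_def conj_ac)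
  have 1: "f \<in> Ar" "g \<in> Ar" "\<phi> \<in> Ar" "dm f = cd \<phi>" "dm g = cd \<phi>" "dm \<phi> = dm f'" "f \<bullet> \<phi> = f'" "g \<bullet> \<phi> = g'"
    using assms unfolding \<sigma> Pith_def by (simp_all add: cell)
  have "biso (span_bicat C) ((f', g'), (f, g), \<phi>)"
    using assms unfolding \<sigma> by (simp add: Pith_def)
  then obtain \<tau> where \<tau>: "\<tau> \<in> bCell (span_bicat C)" "fst \<tau> = (f, g)" "fst (snd \<tau>) = (f', g')"
    "snd (snd \<tau>) \<bullet> \<phi> = idt (dm f')" "\<phi> \<bullet> snd (snd \<tau>) = idt (dm f)"
    unfolding biso_def by (auto simp: span_bicat_def simp del: cmp_arr cmp_idt)
  then have "((f, g), (f', g'), snd (snd \<tau>)) \<in> bCell (span_bicat C)"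
    by (metis prod.collapse)
  then have "iso_arr \<phi>"
    using 1 \<tau>(4,5) unfolding iso_arr_def cell by (intro conjI bexI[of _ "snd (snd \<tau>)"]) simp_all
  then show thesis using that \<sigma> 1 by blast
qed

end

context pbc_locale begin

definition span_pfun :: "('o, 'a\<times>'a, ('a\<times>'a)\<times>('a\<times>'a)\<times>'a, 'bo, 'bc, 'bt) pfun" where
  "span_pfun = \<lparr>PO = PO U, P1 = (\<lambda>S. u (snd S) \<star> v (fst S)),
     P2 = (\<lambda>\<sigma>. Fcell (fst (fst (snd \<sigma>))) (snd (fst (snd \<sigma>))) (snd (snd \<sigma>))),
     Pcmp = (\<lambda>T S. Fcmp (fst S) (snd S) (fst T) (snd T) (fst (pbk C (snd S) (fst T))) (snd (pbk C (snd S) (fst T)))),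
     Pid = Funit\<rparr>"

lemma span_pfun_simps [simp]:
  "PO span_pfun = PO U"
  "P1 span_pfun S = u (snd S) \<star> v (fst S)"
  "P2 span_pfun \<sigma> = Fcell (fst (fst (snd \<sigma>))) (snd (fst (snd \<sigma>))) (snd (snd \<sigma>))"
  "Pcmp span_pfun T S = Fcmp (fst S) (snd S) (fst T) (snd T) (fst (pbk C (snd S) (fst T))) (snd (pbk C (snd S) (fst T)))"
  "Pid span_pfun = Funit"
  by (simp_all add: span_pfun_def)

lemma pseudofunctor_span_pfun:
  assumes pbs: "has_pullbacks C"
  shows "pseudofunctor (Pith (span_bicat C)) B span_pfun"
proof -
  let ?S = "Pith (span_bicat C)" and ?F = span_pfun
  note pbk = pb_pbk[OF pbs]
  have c1: "\<forall>a\<in>bObj ?S. PO ?F a \<in> bObj B" by simp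
  have c2: "\<forall>x\<in>bHom ?S. P1 ?F x \<in> Hom \<and> src (P1 ?F x) = PO ?F (bsrc ?S x) \<and> trg (P1 ?F x) = PO ?F (btrg ?S x)"
    by auto
  have c3: "\<forall>\<alpha>\<in>bCell ?S. P2 ?F \<alpha> \<in> Cell \<and> dom2 (P2 ?F \<alpha>) = P1 ?F (bdom ?S \<alpha>) \<and> cod2 (P2 ?F \<alpha>) = P1 ?F (bcod ?S \<alpha>)"
    by (auto elim!: Pith_span_cell simp: Fcell_cell)
  have c4: "\<forall>x\<in>bHom ?S. P2 ?F (bidc ?S x) = id2 (P1 ?F x)"
    by clarsimp (metis Fcell_idt)
  have c5: "\<forall>\<alpha>\<in>bCell ?S. \<forall>\<beta>\<in>bCell ?S. bcod ?S \<alpha> = bdom ?S \<beta> \<longrightarrow> P2 ?F (bvc ?S \<beta> \<alpha>) = P2 ?F \<beta> \<odot> P2 ?F \<alpha>"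
  proof (intro ballI impI)
    fix \<alpha> \<beta> assume "\<alpha> \<in> bCell ?S" "\<beta> \<in> bCell ?S" and eq: "bcod ?S \<alpha> = bdom ?S \<beta>"
    then obtain f g \<phi> f' g' \<psi> where \<alpha>: "\<alpha> = ((f \<bullet> \<phi>, g \<bullet> \<phi>), (f, g), \<phi>)" "f \<in> Ar" "g \<in> Ar" "iso_arr \<phi>" "dm f = cd \<phi>" "dm g = cd \<phi>"
      and \<beta>: "\<beta> = ((f' \<bullet> \<psi>, g' \<bullet> \<psi>), (f', g'), \<psi>)" "f' \<in> Ar" "g' \<in> Ar" "iso_arr \<psi>" "dm f' = cd \<psi>" "dm g' = cd \<psi>"
      by (metis Pith_span_cell)
    have fg: "f = f' \<bullet> \<psi>" "g = g' \<bullet> \<psi>" using eq \<alpha>(1) \<beta>(1) by simp_all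
    have "cd \<phi> = dm \<psi>" using \<alpha>(5) fg \<beta> iso_arr_arr[OF \<beta>(4)] by simp
    then have "Fcell f' g' (\<psi> \<bullet> \<phi>) = Fcell f' g' \<psi> \<odot> Fcell (f' \<bullet> \<psi>) (g' \<bullet> \<psi>) \<phi>"
      by (intro Fcell_comp \<alpha> \<beta>)
    then show "P2 ?F (bvc ?S \<beta> \<alpha>) = P2 ?F \<beta> \<odot> P2 ?F \<alpha>"
      by (simp add: \<alpha>(1) \<beta>(1) fg)
  qed
  have c6: "\<forall>x\<in>bHom ?S. \<forall>y\<in>bHom ?S. bsrc ?S y = btrg ?S x \<longrightarrow>
      Pcmp ?F y x \<in> Cell \<and> dom2 (Pcmp ?F y x) = P1 ?F (bhc ?S y x) \<and>
      cod2 (Pcmp ?F y x) = P1 ?F y \<star> P1 ?F x \<and> biso B (Pcmp ?F y x)"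
  proof (intro ballI impI)
    fix x y assume "x \<in> bHom ?S" "y \<in> bHom ?S" "bsrc ?S y = btrg ?S x"
    then obtain f g h k where xy: "x = (f, g)" "y = (h, k)" "f \<in> Ar" "g \<in> Ar" "h \<in> Ar" "k \<in> Ar" "dm f = dm g" "dm h = dm k" "cd h = cd g"
      by auto
    then have P: "pb (fst (pbk C g h)) (snd (pbk C g h)) g h" by (intro pbk) simp_all
    have "dm f = cd (fst (pbk C g h))" "dm k = cd (snd (pbk C g h))" using pbD(6,7)[OF P] xy by simp_all
    from Fcmp_cell[OF P _ _ this] show "Pcmp ?F y x \<in> Cell \<and> dom2 (Pcmp ?F y x) = P1 ?F (bhc ?S y x) \<and>
      cod2 (Pcmp ?F y x) = P1 ?F y \<star> P1 ?F x \<and> biso B (Pcmp ?F y x)"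
      using xy by (simp add: span_hc_def)
  qed
  have c7: "\<forall>\<alpha>\<in>bCell ?S. \<forall>\<beta>\<in>bCell ?S. bsrc ?S (bdom ?S \<beta>) = btrg ?S (bdom ?S \<alpha>) \<longrightarrow>
      Pcmp ?F (bcod ?S \<beta>) (bcod ?S \<alpha>) \<odot> P2 ?F (bhcc ?S \<beta> \<alpha>) =
      (P2 ?F \<beta> \<otimes> P2 ?F \<alpha>) \<odot> Pcmp ?F (bdom ?S \<beta>) (bdom ?S \<alpha>)"
  proof (intro ballI impI)
    fix \<alpha> \<beta> assume "\<alpha> \<in> bCell ?S" "\<beta> \<in> bCell ?S" and eq: "bsrc ?S (bdom ?S \<beta>) = btrg ?S (bdom ?S \<alpha>)"
    then obtain f g \<phi> h k \<psi> where \<alpha>: "\<alpha> = ((f \<bullet> \<phi>, g \<bullet> \<phi>), (f, g), \<phi>)" "f \<in> Ar" "g \<in> Ar" "iso_arr \<phi>" "dm f = cd \<phi>" "dm g = cd \<phi>"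
      and \<beta>: "\<beta> = ((h \<bullet> \<psi>, k \<bullet> \<psi>), (h, k), \<psi>)" "h \<in> Ar" "k \<in> Ar" "iso_arr \<psi>" "dm h = cd \<psi>" "dm k = cd \<psi>"
      by (metis Pith_span_cell)
    have [simp]: "\<phi> \<in> Ar" "\<psi> \<in> Ar" using \<alpha>(4) \<beta>(4) by (simp_all add: iso_arr_arr)
    note [simp] = \<alpha>(2,3,5,6) \<beta>(2,3,5,6)
    have gh [simp]: "cd h = cd g" using eq \<alpha>(1) \<beta>(1) by simp
    let ?P = "pbk C (g \<bullet> \<phi>) (h \<bullet> \<psi>)" and ?P' = "pbk C g h"
    have P: "pb (fst ?P) (snd ?P) (g \<bullet> \<phi>) (h \<bullet> \<psi>)" by (rule pbk) simp_all
    have P': "pb (fst ?P') (snd ?P') g h" by (rule pbk) simp_all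
    note D = pbD(1-8)[OF P] pbD(1-8)[OF P']
    \<comment> \<open>The apex map that \<open>span_hcc\<close> assigns to the horizontal
      composite.\<close>
    let ?\<chi> = "pbmap C ?P' (\<phi> \<bullet> fst ?P) (\<psi> \<bullet> snd ?P)"
    have comm: "g \<bullet> \<phi> \<bullet> fst ?P = h \<bullet> \<psi> \<bullet> snd ?P"
      using pbD(9)[OF P] D by (simp add: cmp_assoc)
    have X: "?\<chi> \<in> Ar" "cd ?\<chi> = dm (fst ?P')" "fst ?P' \<bullet> ?\<chi> = \<phi> \<bullet> fst ?P" "snd ?P' \<bullet> ?\<chi> = \<psi> \<bullet> snd ?P"
      using D comm by (simp_all add: pbmap_props[OF P'])
    show "Pcmp ?F (bcod ?S \<beta>) (bcod ?S \<alpha>) \<odot> P2 ?F (bhcc ?S \<beta> \<alpha>) =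
      (P2 ?F \<beta> \<otimes> P2 ?F \<alpha>) \<odot> Pcmp ?F (bdom ?S \<beta>) (bdom ?S \<alpha>)"
      using Fcmp_natural[OF P P' \<alpha>(4) \<beta>(4) X, of f k] by (simp add: \<alpha>(1) \<beta>(1) span_hcc_def span_hc_def)
  qed
  have c8: "\<forall>a\<in>bObj ?S. Pid ?F a \<in> Cell \<and> dom2 (Pid ?F a) = P1 ?F (bid ?S a) \<and>
        cod2 (Pid ?F a) = id1 (PO ?F a) \<and> biso B (Pid ?F a)"
    by (simp add: Funit_cell)
  have c9: "\<forall>x\<in>bHom ?S. \<forall>y\<in>bHom ?S. \<forall>z\<in>bHom ?S. bsrc ?S y = btrg ?S x \<and> bsrc ?S z = btrg ?S y \<longrightarrow>
        ass (P1 ?F z) (P1 ?F y) (P1 ?F x) \<odot> (Pcmp ?F z y \<otimes> id2 (P1 ?F x)) \<odot> Pcmp ?F (bhc ?S z y) x =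
        (id2 (P1 ?F z) \<otimes> Pcmp ?F y x) \<odot> Pcmp ?F z (bhc ?S y x) \<odot> P2 ?F (bassoc ?S z y x)"
  proof (intro ballI impI)
    fix x y z assume "x \<in> bHom ?S" "y \<in> bHom ?S" "z \<in> bHom ?S" "bsrc ?S y = btrg ?S x \<and> bsrc ?S z = btrg ?S y"
    then obtain f g h k p q where xyz: "x = (f, g)" "y = (h, k)" "z = (p, q)"
      and ar [simp]: "f \<in> Ar" "g \<in> Ar" "h \<in> Ar" "k \<in> Ar" "p \<in> Ar" "q \<in> Ar"
      and dms: "dm f = dm g" "dm h = dm k" "dm q = dm p" "cd h = cd g" "cd p = cd k"
      by auto
    let ?R = "pbk C k p" and ?P = "pbk C g h"
    let ?T = "pbk C g (h \<bullet> fst ?R)" and ?Q = "pbk C (k \<bullet> snd ?P) p"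
    have R: "pb (fst ?R) (snd ?R) k p" by (rule pbk) (use dms in simp_all)
    have P: "pb (fst ?P) (snd ?P) g h" by (rule pbk) (use dms in simp_all)
    have T: "pb (fst ?T) (snd ?T) g (h \<bullet> fst ?R)" by (rule pbk) (use dms pbD[OF R] in simp_all)
    have Q: "pb (fst ?Q) (snd ?Q) (k \<bullet> snd ?P) p" by (rule pbk) (use dms pbD[OF P] in simp_all)
    note D = dms pbD(1-8)[OF R] pbD(1-8)[OF P] pbD(1-8)[OF T] pbD(1-8)[OF Q]
    \<comment> \<open>\<open>?s\<close> and \<open>?a\<close> are the maps occurring in
      \<open>span_assoc\<close>. Both start at the apex of \<open>?T\<close>; \<open>?s\<close> ends
      at the apex of \<open>?P\<close> and \<open>?a\<close> at that of \<open>?Q\<close>.\<close>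
    let ?s = "pbmap C ?P (fst ?T) (fst ?R \<bullet> snd ?T)"
    let ?a = "pbmap C ?Q ?s (snd ?R \<bullet> snd ?T)"
    have "g \<bullet> fst ?T = h \<bullet> fst ?R \<bullet> snd ?T"
      using pbD(9)[OF T] D by (simp add: cmp_assoc)
    then have s: "?s \<in> Ar" "dm ?s = dm (fst ?T)" "cd ?s = dm (fst ?P)" "fst ?P \<bullet> ?s = fst ?T" "snd ?P \<bullet> ?s = fst ?R \<bullet> snd ?T"
      using D by (simp_all add: pbmap_props[OF P])
    have "k \<bullet> fst ?R \<bullet> snd ?T = p \<bullet> snd ?R \<bullet> snd ?T"
      by (rule cmp_square_reassoc[OF pbD(9)[OF R]]) (use D in simp_all)
    then have "(k \<bullet> snd ?P) \<bullet> ?s = p \<bullet> snd ?R \<bullet> snd ?T"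
      using D s by (simp add: cmp_assoc)
    then have a: "?a \<in> Ar" "cd ?a = dm (fst ?Q)" "fst ?Q \<bullet> ?a = ?s" "snd ?Q \<bullet> ?a = snd ?R \<bullet> snd ?T"
      using D s by (simp_all add: pbmap_props[OF Q])
    show "ass (P1 ?F z) (P1 ?F y) (P1 ?F x) \<odot> (Pcmp ?F z y \<otimes> id2 (P1 ?F x)) \<odot> Pcmp ?F (bhc ?S z y) x =
        (id2 (P1 ?F z) \<otimes> Pcmp ?F y x) \<odot> Pcmp ?F z (bhc ?S y x) \<odot> P2 ?F (bassoc ?S z y x)"
      using Fcmp_assoc[OF R T P Q s(1,3-) a, of f q] dms by (simp add: xyz span_assoc_def span_hc_def Let_def)
  qed
  have c10: "\<forall>x\<in>bHom ?S. blu B (P1 ?F x) \<odot> (Pid ?F (btrg ?S x) \<otimes> id2 (P1 ?F x)) \<odot> Pcmp ?F (bid ?S (btrg ?S x)) x =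
        P2 ?F (blu ?S x)"
  proof
    fix x assume "x \<in> bHom ?S"
    then obtain f g where x: "x = (f, g)" and ar: "f \<in> Ar" "g \<in> Ar" "dm f = dm g" by auto
    have P: "pb (fst (pbk C g (idt (cd g)))) (snd (pbk C g (idt (cd g)))) g (idt (cd g))"
      by (rule pbk) (use ar in simp_all)
    show "blu B (P1 ?F x) \<odot> (Pid ?F (btrg ?S x) \<otimes> id2 (P1 ?F x)) \<odot> Pcmp ?F (bid ?S (btrg ?S x)) x = P2 ?F (blu ?S x)"
      using Fcmp_lunit[OF P ar(1,3)] by (simp add: x span_lu_def Let_def)
  qed
  have c11: "\<forall>x\<in>bHom ?S. bru B (P1 ?F x) \<odot> (id2 (P1 ?F x) \<otimes> Pid ?F (bsrc ?S x)) \<odot> Pcmp ?F x (bid ?S (bsrc ?S x)) =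
        P2 ?F (bru ?S x)"
  proof
    fix x assume "x \<in> bHom ?S"
    then obtain f g where x: "x = (f, g)" and ar: "f \<in> Ar" "g \<in> Ar" "dm f = dm g" by auto
    have P: "pb (fst (pbk C (idt (cd f)) f)) (snd (pbk C (idt (cd f)) f)) (idt (cd f)) f"
      by (rule pbk) (use ar in simp_all)
    show "bru B (P1 ?F x) \<odot> (id2 (P1 ?F x) \<otimes> Pid ?F (bsrc ?S x)) \<odot> Pcmp ?F x (bid ?S (bsrc ?S x)) = P2 ?F (bru ?S x)"
      using Fcmp_runit[OF P ar(2,3)] by (simp add: x span_ru_def Let_def)
  qed
  show ?thesis
    unfolding pseudofunctor_def by (intro conjI c1 c2 c3 c4 c5 c6 c7 c8 c9 c10 c11)
qed

end

theorem mainTheorem7: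
  fixes C :: "('o,'a) cat" and B :: "('bo,'bc,'bt) bicat"
    and U V :: "('o,'a,'a,'bo,'bc,'bt) pfun"
    and BC :: "'a \<Rightarrow> 'a \<Rightarrow> 'a \<Rightarrow> 'a \<Rightarrow> 'bt"
  assumes "category C" and "has_pullbacks C" and "bicategory B"
    and "pbc_system C B U V BC"
  shows "\<exists>F :: ('o, 'a\<times>'a, ('a\<times>'a)\<times>('a\<times>'a)\<times>'a, 'bo, 'bc, 'bt) pfun.
    pseudofunctor (Pith (span_bicat C)) B F \<and>
    (\<forall>c\<in>cOb C. PO F c = PO U c) \<and>
    (\<forall>f g. (f, g) \<in> bHom (span_bicat C) \<longrightarrow> P1 F (f, g) = bhc B (P1 U g) (P1 V f)) \<and>
    (\<forall>f g f' g' \<phi>. ((f, g), (f', g'), \<phi>) \<in> bCell (Pith (span_bicat C)) \<longrightarrow>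
       P2 F ((f, g), (f', g'), \<phi>) =
         bvc B (bhcc B (bru B (P1 U g')) (bidc B (P1 V f')))
          (bvc B (bhcc B (bhcc B (bidc B (P1 U g')) (bc_eta C B U V BC \<phi>)) (bidc B (P1 V f')))
           (bvc B (bhcc B (bassoc B (P1 U g') (P1 U \<phi>) (P1 V \<phi>)) (bidc B (P1 V f')))
            (bvc B (binv B (bassoc B (bhc B (P1 U g') (P1 U \<phi>)) (P1 V \<phi>) (P1 V f')))
             (bhcc B (Pcmp U g' \<phi>) (Pcmp V \<phi> f')))))) \<and>
    (\<forall>f g h k. (f, g) \<in> bHom (span_bicat C) \<and> (h, k) \<in> bHom (span_bicat C) \<and> ccod C h = ccod C g \<longrightarrow>
       (let \<pi>1 = fst (pbk C g h); \<pi>2 = snd (pbk C g h) in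
        Pcmp F (h, k) (f, g) =
         bvc B (bassoc B (bhc B (P1 U k) (P1 V h)) (P1 U g) (P1 V f))
          (bvc B (bhcc B (binv B (bassoc B (P1 U k) (P1 V h) (P1 U g))) (bidc B (P1 V f)))
           (bvc B (bhcc B (bhcc B (bidc B (P1 U k)) (binv B (BC \<pi>1 \<pi>2 g h))) (bidc B (P1 V f)))
            (bvc B (bhcc B (bassoc B (P1 U k) (P1 U \<pi>2) (P1 V \<pi>1)) (bidc B (P1 V f)))
             (bvc B (binv B (bassoc B (bhc B (P1 U k) (P1 U \<pi>2)) (P1 V \<pi>1) (P1 V f)))
              (bhcc B (Pcmp U k \<pi>2) (Pcmp V \<pi>1 f)))))))) \<and>
    (\<forall>c\<in>cOb C. Pid F c = bvc B (blu B (bid B (PO U c))) (bhcc B (Pid U c) (Pid V c)))"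
proof -
  interpret pbc_locale B C U V BC
    using assms by unfold_locales
  show ?thesis
    by (rule exI[of _ span_pfun])
      (simp add: pseudofunctor_span_pfun[OF assms(2)] Fcell_def Fcmp_def Funit_def Let_def)
qed

end
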